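(* Let $0<q<1$ and $l>0$. The bounded selfadjoint operator $I_1=\frac a2 q^{J_0}-b-\frac12\, q^{J_0/4}(J_++J_-)q^{J_0/4}$ on the Hilbert space $\mathcal H_l$, where $b=(q^{1/2}-q^{-1/2})^{-1}$ and $a=(q^{1/4}+q^{-1/4})b$, has a continuous and simple spectrum, which covers the finite interval $[0,\,2q^{1/2}/(1-q)]$. The corresponding (generalized) eigenfunctions, $I_1\,\xi^l_\lambda=\lambda\,\xi^l_\lambda$ with $\lambda=\frac{1-\cos\theta}{q^{-1/2}-q^{1/2}}$, are $$\xi^l_{\lambda}(x;q)=\frac{(q^{l/2}x;q)_\infty\,(q^{(l+1)/2}x;q)_\infty}{(q^{(1-2l)/4}e^{\mathrm i\theta}x;q)_\infty\,(q^{(1-2l)/4}e^{-\mathrm i\theta}x;q)_\infty},$$ and they are related to the orthonormal basis $f^l_n$ of $\mathcal H_l$ by $$\xi^l_\lambda(x;q)=\sum_{n=0}^\infty p_n(\lambda)\,f^l_n(x;q),\qquad p_n(\lambda)=\frac{q^{(1/4-l)n}(q;q)_n^{1/2}}{(q^{2l};q)_n^{1/2}}\,P_n^{(2l-1)}\bigl(1-(q^{-1/2}-q^{1/2})\lambda\,\big|\,q\bigr),$$ where $P_n^{(\alpha)}(\cdot|q)$ are the continuous $q$-Laguerre polynomials.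
   Context: Notation: $(a;q)_n=\prod_{r=0}^{n-1}(1-aq^r)$, $(a;q)_\infty=\prod_{r\ge0}(1-aq^r)$, $[c]_q=\frac{q^{c/2}-q^{-c/2}}{q^{1/2}-q^{-1/2}}$. Discrete series representation $T_l^+$ of $U_q(\mathrm{su}_{1,1})$ ($l>0$): $\mathcal H_l$ is the Hilbert space with orthonormal basis the monomials $f^l_n(x;q)=c^l_n(q)x^n$, $n=0,1,2,\dots$, where $c^l_n(q)=q^{(1-2l)n/4}\left(\frac{(q^{2l};q)_n}{(q;q)_n}\right)^{1/2}$. The operators act by $J_0f^l_n=(l+n)f^l_n$, $J_+f^l_n=\sqrt{[2l+n]_q[n+1]_q}\,f^l_{n+1}$, $J_-f^l_n=\sqrt{[2l+n-1]_q[n]_q}\,f^l_{n-1}$, and $q^{cJ_0}f^l_n=q^{c(l+n)}f^l_n$. Thus $I_1$ is given by a tridiagonal (Jacobi) matrix in the basis $f^l_n$ and also acts on arbitrary formal power series $\sum_n a_n f_n^l$ (coefficientwise). The generalized eigenfunctions are power series in $x$ that need not belong to $\mathcal H_l$, and the eigenvalue equation is understood for this action. Continuous $q$-Laguerre polynomials: for $y=\cos\theta$, $$P_n^{(\alpha)}(y|q)=\frac{(q^{\alpha+1};q)_n}{(q;q)_n}\sum_{k=0}^n\frac{(q^{-n};q)_k\,(q^{\alpha/2+1/4}e^{\mathrm i\theta};q)_k\,(q^{\alpha/2+1/4}e^{-\mathrm i\theta};q)_k}{(q^{\alpha+1};q)_k\,(q;q)_k}\,q^k .$$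
   Formalization: For 0<l<1/4 the operator also has a negative eigenvalue, so the claim that the whole spectrum is continuous and equals the interval is made only for l ≥ 1/4; for every l>0 the continuous spectrum is shown to be exactly the interval. *)

theory Defs
  imports "HOL-Analysis.Analysis"
begin

section \<open>\<open>q\<close>-notation\<close>

definition qpoch :: "'a::comm_ring_1 \<Rightarrow> 'a \<Rightarrow> nat \<Rightarrow> 'a" where
  "qpoch a q n = (\<Prod>r<n. 1 - a * q ^ r)"

definition qpoch_inf :: "complex \<Rightarrow> complex \<Rightarrow> complex" where
  "qpoch_inf a q = (\<Prod>r. 1 - a * q ^ r)"

definition qnum :: "real \<Rightarrow> real \<Rightarrow> real" where
  "qnum q c = (q powr (c/2) - q powr (-c/2)) / (q powr (1/2) - q powr (-1/2))"

text \<open>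
  The continuous \<open>q\<close>-Laguerre polynomial at \<open>y = cos \<theta>\<close>.  Every complex \<open>y\<close> is the cosine of
  \<open>Arccos y\<close>, and the value does not depend on the choice of \<open>\<theta>\<close>, see \<open>cq_laguerre_cos\<close> below.
\<close>

definition cq_laguerre_trig :: "real \<Rightarrow> real \<Rightarrow> nat \<Rightarrow> complex \<Rightarrow> complex" where
  "cq_laguerre_trig q \<alpha> n \<theta> =
     complex_of_real (qpoch (q powr (\<alpha> + 1)) q n / qpoch q q n) *
     (\<Sum>k\<le>n.
        complex_of_real (qpoch (q powr (- real n)) q k) *
        qpoch (complex_of_real (q powr (\<alpha>/2 + 1/4)) * exp (\<i> * \<theta>)) (complex_of_real q) k *
        qpoch (complex_of_real (q powr (\<alpha>/2 + 1/4)) * exp (- \<i> * \<theta>)) (complex_of_real q) k /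
        complex_of_real (qpoch (q powr (\<alpha> + 1)) q k * qpoch q q k) *
        complex_of_real (q ^ k))"

definition cq_laguerre :: "real \<Rightarrow> real \<Rightarrow> nat \<Rightarrow> complex \<Rightarrow> complex" where
  "cq_laguerre q \<alpha> n y = cq_laguerre_trig q \<alpha> n (Arccos y)"

lemma qpoch_exp_mult:
  "qpoch (A * exp (\<i> * \<theta>)) q k * qpoch (A * exp (- \<i> * \<theta>)) q k =
     (\<Prod>r<k. 1 - 2 * A * q ^ r * cos \<theta> + (A * q ^ r)\<^sup>2)"
proof -
  have e: "exp (\<i> * \<theta>) * exp (- \<i> * \<theta>) = 1"
    by (simp flip: exp_add)
  have c: "2 * cos \<theta> = exp (\<i> * \<theta>) + exp (- \<i> * \<theta>)"
    by (simp add: cos_exp_eq)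
  have *: "(1 - A * u * Q) * (1 - A * v * Q) = 1 - 2 * A * Q * C + (A * Q)\<^sup>2"
    if "u * v = 1" "2 * C = u + v" for u v Q C :: complex
  proof -
    have "(1 - A * u * Q) * (1 - A * v * Q) = 1 - A * Q * (u + v) + (A * Q)\<^sup>2 * (u * v)"
      by (simp add: algebra_simps power2_eq_square)
    then show ?thesis
      by (simp add: that(1) flip: that(2))
  qed
  show ?thesis
    unfolding qpoch_def prod.distrib[symmetric]
    by (rule prod.cong[OF refl]) (rule *[OF e c])
qed

lemma cq_laguerre_cos: "cq_laguerre q \<alpha> n (cos \<theta>) = cq_laguerre_trig q \<alpha> n \<theta>"
  unfolding cq_laguerre_def cq_laguerre_trig_def mult.assoc[of _ "qpoch _ _ _" "qpoch _ _ _"]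
    qpoch_exp_mult by simp


section \<open>The space \<open>H\<^sub>l\<close> inside the formal power series\<close>

definition basis_coeff :: "real \<Rightarrow> real \<Rightarrow> nat \<Rightarrow> real" where
  "basis_coeff q l n =
     q powr ((1 - 2*l) * real n / 4) * sqrt (qpoch (q powr (2*l)) q n / qpoch q q n)"

definition fbasis :: "real \<Rightarrow> real \<Rightarrow> nat \<Rightarrow> complex fps" where
  "fbasis q l n = fps_const (complex_of_real (basis_coeff q l n)) * fps_X ^ n"

text \<open>
  For \<open>0 < q < 1\<close> and \<open>l > 0\<close> every formal power series \<open>F\<close> is uniquely \<open>\<Sum>n. a n * f\<^sub>n\<close>, since the
  coefficients of the monomials \<open>f\<^sub>n\<close> are positive; \<open>coords\<close> and \<open>series\<close> pass between \<open>F\<close> and \<open>a\<close>.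
\<close>

definition coords :: "real \<Rightarrow> real \<Rightarrow> complex fps \<Rightarrow> nat \<Rightarrow> complex" where
  "coords q l F n = fps_nth F n / complex_of_real (basis_coeff q l n)"

definition series :: "real \<Rightarrow> real \<Rightarrow> (nat \<Rightarrow> complex) \<Rightarrow> complex fps" where
  "series q l a = Abs_fps (\<lambda>n. a n * complex_of_real (basis_coeff q l n))"

definition Hl :: "real \<Rightarrow> real \<Rightarrow> complex fps set" where
  "Hl q l = {F. summable (\<lambda>n. (cmod (coords q l F n))\<^sup>2)}"

definition Hl_inner :: "real \<Rightarrow> real \<Rightarrow> complex fps \<Rightarrow> complex fps \<Rightarrow> complex" where
  "Hl_inner q l F G = (\<Sum>n. coords q l F n * cnj (coords q l G n))"

definition Hl_norm :: "real \<Rightarrow> real \<Rightarrow> complex fps \<Rightarrow> real" where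
  "Hl_norm q l F = sqrt (Re (Hl_inner q l F F))"


section \<open>Operators\<close>

definition bounded_operator :: "real \<Rightarrow> real \<Rightarrow> (complex fps \<Rightarrow> complex fps) \<Rightarrow> bool" where
  "bounded_operator q l A \<longleftrightarrow>
     (\<forall>F\<in>Hl q l. A F \<in> Hl q l) \<and>
     (\<forall>F\<in>Hl q l. \<forall>G\<in>Hl q l. A (F + G) = A F + A G) \<and>
     (\<forall>F\<in>Hl q l. \<forall>z. A (fps_const z * F) = fps_const z * A F) \<and>
     (\<exists>K. \<forall>F\<in>Hl q l. Hl_norm q l (A F) \<le> K * Hl_norm q l F)"

text \<open>For everywhere defined bounded operators, selfadjoint means symmetric.\<close>

definition bounded_selfadjoint :: "real \<Rightarrow> real \<Rightarrow> (complex fps \<Rightarrow> complex fps) \<Rightarrow> bool" where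
  "bounded_selfadjoint q l A \<longleftrightarrow>
     bounded_operator q l A \<and>
     (\<forall>F\<in>Hl q l. \<forall>G\<in>Hl q l. Hl_inner q l (A F) G = Hl_inner q l F (A G))"

definition spectrum :: "real \<Rightarrow> real \<Rightarrow> (complex fps \<Rightarrow> complex fps) \<Rightarrow> complex set" where
  "spectrum q l A =
     {z. \<not> (\<exists>R. bounded_operator q l R \<and>
               (\<forall>F\<in>Hl q l. R (A F - fps_const z * F) = F \<and>
                            A (R F) - fps_const z * R F = F))}"

definition point_spectrum :: "real \<Rightarrow> real \<Rightarrow> (complex fps \<Rightarrow> complex fps) \<Rightarrow> complex set" where
  "point_spectrum q l A = {z. \<exists>F\<in>Hl q l. F \<noteq> 0 \<and> A F = fps_const z * F}"

text \<open>Points of the spectrum at which \<open>A - z\<close> is injective with dense range.\<close>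

definition continuous_spectrum :: "real \<Rightarrow> real \<Rightarrow> (complex fps \<Rightarrow> complex fps) \<Rightarrow> complex set" where
  "continuous_spectrum q l A =
     {z \<in> spectrum q l A. z \<notin> point_spectrum q l A \<and>
        (\<forall>G\<in>Hl q l. \<forall>e>0. \<exists>F\<in>Hl q l. Hl_norm q l (A F - fps_const z * F - G) < e)}"

text \<open>A bounded selfadjoint operator has simple spectrum if it has a cyclic vector.\<close>

definition simple_spectrum :: "real \<Rightarrow> real \<Rightarrow> (complex fps \<Rightarrow> complex fps) \<Rightarrow> bool" where
  "simple_spectrum q l A \<longleftrightarrow>
     (\<exists>v\<in>Hl q l. \<forall>G\<in>Hl q l. \<forall>e>0. \<exists>N c.
        Hl_norm q l ((\<Sum>i<N. fps_const (c i) * (A ^^ i) v) - G) < e)"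


section \<open>The representation and the operator \<open>I\<^sub>1\<close>\<close>

definition Jplus :: "real \<Rightarrow> real \<Rightarrow> complex fps \<Rightarrow> complex fps" where
  "Jplus q l F = series q l (\<lambda>n. if n = 0 then 0 else
     complex_of_real (sqrt (qnum q (2*l + real (n - 1)) * qnum q (real n))) * coords q l F (n - 1))"

definition Jminus :: "real \<Rightarrow> real \<Rightarrow> complex fps \<Rightarrow> complex fps" where
  "Jminus q l F = series q l (\<lambda>n.
     complex_of_real (sqrt (qnum q (2*l + real n) * qnum q (real (n + 1)))) * coords q l F (n + 1))"

definition qJ0 :: "real \<Rightarrow> real \<Rightarrow> real \<Rightarrow> complex fps \<Rightarrow> complex fps" where
  "qJ0 q l c F = series q l (\<lambda>n. complex_of_real (q powr (c * (l + real n))) * coords q l F n)"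

definition b_const :: "real \<Rightarrow> real" where
  "b_const q = inverse (q powr (1/2) - q powr (-1/2))"

definition a_const :: "real \<Rightarrow> real" where
  "a_const q = (q powr (1/4) + q powr (-1/4)) * b_const q"

text \<open>
  For \<open>0 < l < 1/4\<close> the operator \<open>I1\<close> has, besides its continuous spectrum, a negative eigenvalue
  \<open>(1 - (A + 1/A)/2) / (q powr (-1/2) - q powr (1/2))\<close> with \<open>A = q powr (l - 1/4) > 1\<close>: the numbers
  \<open>A powr (-n) * sqrt (qpoch (q powr (2*l)) q n / qpoch q q n)\<close> are the coordinates of a square-summable
  eigenvector.  The spectrum is purely continuous exactly when \<open>l \<ge> 1/4\<close>.
\<close>

definition I1 :: "real \<Rightarrow> real \<Rightarrow> complex fps \<Rightarrow> complex fps" where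
  "I1 q l F =
     fps_const (complex_of_real (a_const q / 2)) * qJ0 q l 1 F
     - fps_const (complex_of_real (b_const q)) * F
     - fps_const (1/2) * qJ0 q l (1/4) (Jplus q l (qJ0 q l (1/4) F) + Jminus q l (qJ0 q l (1/4) F))"

definition xi :: "real \<Rightarrow> real \<Rightarrow> real \<Rightarrow> complex \<Rightarrow> complex" where
  "xi q l \<theta> x =
     (qpoch_inf (complex_of_real (q powr (l/2)) * x) (complex_of_real q) *
      qpoch_inf (complex_of_real (q powr ((l + 1)/2)) * x) (complex_of_real q)) /
     (qpoch_inf (complex_of_real (q powr ((1 - 2*l)/4)) * exp (\<i> * complex_of_real \<theta>) * x) (complex_of_real q) *
      qpoch_inf (complex_of_real (q powr ((1 - 2*l)/4)) * exp (- \<i> * complex_of_real \<theta>) * x) (complex_of_real q))"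

definition p_coeff :: "real \<Rightarrow> real \<Rightarrow> nat \<Rightarrow> real \<Rightarrow> complex" where
  "p_coeff q l n \<mu> =
     complex_of_real (q powr ((1/4 - l) * real n) * sqrt (qpoch q q n) / sqrt (qpoch (q powr (2*l)) q n)) *
     cq_laguerre q (2*l - 1) n (complex_of_real (1 - (q powr (-1/2) - q powr (1/2)) * \<mu>))"


section \<open>The action on the basis\<close>

lemma qpoch_pos:
  fixes a q :: real
  assumes "0 < q" "q < 1" "a < 1" "0 < a"
  shows "qpoch a q n > 0"
proof -
  have "a * q ^ r \<le> a * 1" for r
    using assms by (intro mult_left_mono power_le_one) auto
  then have "a * q ^ r < 1" for r
    using assms(3) by (metis le_less_trans mult.right_neutral)
  then show ?thesis
    by (auto simp: qpoch_def intro!: prod_pos)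
qed

lemma basis_coeff_pos:
  assumes "0 < q" "q < 1" "0 < l"
  shows "basis_coeff q l n > 0"
proof -
  have "q powr (2*l) < 1"
    using powr_less_mono'[of q 0 "2*l"] assms by simp
  then show ?thesis
    using assms qpoch_pos[of q q n] qpoch_pos[of q "q powr (2*l)" n]
    by (simp add: basis_coeff_def)
qed

lemma coords_series:
  assumes "0 < q" "q < 1" "0 < l"
  shows "coords q l (series q l a) n = a n"
  using basis_coeff_pos[OF assms, of n] by (simp add: coords_def series_def)

lemma series_coords:
  assumes "0 < q" "q < 1" "0 < l"
  shows "series q l (coords q l F) = F"
proof (rule fps_ext)
  show "fps_nth (series q l (coords q l F)) n = fps_nth F n" for n
    using basis_coeff_pos[OF assms, of n] by (simp add: coords_def series_def)
qed

lemma coords_fbasis: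
  assumes "0 < q" "q < 1" "0 < l"
  shows "coords q l (fbasis q l n) m = (if m = n then 1 else 0)"
  using basis_coeff_pos[OF assms, of n] by (simp add: coords_def fbasis_def)

lemma series_single: "series q l (\<lambda>m. if m = n then c else 0) = fps_const c * fbasis q l n"
  by (rule fps_ext) (simp add: series_def fbasis_def)

lemma Jplus_fbasis:
  assumes "0 < q" "q < 1" "0 < l"
  shows "Jplus q l (fbasis q l n) =
    fps_const (complex_of_real (sqrt (qnum q (2*l + real n) * qnum q (real (n + 1))))) * fbasis q l (n + 1)"
  unfolding Jplus_def series_single[symmetric]
  by (rule arg_cong[where f = "series q l"], rule ext) (auto simp: coords_fbasis[OF assms])

lemma Jminus_fbasis:
  assumes "0 < q" "q < 1" "0 < l"
  shows "Jminus q l (fbasis q l n) =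
    fps_const (complex_of_real (sqrt (qnum q (2*l + real n - 1) * qnum q (real n)))) * fbasis q l (n - 1)"
proof (cases n)
  case 0
  then show ?thesis
    by (intro fps_ext) (simp add: Jminus_def series_def coords_fbasis[OF assms] qnum_def)
next
  case (Suc m)
  show ?thesis
    unfolding Jminus_def series_single[symmetric]
    by (rule arg_cong[where f = "series q l"], rule ext) (auto simp: coords_fbasis[OF assms] Suc)
qed

lemma qJ0_fbasis:
  assumes "0 < q" "q < 1" "0 < l"
  shows "qJ0 q l c (fbasis q l n) =
    fps_const (complex_of_real (q powr (c * (l + real n)))) * fbasis q l n"
  unfolding qJ0_def series_single[symmetric]
  by (rule arg_cong[where f = "series q l"], rule ext) (auto simp: coords_fbasis[OF assms])

end

(*
  In the coordinates of the basis f_n the operator is (1 - J) / kap with kap = q^(-1/2) - q^(1/2) and J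
  a Jacobi matrix that tends exponentially fast to the free one. Write z = (w + 1/w) / 2 with
  0 < |w| <= 1. There is an explicit Jost solution psi_n ~ L w^n of the eigenvalue equation off n = 0.

  If |w| = 1, constancy of the Wronskian with psi shows that no nonzero null sequence solves the equation
  off n = 0. So z is not an eigenvalue, e_0 is not in the range of J - z, and z lies in the
  spectrum; the range is dense because the solution p_n of the full equation is not square-summable.
  If |w| < 1, either psi is an eigenvector or the Green kernel made of p and psi is a bounded inverse
  of J - z. For l >= 1/4 the first case is excluded by the functional equation
    F(t) (1 - w t) (1 - t/w) = F(q t) (1 - A t) (1 - B t),   A = q^(l - 1/4), B = q^(l + 1/4),
  of F = sum p_n f_n in the variable t = q^((1-2l)/4) x, evaluated at t = w.

  Iterating the same functional equation with |w| = 1 gives the product formula for xi. The q-Laguerre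
  polynomials enter only through their three-term recurrence, which determines p_n.
*)

theory Submission
  imports Defs
begin

section \<open>Square-summable sequences\<close>

text \<open>The delicate points are the band edges w = 1 and w = -1, where the solutions attached to
  w and 1/w coincide. Hence everything on the circle is derived from the single solution
  \<open>\<psi>\<close>: its denominators do not vanish there, and all that is used is that
  |\<open>\<psi>\<close> n| tends to |L| > 0. Off the circle no spectral measure or perturbation
  theory is needed, because the inverse is explicit; it is bounded since the growing solution p is
  always taken at the smaller index and the decaying \<open>\<psi>\<close> at the larger one.

  The threshold l = 1/4 is the value where A = 1. Propagating a zero of F from w to q w, q^2 w and
  so on divides by 1 - A t with |t| < 1, which is safe exactly when A <= 1.

  Square roots are avoided by passing from coordinates u to y = g u; as g has a positive limit,
  growth and decay are the same in both.\<close>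

definition l2 :: "(nat \<Rightarrow> complex) set" where
  "l2 = {u. summable (\<lambda>n. (cmod (u n))\<^sup>2)}"

definition l2norm :: "(nat \<Rightarrow> complex) \<Rightarrow> real" where
  "l2norm u = sqrt (\<Sum>n. (cmod (u n))\<^sup>2)"

definition unit_seq :: "nat \<Rightarrow> nat \<Rightarrow> complex" where
  "unit_seq m n = (if n = m then 1 else 0)"

lemma L2_set_le_l2norm:
  assumes "u \<in> l2"
  shows "L2_set (\<lambda>n. cmod (u n)) {..<N} \<le> l2norm u"
  using assms unfolding l2_def l2norm_def L2_set_def
  by (auto intro!: real_sqrt_le_mono sum_le_suminf)

lemma l2norm_nonneg: "u \<in> l2 \<Longrightarrow> 0 \<le> l2norm u"
  by (auto simp: l2norm_def l2_def intro!: suminf_nonneg)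

text \<open>Norm estimates are made on initial sections, where Minkowski's inequality for
  \<open>L2_set\<close> raises no question of convergence; a bound uniform in N then yields
  membership and the norm bound together.\<close>

lemma l2I:
  assumes "\<And>N. L2_set (\<lambda>n. cmod (u n)) {..<N} \<le> K"
  shows "u \<in> l2" and "l2norm u \<le> K"
proof -
  have K: "0 \<le> K"
    using assms[of 0] by simp
  have "(\<Sum>n<N. (cmod (u n))\<^sup>2) \<le> K\<^sup>2" for N
    using power_mono[OF assms[of N], of 2] by (simp add: L2_set_def sum_nonneg)
  note b = this
  show "u \<in> l2"
    unfolding l2_def by (auto intro!: summableI_nonneg_bounded b)
  then have "(\<Sum>n. (cmod (u n))\<^sup>2) \<le> K\<^sup>2"
    unfolding l2_def by (auto intro!: suminf_le_const b)
  then show "l2norm u \<le> K"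
    unfolding l2norm_def using K by (simp add: real_le_lsqrt)
qed

lemma L2_set_cmod_triangle:
  assumes "\<And>n. n < N \<Longrightarrow> cmod (w n) \<le> cmod (u n) + cmod (v n)"
  shows "L2_set (\<lambda>n. cmod (w n)) {..<N} \<le>
           L2_set (\<lambda>n. cmod (u n)) {..<N} + L2_set (\<lambda>n. cmod (v n)) {..<N}"
proof -
  have "L2_set (\<lambda>n. cmod (w n)) {..<N} \<le> L2_set (\<lambda>n. cmod (u n) + cmod (v n)) {..<N}"
    by (rule L2_set_mono) (use assms in auto)
  also have "\<dots> \<le> L2_set (\<lambda>n. cmod (u n)) {..<N} + L2_set (\<lambda>n. cmod (v n)) {..<N}"
    by (rule L2_set_triangle_ineq)
  finally show ?thesis .
qed

text \<open>A pointwise bound instead of an equation covers sums and differences at once.\<close>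

lemma
  assumes "u \<in> l2" "v \<in> l2" "\<And>n. cmod (w n) \<le> cmod (u n) + cmod (v n)"
  shows l2_dominated_add: "w \<in> l2"
    and l2norm_dominated_add: "l2norm w \<le> l2norm u + l2norm v"
proof -
  have "L2_set (\<lambda>n. cmod (w n)) {..<N} \<le> l2norm u + l2norm v" for N
    using L2_set_cmod_triangle[of N w u v, OF assms(3)] L2_set_le_l2norm[OF assms(1), of N]
      L2_set_le_l2norm[OF assms(2), of N] by linarith
  then show "w \<in> l2" "l2norm w \<le> l2norm u + l2norm v"
    by (rule l2I)+
qed

lemma
  assumes "u \<in> l2" "\<And>n. cmod (w n) \<le> c * cmod (u n)" "0 \<le> c"
  shows l2_dominated: "w \<in> l2"
    and l2norm_dominated: "l2norm w \<le> c * l2norm u"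
proof -
  have "L2_set (\<lambda>n. cmod (w n)) {..<N} \<le> c * l2norm u" for N
  proof -
    have "L2_set (\<lambda>n. cmod (w n)) {..<N} \<le> L2_set (\<lambda>n. c * cmod (u n)) {..<N}"
      by (rule L2_set_mono) (use assms in auto)
    also have "\<dots> = c * L2_set (\<lambda>n. cmod (u n)) {..<N}"
      using assms(3) by (simp add: L2_set_right_distrib)
    also have "\<dots> \<le> c * l2norm u"
      by (intro mult_left_mono L2_set_le_l2norm assms)
    finally show ?thesis .
  qed
  then show "w \<in> l2" "l2norm w \<le> c * l2norm u"
    by (rule l2I)+
qed

lemma l2_add: "u \<in> l2 \<Longrightarrow> v \<in> l2 \<Longrightarrow> (\<lambda>n. u n + v n) \<in> l2"
  and l2norm_add: "u \<in> l2 \<Longrightarrow> v \<in> l2 \<Longrightarrow> l2norm (\<lambda>n. u n + v n) \<le> l2norm u + l2norm v"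
  by (rule l2_dominated_add l2norm_dominated_add; auto intro: norm_triangle_ineq)+

lemma l2_diff: "u \<in> l2 \<Longrightarrow> v \<in> l2 \<Longrightarrow> (\<lambda>n. u n - v n) \<in> l2"
  by (rule l2_dominated_add; auto intro: norm_triangle_ineq4)+

lemma l2_scale: "u \<in> l2 \<Longrightarrow> (\<lambda>n. c * u n) \<in> l2"
  and l2norm_scale_le: "u \<in> l2 \<Longrightarrow> l2norm (\<lambda>n. c * u n) \<le> cmod c * l2norm u"
  by (rule l2_dominated[where c = "cmod c"] l2norm_dominated; auto simp: norm_mult)+

lemma
  assumes "u \<in> l2"
  shows l2_Suc: "(\<lambda>n. u (Suc n)) \<in> l2"
    and l2norm_Suc: "l2norm (\<lambda>n. u (Suc n)) \<le> l2norm u"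
    and l2_pred: "(\<lambda>n. if n = 0 then 0 else u (n - 1)) \<in> l2"
    and l2norm_pred: "l2norm (\<lambda>n. if n = 0 then 0 else u (n - 1)) \<le> l2norm u"
proof -
  have "L2_set (\<lambda>n. cmod (u (Suc n))) {..<N} \<le> l2norm u" for N
  proof -
    have "L2_set (\<lambda>n. cmod (u (Suc n))) {..<N} \<le> L2_set (\<lambda>n. cmod (u n)) {..<Suc N}"
      unfolding L2_set_def sum.lessThan_Suc_shift by simp
    then show ?thesis
      using L2_set_le_l2norm[OF assms, of "Suc N"] by linarith
  qed
  then show "(\<lambda>n. u (Suc n)) \<in> l2" "l2norm (\<lambda>n. u (Suc n)) \<le> l2norm u"
    by (rule l2I)+
  have "L2_set (\<lambda>n. cmod (if n = 0 then 0 else u (n - 1))) {..<N} \<le> l2norm u" for N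
  proof -
    have "L2_set (\<lambda>n. cmod (if n = 0 then 0 else u (n - 1))) {..<N} \<le>
        L2_set (\<lambda>n. cmod (if n = 0 then 0 else u (n - 1))) {..<Suc N}"
      unfolding L2_set_def by (simp del: norm_eq_zero)
    also have "\<dots> = L2_set (\<lambda>n. cmod (u n)) {..<N}"
      unfolding L2_set_def sum.lessThan_Suc_shift by simp
    finally show ?thesis
      using L2_set_le_l2norm[OF assms, of N] by linarith
  qed
  then show "(\<lambda>n. if n = 0 then 0 else u (n - 1)) \<in> l2"
    "l2norm (\<lambda>n. if n = 0 then 0 else u (n - 1)) \<le> l2norm u"
    by (rule l2I)+
qed

lemma l2_tendsto_0: "u \<in> l2 \<Longrightarrow> u \<longlonglongrightarrow> 0"
proof -
  assume "u \<in> l2"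
  then have "(\<lambda>n. (cmod (u n))\<^sup>2) \<longlonglongrightarrow> 0"
    unfolding l2_def mem_Collect_eq by (rule summable_LIMSEQ_zero)
  then have "(\<lambda>n. sqrt ((cmod (u n))\<^sup>2)) \<longlonglongrightarrow> sqrt 0"
    by (rule tendsto_real_sqrt)
  then show ?thesis
    by (simp add: tendsto_norm_zero_cancel)
qed

lemma cmod_le_l2norm: "u \<in> l2 \<Longrightarrow> cmod (u n) \<le> l2norm u"
  using L2_set_le_l2norm[of u "Suc n"] member_le_L2_set[of "{..<Suc n}" n "\<lambda>n. cmod (u n)"]
  by auto

lemma l2_finite_support:
  assumes "\<And>n. n \<ge> N \<Longrightarrow> u n = 0"
  shows "u \<in> l2" and "(l2norm u)\<^sup>2 = (\<Sum>n<N. (cmod (u n))\<^sup>2)"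
proof -
  have "(\<lambda>n. (cmod (u n))\<^sup>2) sums (\<Sum>n<N. (cmod (u n))\<^sup>2)"
    by (rule sums_finite) (use assms in auto)
  then show "u \<in> l2" "(l2norm u)\<^sup>2 = (\<Sum>n<N. (cmod (u n))\<^sup>2)"
    by (auto simp: l2_def l2norm_def sums_iff sum_nonneg)
qed

lemma unit_seq_l2: "unit_seq m \<in> l2"
  by (rule l2_finite_support[of "Suc m"]) (auto simp: unit_seq_def)

lemma l2_summable_mult:
  assumes "u \<in> l2" "v \<in> l2"
  shows "summable (\<lambda>n. u n * cnj (v n))"
proof (rule summable_comparison_test')
  show "summable (\<lambda>n. (cmod (u n))\<^sup>2 + (cmod (v n))\<^sup>2)"
    using assms by (auto simp: l2_def intro: summable_add)
  fix n :: nat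
  have "0 \<le> cmod (u n) * cmod (v n)"
    by simp
  then have "cmod (u n) * cmod (v n) \<le> (cmod (u n))\<^sup>2 + (cmod (v n))\<^sup>2"
    using sum_squares_bound[of "cmod (u n)" "cmod (v n)"] by linarith
  then show "norm (u n * cnj (v n)) \<le> (cmod (u n))\<^sup>2 + (cmod (v n))\<^sup>2"
    by (simp add: norm_mult)
qed

lemma l2_truncation:
  assumes "u \<in> l2" "e > 0"
  obtains N where "l2norm (\<lambda>n. (\<Sum>m<N. u m * unit_seq m n) - u n) < e"
proof -
  have su: "summable (\<lambda>n. (cmod (u n))\<^sup>2)"
    using assms by (simp add: l2_def)
  have t: "(\<Sum>m<N. u m * unit_seq m n) = (if n < N then u n else 0)" for N n
    by (simp add: unit_seq_def if_distrib[of "\<lambda>x. _ * x"] sum.delta' cong: if_cong)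
  obtain N where N: "norm (\<Sum>i. (cmod (u (i + N)))\<^sup>2) < e\<^sup>2"
    using suminf_exist_split[of "e\<^sup>2" "\<lambda>n. (cmod (u n))\<^sup>2"] su assms(2) by force
  define v where "v = (\<lambda>n. if n < N then 0 else u n)"
  have v: "l2norm (\<lambda>n. (\<Sum>m<N. u m * unit_seq m n) - u n) = l2norm v"
    unfolding l2norm_def t v_def by (intro arg_cong[where f = sqrt] suminf_cong) auto
  have "v \<in> l2"
    by (rule l2_dominated[OF assms(1), where c = 1]) (auto simp: v_def)
  then have "(\<Sum>n. (cmod (v n))\<^sup>2) = (\<Sum>n. (cmod (v (n + N)))\<^sup>2) + (\<Sum>i<N. (cmod (v i))\<^sup>2)"
    by (intro suminf_split_initial_segment) (simp add: l2_def)
  also have "\<dots> = (\<Sum>i. (cmod (u (i + N)))\<^sup>2)"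
    by (simp add: v_def)
  also have "\<dots> < e\<^sup>2"
    using N by (simp add: abs_if split: if_splits)
  finally have "l2norm v < e"
    unfolding l2norm_def using assms(2) real_less_lsqrt[of e] by simp
  with v show thesis
    by (intro that[of N]) simp
qed

section \<open>Closures of subspaces of l2\<close>

definition l2_adherent :: "(nat \<Rightarrow> complex) set \<Rightarrow> (nat \<Rightarrow> complex) \<Rightarrow> bool" where
  "l2_adherent V g \<longleftrightarrow> g \<in> l2 \<and> (\<forall>e>0. \<exists>v\<in>V. l2norm (\<lambda>n. v n - g n) < e)"

locale l2_subspace =
  fixes V :: "(nat \<Rightarrow> complex) set"
  assumes sub_l2: "V \<subseteq> l2"
    and zero_mem: "(\<lambda>_. 0) \<in> V"
    and add_mem: "u \<in> V \<Longrightarrow> v \<in> V \<Longrightarrow> (\<lambda>n. u n + v n) \<in> V"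
    and scale_mem: "u \<in> V \<Longrightarrow> (\<lambda>n. c * u n) \<in> V"
begin

lemma sum_mem:
  assumes "\<And>i. i < N \<Longrightarrow> f i \<in> V"
  shows "(\<lambda>n. \<Sum>i<(N::nat). c i * f i n) \<in> V"
  using assms by (induction N) (auto intro!: zero_mem add_mem scale_mem)

lemma adherent_mem:
  assumes "u \<in> V"
  shows "l2_adherent V u"
proof -
  have "l2norm (\<lambda>n. u n - u n) = 0"
    by (simp add: l2norm_def)
  then show ?thesis
    unfolding l2_adherent_def using assms sub_l2 by (auto intro!: bexI[of _ u])
qed

lemma adherent_add:
  assumes "l2_adherent V g" "l2_adherent V h"
  shows "l2_adherent V (\<lambda>n. g n + h n)"
  unfolding l2_adherent_def
proof (intro conjI allI impI)
  show "(\<lambda>n. g n + h n) \<in> l2"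
    using assms by (auto simp: l2_adherent_def intro: l2_add)
  fix e :: real assume e: "e > 0"
  obtain u where u: "u \<in> V" "l2norm (\<lambda>n. u n - g n) < e / 2"
    using assms(1) e unfolding l2_adherent_def by (meson half_gt_zero)
  obtain v where v: "v \<in> V" "l2norm (\<lambda>n. v n - h n) < e / 2"
    using assms(2) e unfolding l2_adherent_def by (meson half_gt_zero)
  have "l2norm (\<lambda>n. (u n - g n) + (v n - h n)) \<le> l2norm (\<lambda>n. u n - g n) + l2norm (\<lambda>n. v n - h n)"
    using assms u(1) v(1) sub_l2 by (intro l2norm_add l2_diff) (auto simp: l2_adherent_def)
  also have "\<dots> < e"
    using u(2) v(2) by linarith
  finally have "l2norm (\<lambda>n. (u n + v n) - (g n + h n)) < e"
    by (simp add: algebra_simps)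
  with add_mem[OF u(1) v(1)] show "\<exists>w\<in>V. l2norm (\<lambda>n. w n - (g n + h n)) < e"
    by metis
qed

lemma adherent_scale:
  assumes "l2_adherent V g"
  shows "l2_adherent V (\<lambda>n. c * g n)"
  unfolding l2_adherent_def
proof (intro conjI allI impI)
  show "(\<lambda>n. c * g n) \<in> l2"
    using assms by (auto simp: l2_adherent_def intro: l2_scale)
  fix e :: real assume e: "e > 0"
  \<comment> \<open>The summand 1 keeps the denominator positive when c = 0.\<close>
  define d where "d = e / (cmod c + 1)"
  have c1: "cmod c + 1 > 0"
    by (simp add: add_nonneg_pos)
  then have d: "d > 0" "cmod c * d < e"
    using e by (auto simp: d_def field_simps)
  obtain u where u: "u \<in> V" "l2norm (\<lambda>n. u n - g n) < d"
    using assms d(1) unfolding l2_adherent_def by meson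
  have "l2norm (\<lambda>n. c * (u n - g n)) \<le> cmod c * l2norm (\<lambda>n. u n - g n)"
    using assms u(1) sub_l2 by (intro l2norm_scale_le l2_diff) (auto simp: l2_adherent_def)
  also have "\<dots> \<le> cmod c * d"
    using u(2) by (intro mult_left_mono) auto
  finally have "l2norm (\<lambda>n. c * u n - c * g n) < e"
    using d(2) by (simp add: algebra_simps)
  with scale_mem[OF u(1)] show "\<exists>w\<in>V. l2norm (\<lambda>n. w n - c * g n) < e"
    by metis
qed

lemma adherent_limit:
  assumes "h \<in> l2" "\<And>e. e > 0 \<Longrightarrow> \<exists>g. l2_adherent V g \<and> l2norm (\<lambda>n. g n - h n) < e"
  shows "l2_adherent V h"
  unfolding l2_adherent_def
proof (intro conjI allI impI)
  fix e :: real assume e: "e > 0"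
  obtain g where g: "l2_adherent V g" "l2norm (\<lambda>n. g n - h n) < e / 2"
    using assms(2)[of "e / 2"] e by auto
  obtain u where u: "u \<in> V" "l2norm (\<lambda>n. u n - g n) < e / 2"
    using g(1) e unfolding l2_adherent_def by (meson half_gt_zero)
  have "l2norm (\<lambda>n. (u n - g n) + (g n - h n)) \<le> l2norm (\<lambda>n. u n - g n) + l2norm (\<lambda>n. g n - h n)"
    using assms(1) g u(1) sub_l2 by (intro l2norm_add l2_diff) (auto simp: l2_adherent_def)
  with u(1,2) g(2) show "\<exists>w\<in>V. l2norm (\<lambda>n. w n - h n) < e"
    by (intro bexI[of _ u]) (auto simp: algebra_simps)
qed (rule assms)

text \<open>Linearity leads from unit vectors to finite combinations, truncation from these to all
  of l2. Serves both the range of J - z and the Krylov space.\<close>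

lemma dense:
  assumes "\<And>m. l2_adherent V (unit_seq m)" "g \<in> l2"
  shows "l2_adherent V g"
proof (rule adherent_limit[OF assms(2)])
  fix e :: real assume "e > 0"
  then obtain N where N: "l2norm (\<lambda>n. (\<Sum>m<N. g m * unit_seq m n) - g n) < e"
    using l2_truncation[OF assms(2)] by metis
  have "l2_adherent V (\<lambda>n. \<Sum>m<N. g m * unit_seq m n)" for N
  proof (induction N)
    case 0
    then show ?case
      by (simp add: adherent_mem zero_mem)
  next
    case (Suc N)
    then show ?case
      using adherent_add[OF Suc adherent_scale[OF assms(1)]] by simp
  qed
  with N show "\<exists>h. l2_adherent V h \<and> l2norm (\<lambda>n. h n - g n) < e"
    by blast
qed

end


section \<open>Jacobi operators\<close>

text \<open>\<open>s\<close> is twice the off-diagonal entry, so the free matrix is s = 1,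
  \<open>\<beta>\<close> = 0. The value s 0 = 0 gives row 0 the same formula as the others: in
  \<open>J\<close> it multiplies the meaningless entry u (0 - 1) = u 0.\<close>

locale jacobi =
  fixes s \<beta> :: "nat \<Rightarrow> real" and c M :: real
  assumes s_0 [simp]: "s 0 = 0"
    and c_pos: "0 < c"
    and s_lower: "c \<le> s (Suc n)"
    and s_upper: "s n \<le> 1"
    and beta_bound: "\<bar>\<beta> n\<bar> \<le> M"
begin

definition J :: "(nat \<Rightarrow> complex) \<Rightarrow> nat \<Rightarrow> complex" where
  "J u n = (complex_of_real (s (Suc n)) * u (Suc n) + complex_of_real (s n) * u (n - 1)) / 2
     + complex_of_real (\<beta> n) * u n"

text \<open>The orthonormal polynomials of the Jacobi matrix, evaluated at z.\<close>

fun p :: "complex \<Rightarrow> nat \<Rightarrow> complex" where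
  "p z 0 = 1"
| "p z (Suc 0) = 2 * (z - complex_of_real (\<beta> 0)) / complex_of_real (s 1)"
| "p z (Suc (Suc n)) =
     (2 * (z - complex_of_real (\<beta> (Suc n))) * p z (Suc n) - complex_of_real (s (Suc n)) * p z n)
       / complex_of_real (s (Suc (Suc n)))"

lemma s_Suc_pos: "0 < s (Suc n)"
  using c_pos s_lower[of n] by linarith

lemma s_Suc_ne [simp]: "s (Suc n) \<noteq> 0" "s 1 \<noteq> 0"
  using s_Suc_pos[of n] s_Suc_pos[of 0] by auto

lemma s_nonneg: "0 \<le> s n"
  using s_Suc_pos by (cases n) (auto intro: less_imp_le)

lemma J_add: "J (\<lambda>n. u n + v n) n = J u n + J v n"
  by (simp add: J_def field_simps)

lemma J_diff: "J (\<lambda>n. u n - v n) n = J u n - J v n"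
  by (simp add: J_def field_simps)

lemma J_scale: "J (\<lambda>n. k * u n) n = k * J u n"
  by (simp add: J_def field_simps)

lemma J_sum: "J (\<lambda>n. \<Sum>i<(N::nat). f i n) n = (\<Sum>i<N. J (f i) n)"
proof (induction N)
  case 0
  show ?case
    by (simp add: J_def)
qed (simp add: J_add)

lemma
  assumes "u \<in> l2"
  shows J_l2: "J u \<in> l2"
    and l2norm_J: "l2norm (J u) \<le> (2 + M) * l2norm u"
proof -
  define u1 u2 where "u1 n = u (Suc n)" and "u2 n = (if n = 0 then 0 else u (n - 1))" for n
  have u12: "u1 \<in> l2" "l2norm u1 \<le> l2norm u" "u2 \<in> l2" "l2norm u2 \<le> l2norm u"
    using l2_Suc[OF assms] l2norm_Suc[OF assms] l2_pred[OF assms] l2norm_pred[OF assms]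
    unfolding u1_def[abs_def] u2_def[abs_def] by auto
  have M: "0 \<le> M"
    using beta_bound[of 0] by linarith
  have "L2_set (\<lambda>n. cmod (J u n)) {..<N} \<le> (2 + M) * l2norm u" for N
  proof -
    have b: "cmod (J u n) \<le> cmod (u1 n) + (cmod (u2 n) + M * cmod (u n))" for n
    proof -
      have "cmod (s (Suc n) * u (Suc n)) \<le> 1 * cmod (u1 n)"
        unfolding norm_mult u1_def using s_nonneg[of "Suc n"] s_upper[of "Suc n"]
        by (intro mult_right_mono) auto
      moreover have "cmod (s n * u (n - 1)) \<le> cmod (u2 n)"
        using s_nonneg[of n] s_upper[of n] mult_right_mono[of "s n" 1 "cmod (u (n - 1))"]
        by (auto simp: norm_mult u2_def)
      moreover have "cmod (\<beta> n * u n) \<le> M * cmod (u n)"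
        unfolding norm_mult using beta_bound[of n] by (intro mult_right_mono) auto
      moreover have "cmod (J u n) \<le>
          (cmod (s (Suc n) * u (Suc n)) + cmod (s n * u (n - 1))) / 2 + cmod (\<beta> n * u n)"
        unfolding J_def
        by (intro order.trans[OF norm_triangle_ineq] add_right_mono)
           (simp add: norm_divide norm_triangle_ineq)
      ultimately show ?thesis
        using norm_ge_zero[of "u1 n"] norm_ge_zero[of "u2 n"] by argo
    qed
    have "L2_set (\<lambda>n. cmod (J u n)) {..<N} \<le>
        L2_set (\<lambda>n. cmod (u1 n) + (cmod (u2 n) + M * cmod (u n))) {..<N}"
      by (rule L2_set_mono) (use b in auto)
    also have "\<dots> \<le> L2_set (\<lambda>n. cmod (u1 n)) {..<N} +
        L2_set (\<lambda>n. cmod (u2 n) + M * cmod (u n)) {..<N}"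
      by (rule L2_set_triangle_ineq)
    also have "L2_set (\<lambda>n. cmod (u2 n) + M * cmod (u n)) {..<N} \<le>
        L2_set (\<lambda>n. cmod (u2 n)) {..<N} + L2_set (\<lambda>n. M * cmod (u n)) {..<N}"
      by (rule L2_set_triangle_ineq)
    also have "L2_set (\<lambda>n. M * cmod (u n)) {..<N} = M * L2_set (\<lambda>n. cmod (u n)) {..<N}"
      using M by (simp add: L2_set_right_distrib)
    also have "\<dots> \<le> M * l2norm u"
      using M L2_set_le_l2norm[OF assms] by (intro mult_left_mono)
    also have "L2_set (\<lambda>n. cmod (u1 n)) {..<N} \<le> l2norm u"
      using L2_set_le_l2norm[OF u12(1)] u12(2) order.trans by blast
    also have "L2_set (\<lambda>n. cmod (u2 n)) {..<N} \<le> l2norm u"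
      using L2_set_le_l2norm[OF u12(3)] u12(4) order.trans by blast
    finally show ?thesis
      by (simp add: algebra_simps)
  qed
  then show "J u \<in> l2" "l2norm (J u) \<le> (2 + M) * l2norm u"
    by (rule l2I)+
qed

text \<open>The partial sums of the two sides differ by the boundary term of Green's formula.\<close>

lemma J_symmetric:
  assumes "u \<in> l2" "v \<in> l2"
  shows "(\<Sum>n. J u n * cnj (v n)) = (\<Sum>n. u n * cnj (J v n))"
proof -
  define B where "B N = s N * (u N * cnj (v (N - 1)) - u (N - 1) * cnj (v N)) / 2" for N
  have part: "(\<Sum>n<N. J u n * cnj (v n) - u n * cnj (J v n)) = B N" for N
  proof (induction N)
    case 0
    show ?case
      by (simp add: B_def)
  next
    case (Suc N)
    have "J u N * cnj (v N) - u N * cnj (J v N) = B (Suc N) - B N"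
      by (simp add: B_def J_def field_simps)
    with Suc show ?case
      by simp
  qed
  have "(\<lambda>n. J u n * cnj (v n)) sums (\<Sum>n. J u n * cnj (v n))"
    "(\<lambda>n. u n * cnj (J v n)) sums (\<Sum>n. u n * cnj (J v n))"
    using assms by (auto intro!: summable_sums l2_summable_mult J_l2)
  from sums_diff[OF this]
  have lim: "B \<longlonglongrightarrow> (\<Sum>n. J u n * cnj (v n)) - (\<Sum>n. u n * cnj (J v n))"
    by (simp only: sums_def part)
  have "(\<lambda>n. u (Suc n)) \<longlonglongrightarrow> 0" "u \<longlonglongrightarrow> 0" "(\<lambda>n. v (Suc n)) \<longlonglongrightarrow> 0" "v \<longlonglongrightarrow> 0"
    using assms by (auto intro!: l2_tendsto_0 LIMSEQ_Suc)
  then have w: "(\<lambda>n. u (Suc n) * cnj (v n) - u n * cnj (v (Suc n))) \<longlonglongrightarrow> 0 * cnj 0 - 0 * cnj 0"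
    by (intro tendsto_intros)
  have "(\<lambda>n. B (Suc n)) \<longlonglongrightarrow> 0"
  proof (rule Lim_null_comparison)
    show "(\<lambda>n. cmod (u (Suc n) * cnj (v n) - u n * cnj (v (Suc n)))) \<longlonglongrightarrow> 0"
      using w by (intro tendsto_norm_zero) simp
    have "cmod (B (Suc n)) \<le> cmod (u (Suc n) * cnj (v n) - u n * cnj (v (Suc n)))" for n
      using mult_mono[of "s (Suc n)" 1 "cmod (u (Suc n) * cnj (v n) - u n * cnj (v (Suc n)))"
          "2 * cmod (u (Suc n) * cnj (v n) - u n * cnj (v (Suc n)))"]
        s_nonneg[of "Suc n"] s_upper[of "Suc n"]
      by (simp add: B_def norm_mult norm_divide)
    then show "\<forall>\<^sub>F n in sequentially. cmod (B (Suc n)) \<le>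
        cmod (u (Suc n) * cnj (v n) - u n * cnj (v (Suc n)))"
      by simp
  qed
  then have "B \<longlonglongrightarrow> 0"
    by (rule LIMSEQ_imp_Suc)
  with lim show ?thesis
    using LIMSEQ_unique by fastforce
qed

lemma J_p: "J (p z) n = z * p z n"
proof (cases n)
  case 0
  then show ?thesis
    by (simp add: J_def) (simp add: field_simps)
next
  case (Suc m)
  then show ?thesis
    by (simp add: J_def field_simps)
qed

text \<open>Row n determines the entry n + 1 because s (Suc n) is nonzero. The sequence is
  arbitrary, so this also yields uniqueness among formal power series.\<close>

lemma J_eigen_unique:
  assumes "\<And>n. J u n = z * u n"
  shows "u n = u 0 * p z n"
proof (induction n rule: induct_nat_012)
  case 1
  have "s 1 * u 1 = 2 * (z - \<beta> 0) * u 0"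
    using assms[of 0] by (simp add: J_def field_simps)
  then show ?case
    by (simp add: field_simps)
next
  case (ge2 n)
  have "s (Suc (Suc n)) * u (Suc (Suc n)) = 2 * (z - \<beta> (Suc n)) * u (Suc n) - s (Suc n) * u n"
    using assms[of "Suc n"] by (simp add: J_def field_simps)
  then have "u (Suc (Suc n)) =
      (2 * (z - \<beta> (Suc n)) * u (Suc n) - s (Suc n) * u n) / s (Suc (Suc n))"
    by (simp add: field_simps)
  also have "\<dots> = (2 * (z - \<beta> (Suc n)) * (u 0 * p z (Suc n)) - s (Suc n) * (u 0 * p z n)) / s (Suc (Suc n))"
    by (simp only: flip: ge2)
  also have "\<dots> = u 0 * p z (Suc (Suc n))"
    by (simp add: algebra_simps diff_divide_distrib)
  finally show ?case .
qed simp

text \<open>The discrete Wronskian (Casoratian); the weight \<open>s\<close> makes it constant along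
  solutions.\<close>

definition W :: "(nat \<Rightarrow> complex) \<Rightarrow> (nat \<Rightarrow> complex) \<Rightarrow> nat \<Rightarrow> complex" where
  "W u v n = complex_of_real (s (Suc n)) * (u (Suc n) * v n - u n * v (Suc n))"

lemma W_const:
  assumes "\<And>n. J u (Suc n) = z * u (Suc n)" "\<And>n. J v (Suc n) = z * v (Suc n)"
  shows "W u v n = W u v 0"
proof (induction n)
  case (Suc n)
  have "s (Suc (Suc n)) * u (Suc (Suc n)) = 2 * (z - \<beta> (Suc n)) * u (Suc n) - s (Suc n) * u n"
    "s (Suc (Suc n)) * v (Suc (Suc n)) = 2 * (z - \<beta> (Suc n)) * v (Suc n) - s (Suc n) * v n"
    using assms[of n] by (simp_all add: J_def field_simps)
  note rec = this
  have "W u v (Suc n) =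
      (s (Suc (Suc n)) * u (Suc (Suc n))) * v (Suc n) - u (Suc n) * (s (Suc (Suc n)) * v (Suc (Suc n)))"
    by (simp add: W_def algebra_simps)
  also have "\<dots> = W u v n"
    unfolding rec by (simp add: W_def algebra_simps)
  finally have "W u v (Suc n) = W u v n" .
  with Suc show ?case
    by simp
qed simp

lemma W_tendsto_0:
  assumes "u \<longlonglongrightarrow> 0" "\<And>n. cmod (v n) \<le> C"
  shows "W u v \<longlonglongrightarrow> 0"
proof (rule Lim_null_comparison)
  have C: "0 \<le> C"
    using assms(2)[of 0] norm_ge_zero order.trans by blast
  have u: "u \<longlonglongrightarrow> 0" "(\<lambda>n. u (Suc n)) \<longlonglongrightarrow> 0"
    using assms(1) by (auto intro: LIMSEQ_Suc)
  have "(\<lambda>n. cmod (u (Suc n)) * C + cmod (u n) * C) \<longlonglongrightarrow> cmod 0 * C + cmod 0 * C"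
    by (intro tendsto_intros u)
  then show "(\<lambda>n. cmod (u (Suc n)) * C + cmod (u n) * C) \<longlonglongrightarrow> 0"
    by simp
  show "\<forall>\<^sub>F n in sequentially. cmod (W u v n) \<le> cmod (u (Suc n)) * C + cmod (u n) * C"
  proof (intro always_eventually allI)
    fix n
    have "cmod (W u v n) \<le> 1 * cmod (u (Suc n) * v n - u n * v (Suc n))"
      unfolding W_def norm_mult using s_nonneg[of "Suc n"] s_upper[of "Suc n"]
      by (intro mult_right_mono) auto
    also have "\<dots> \<le> cmod (u (Suc n)) * cmod (v n) + cmod (u n) * cmod (v (Suc n))"
      using norm_triangle_ineq4[of "u (Suc n) * v n" "u n * v (Suc n)"] by (simp add: norm_mult)
    also have "\<dots> \<le> cmod (u (Suc n)) * C + cmod (u n) * C"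
      by (intro add_mono mult_left_mono assms) auto
    finally show "cmod (W u v n) \<le> cmod (u (Suc n)) * C + cmod (u n) * C" .
  qed
qed

section \<open>The range of J - z and its closure\<close>

definition range_sub :: "complex \<Rightarrow> (nat \<Rightarrow> complex) set" where
  "range_sub z = {(\<lambda>n. J u n - z * u n) |u. u \<in> l2}"

lemma range_subspace: "l2_subspace (range_sub z)"
proof
  show "range_sub z \<subseteq> l2"
    by (auto simp: range_sub_def intro!: l2_diff J_l2 l2_scale)
  have "(\<lambda>_. 0) \<in> l2"
    using l2_scale[OF unit_seq_l2[of 0], of 0] by simp
  then show "(\<lambda>_. 0) \<in> range_sub z"
    unfolding range_sub_def mem_Collect_eq
    by (intro exI[of _ "\<lambda>_. 0"]) (simp add: J_def)
next
  fix u v assume "u \<in> range_sub z" "v \<in> range_sub z"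
  then obtain f g where fg: "f \<in> l2" "g \<in> l2"
    "u = (\<lambda>n. J f n - z * f n)" "v = (\<lambda>n. J g n - z * g n)"
    unfolding range_sub_def by blast
  show "(\<lambda>n. u n + v n) \<in> range_sub z"
    unfolding range_sub_def mem_Collect_eq
    by (intro exI[of _ "\<lambda>n. f n + g n"]) (simp add: fg l2_add J_add algebra_simps)
next
  fix u k assume "u \<in> range_sub z"
  then obtain f where f: "f \<in> l2" "u = (\<lambda>n. J f n - z * f n)"
    unfolding range_sub_def by blast
  show "(\<lambda>n. k * u n) \<in> range_sub z"
    unfolding range_sub_def mem_Collect_eq
    by (intro exI[of _ "\<lambda>n. k * f n"]) (simp add: f l2_scale J_scale algebra_simps)
qed

lemma J_unit_seq:
  "J (unit_seq 0) n = s 1 / 2 * unit_seq 1 n + \<beta> 0 * unit_seq 0 n"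
  "J (unit_seq (Suc m)) n =
     s (Suc (Suc m)) / 2 * unit_seq (Suc (Suc m)) n + s (Suc m) / 2 * unit_seq m n
     + \<beta> (Suc m) * unit_seq (Suc m) n"
  by (cases n; auto simp: J_def unit_seq_def)+

text \<open>(J - z) e_k combines e_(k-1), e_k and e_(k+1) with the coefficients of row k, so modulo
  the range the unit vectors obey the recurrence that defines p.\<close>

lemma unit_seq_mod_range: "(\<lambda>n. unit_seq m n - p z m * unit_seq 0 n) \<in> range_sub z"
proof -
  interpret l2_subspace "range_sub z"
    by (rule range_subspace)
  have r: "(\<lambda>n. J (unit_seq k) n - z * unit_seq k n) \<in> range_sub z" for k
    unfolding range_sub_def using unit_seq_l2 by blast
  show ?thesis
  proof (induction m rule: induct_nat_012)
    case 0
    show ?case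
      using zero_mem by simp
  next
    case 1
    have eq: "(\<lambda>n. unit_seq (Suc 0) n - p z (Suc 0) * unit_seq 0 n) =
        (\<lambda>n. 2 / s 1 * (J (unit_seq 0) n - z * unit_seq 0 n))"
      by (rule ext) (simp add: J_unit_seq field_simps)
    show ?case
      unfolding eq by (rule scale_mem[OF r])
  next
    case (ge2 m)
    let ?d = "\<lambda>k n. unit_seq k n - p z k * unit_seq 0 n"
    have eq: "?d (Suc (Suc m)) = (\<lambda>n. 2 / s (Suc (Suc m)) * (J (unit_seq (Suc m)) n - z * unit_seq (Suc m) n)
        + (2 * (z - \<beta> (Suc m)) / s (Suc (Suc m)) * ?d (Suc m) n
           + (- s (Suc m) / s (Suc (Suc m))) * ?d m n))"
      by (rule ext) (simp add: J_unit_seq field_simps)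
    show ?case
      unfolding eq by (intro add_mem scale_mem ge2 r)
  qed
qed

text \<open>Modulo the range of \<open>J - z\<close>, \<open>e\<^sub>n\<close> is \<open>p z n \<sdot> e\<^sub>0\<close>, and \<open>e\<^sub>0\<close> is in the closure of the
  range because \<open>(\<Sum>n<N. cnj (p z n) e\<^sub>n) / (\<Sum>n<N. |p z n|\<^sup>2)\<close> tends to \<open>0\<close>.\<close>

lemma dense_range:
  assumes "p z \<notin> l2" "g \<in> l2"
  shows "l2_adherent (range_sub z) g"
proof -
  interpret l2_subspace "range_sub z"
    by (rule range_subspace)
  define S where "S N = (\<Sum>n<N. (cmod (p z n))\<^sup>2)" for N
  have e0: "l2_adherent (range_sub z) (unit_seq 0)"
  proof (rule adherent_limit[OF unit_seq_l2])
    fix e :: real assume e: "e > 0"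
    obtain N where N: "1 / e\<^sup>2 < S N"
    proof -
      have "\<not> (\<forall>N. S N \<le> 1 / e\<^sup>2)"
        using assms(1) summableI_nonneg_bounded[of "\<lambda>n. (cmod (p z n))\<^sup>2" "1 / e\<^sup>2"]
        by (auto simp: S_def l2_def)
      then show thesis
        using that by (auto simp: not_le)
    qed
    have "0 < 1 / e\<^sup>2"
      using e by simp
    then have S: "S N > 0"
      using N by linarith
    \<comment> \<open>In this element of the range the e_0 parts add up to (sum of |p z m|^2) / S N
      = 1 times e_0; the remainder \<open>w\<close> has squared norm 1 / S N.\<close>
    define v where "v n = (\<Sum>m<N. (- cnj (p z m) / S N) * (unit_seq m n - p z m * unit_seq 0 n))" for n
    define w where "w n = (if n < N then - cnj (p z n) / S N else 0)" for n
    have "v \<in> range_sub z"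
      unfolding v_def by (rule sum_mem) (rule unit_seq_mod_range)
    have "v n - unit_seq 0 n = w n" for n
    proof -
      have "v n = (\<Sum>m<N. (- cnj (p z m) / S N) * unit_seq m n)
          + unit_seq 0 n / S N * (\<Sum>m<N. p z m * cnj (p z m))"
        unfolding v_def sum_distrib_left sum.distrib[symmetric]
        by (intro sum.cong refl) (simp add: algebra_simps diff_divide_distrib)
      also have "(\<Sum>m<N. p z m * cnj (p z m)) = S N"
        by (simp add: S_def complex_norm_square flip: of_real_power)
      also have "(\<Sum>m<N. (- cnj (p z m) / S N) * unit_seq m n) = w n"
        by (simp add: w_def unit_seq_def if_distrib[of "\<lambda>x. _ * x"] cong: if_cong)
      finally show ?thesis
        using S by simp
    qed
    then have "l2norm (\<lambda>n. v n - unit_seq 0 n) = l2norm w"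
      by presburger
    moreover have "(l2norm w)\<^sup>2 = 1 / S N"
    proof -
      have "(l2norm w)\<^sup>2 = (\<Sum>n<N. (cmod (p z n) / S N)\<^sup>2)"
        using S by (subst l2_finite_support(2)[of N]) (auto simp: w_def norm_divide)
      also have "\<dots> = S N / (S N)\<^sup>2"
        by (simp add: S_def power_divide sum_divide_distrib)
      finally show ?thesis
        using S by (simp add: power2_eq_square)
    qed
    moreover have "1 / S N < e\<^sup>2"
      using N S e by (simp add: field_simps)
    ultimately have "l2norm (\<lambda>n. v n - unit_seq 0 n) < e"
      using e power2_less_imp_less[of "l2norm w" e] by simp
    then show "\<exists>g. l2_adherent (range_sub z) g \<and> l2norm (\<lambda>n. g n - unit_seq 0 n) < e"
      using adherent_mem \<open>v \<in> range_sub z\<close> by blast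
  qed
  show ?thesis
  proof (rule dense[OF _ assms(2)])
    fix m
    have "l2_adherent (range_sub z) (\<lambda>n. (unit_seq m n - p z m * unit_seq 0 n) + p z m * unit_seq 0 n)"
      by (intro adherent_add adherent_scale e0 adherent_mem unit_seq_mod_range)
    then show "l2_adherent (range_sub z) (unit_seq m)"
      by simp
  qed
qed

section \<open>Cyclicity of e_0\<close>

definition affine_J :: "complex \<Rightarrow> complex \<Rightarrow> (nat \<Rightarrow> complex) \<Rightarrow> nat \<Rightarrow> complex" where
  "affine_J a d u n = a * u n + d * J u n"

text \<open>With a = 1/kap and d = -1/kap, \<open>affine_J\<close> is \<open>I1\<close> in
  coordinates; \<open>simple_spectrum\<close> asks for the powers of that operator rather than of
  J.\<close>

definition krylov :: "complex \<Rightarrow> complex \<Rightarrow> (nat \<Rightarrow> complex) set" where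
  "krylov a d = {(\<lambda>n. \<Sum>i<N. k i * (affine_J a d ^^ i) (unit_seq 0) n) |k (N::nat). True}"

lemma krylovI:
  assumes "\<And>n. u n = (\<Sum>i<(N::nat). k i * (affine_J a d ^^ i) (unit_seq 0) n)"
  shows "u \<in> krylov a d"
  unfolding krylov_def using ext[of u, OF assms] by blast

lemma affine_J_l2: "u \<in> l2 \<Longrightarrow> affine_J a d u \<in> l2"
  unfolding affine_J_def[abs_def] by (intro l2_add l2_scale J_l2)

lemma krylov_iter_l2: "(affine_J a d ^^ i) (unit_seq 0) \<in> l2"
  by (induction i) (auto intro: unit_seq_l2 affine_J_l2)

lemma krylov_subspace: "l2_subspace (krylov a d)"
proof
  let ?e = "\<lambda>i. (affine_J a d ^^ i) (unit_seq 0)"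
  have "(\<lambda>n. \<Sum>i<N. k i * ?e i n) \<in> l2" for k and N :: nat
  proof (induction N)
    case 0
    then show ?case
      by (simp add: l2_def)
  qed (auto intro!: l2_add l2_scale krylov_iter_l2)
  then show "krylov a d \<subseteq> l2"
    by (auto simp: krylov_def)
  show "(\<lambda>_. 0) \<in> krylov a d"
    by (rule krylovI[where N = 0]) simp
  fix u v assume "u \<in> krylov a d" "v \<in> krylov a d"
  then obtain k N k' N' where uv: "u = (\<lambda>n. \<Sum>i<N. k i * ?e i n)" "v = (\<lambda>n. \<Sum>i<N'. k' i * ?e i n)"
    unfolding krylov_def by blast
  have ext: "(\<Sum>i<N. f i * g i) = (\<Sum>i<max N N'. (if i < N then f i else 0) * (g i :: complex))"
    for N N' :: nat and f g
    by (rule sum.mono_neutral_cong_left) auto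
  have "u n + v n = (\<Sum>i<max N N'. ((if i < N then k i else 0) + (if i < N' then k' i else 0)) * ?e i n)" for n
    using ext[of k "\<lambda>i. ?e i n" N N'] ext[of k' "\<lambda>i. ?e i n" N' N]
    by (simp add: uv sum.distrib distrib_right max.commute)
  then show "(\<lambda>n. u n + v n) \<in> krylov a d"
    by (rule krylovI)
next
  let ?e = "\<lambda>i. (affine_J a d ^^ i) (unit_seq 0)"
  fix u c assume "u \<in> krylov a d"
  then obtain k N where u: "u = (\<lambda>n. \<Sum>i<N. k i * ?e i n)"
    unfolding krylov_def by blast
  show "(\<lambda>n. c * u n) \<in> krylov a d"
    by (rule krylovI[where k = "\<lambda>i. c * k i" and N = N]) (simp add: u sum_distrib_left mult.assoc)
qed

lemma affine_J_krylov:
  assumes "u \<in> krylov a d"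
  shows "affine_J a d u \<in> krylov a d"
proof -
  let ?e = "\<lambda>i. (affine_J a d ^^ i) (unit_seq 0)"
  obtain k N where u: "u = (\<lambda>n. \<Sum>i<N. k i * ?e i n)"
    using assms unfolding krylov_def by blast
  have "affine_J a d u n = (\<Sum>i<N. k i * affine_J a d (?e i) n)" for n
    unfolding affine_J_def u J_sum by (simp add: J_scale sum_distrib_left sum.distrib algebra_simps)
  then have "affine_J a d u n = (\<Sum>i<Suc N. (if i = 0 then 0 else k (i - 1)) * ?e i n)" for n
    unfolding sum.lessThan_Suc_shift by simp
  then show ?thesis
    by (rule krylovI)
qed

lemma J_krylov:
  assumes "d \<noteq> 0" "u \<in> krylov a d"
  shows "J u \<in> krylov a d"
proof -
  interpret l2_subspace "krylov a d"
    by (rule krylov_subspace)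
  have "J u = (\<lambda>n. 1 / d * (affine_J a d u n + (- a) * u n))"
    using assms(1) by (simp add: affine_J_def fun_eq_iff)
  also have "\<dots> \<in> krylov a d"
    by (intro scale_mem add_mem affine_J_krylov assms)
  finally show ?thesis .
qed

text \<open>J e_m contains e_(m+1) with the nonzero coefficient s (Suc m) / 2, so each unit vector
  is reached from its predecessors. Two consecutive ones are carried along because the relation has
  three terms.\<close>

lemma unit_seq_krylov:
  assumes "d \<noteq> 0"
  shows "unit_seq m \<in> krylov a d"
proof -
  interpret l2_subspace "krylov a d"
    by (rule krylov_subspace)
  have "unit_seq m \<in> krylov a d \<and> unit_seq (Suc m) \<in> krylov a d"
  proof (induction m)
    case 0
    have e0: "unit_seq 0 \<in> krylov a d"
      by (rule krylovI[where k = "\<lambda>_. 1" and N = 1]) simp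
    have "unit_seq (Suc 0) = (\<lambda>n. 2 / s 1 * (J (unit_seq 0) n + (- \<beta> 0) * unit_seq 0 n))"
      by (rule ext) (simp add: J_unit_seq field_simps)
    also have "\<dots> \<in> krylov a d"
      by (intro scale_mem add_mem J_krylov assms e0)
    finally show ?case
      using e0 by blast
  next
    case (Suc m)
    have "unit_seq (Suc (Suc m)) = (\<lambda>n. 2 / s (Suc (Suc m)) *
        (J (unit_seq (Suc m)) n + ((- \<beta> (Suc m)) * unit_seq (Suc m) n + (- s (Suc m) / 2) * unit_seq m n)))"
      by (rule ext) (simp add: J_unit_seq field_simps)
    also have "\<dots> \<in> krylov a d"
      using Suc by (intro scale_mem add_mem J_krylov assms) auto
    finally show ?case
      using Suc by blast
  qed
  then show ?thesis ..
qed

lemma krylov_dense: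
  assumes "d \<noteq> 0" "g \<in> l2"
  shows "l2_adherent (krylov a d) g"
proof -
  interpret l2_subspace "krylov a d"
    by (rule krylov_subspace)
  show ?thesis
    by (rule dense[OF _ assms(2)]) (rule adherent_mem[OF unit_seq_krylov[OF assms(1)]])
qed

end


text \<open>\<open>\<psi>\<close> has to solve only the rows from 1 on; whether row 0 holds too is
  what separates eigenvalues from resolvent points when |w| < 1.\<close>

locale jost = jacobi +
  fixes z w L :: complex and \<psi> :: "nat \<Rightarrow> complex"
  assumes w_ne: "w \<noteq> 0"
    and w_le: "cmod w \<le> 1"
    and J_psi: "J \<psi> (Suc n) = z * \<psi> (Suc n)"
    and psi_lim: "(\<lambda>n. \<psi> n / w ^ n) \<longlonglongrightarrow> L"
    and L_ne: "L \<noteq> 0"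
begin

lemma psi_bound:
  obtains C where "C > 0" "\<And>n. cmod (\<psi> n) \<le> C * cmod w ^ n"
proof -
  have "Bseq (\<lambda>n. \<psi> n / w ^ n)"
    using psi_lim convergentI convergent_imp_Bseq by blast
  then obtain C where C: "C > 0" "\<And>n. cmod (\<psi> n / w ^ n) \<le> C"
    by (auto simp: Bseq_def)
  have "cmod (\<psi> n) \<le> C * cmod w ^ n" for n
    using C(2)[of n] w_ne by (simp add: norm_divide norm_power field_simps)
  with C(1) show thesis
    by (rule that)
qed

text \<open>Row m + 1 can be solved for h m since s (Suc m) is nonzero, and the descent reaches
  index 0 without using row 0.\<close>

lemma backward_zero:
  assumes "\<And>n. J h (Suc n) = z * h (Suc n)" "h N = 0" "h (Suc N) = 0" "m \<le> N"
  shows "h m = 0 \<and> h (Suc m) = 0"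
  using \<open>m \<le> N\<close>
proof (induction rule: inc_induct)
  case base
  show ?case
    using assms by simp
next
  case (step m)
  then have "complex_of_real (s (Suc m)) * h m = 0"
    using assms(1)[of m] by (simp add: J_def)
  with step show ?case
    by simp
qed

text \<open>The Wronskian with \<open>\<psi>\<close> is constant and tends to 0, so it vanishes and
  h is a multiple of \<open>\<psi>\<close> beyond the last zero of \<open>\<psi>\<close>. As
  |\<open>\<psi>\<close> n| tends to |L| > 0, the multiple is 0; the remaining entries follow by
  backward recursion.\<close>

lemma no_decaying_solution:
  assumes w1: "cmod w = 1"
    and h: "\<And>n. J h (Suc n) = z * h (Suc n)" "h \<longlonglongrightarrow> 0"
  shows "h n = 0"
proof -
  obtain C where "C > 0" and C: "\<And>n. cmod (\<psi> n) \<le> C * cmod w ^ n"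
    by (rule psi_bound) blast
  have "W h \<psi> \<longlonglongrightarrow> 0"
    by (rule W_tendsto_0[OF h(2), of _ C]) (use C w1 in auto)
  moreover have W: "W h \<psi> n = W h \<psi> 0" for n
    by (rule W_const[OF h(1) J_psi])
  then have "W h \<psi> \<longlonglongrightarrow> W h \<psi> 0"
    by (intro tendsto_eventually always_eventually allI)
  ultimately have "W h \<psi> 0 = 0"
    using LIMSEQ_unique by blast
  then have cross: "h (Suc n) * \<psi> n = h n * \<psi> (Suc n)" for n
    using W[of n] by (simp add: W_def)
  have lim: "(\<lambda>n. cmod (\<psi> n)) \<longlonglongrightarrow> cmod L"
    using tendsto_norm[OF psi_lim] w1 by (simp add: norm_divide norm_power)
  have "\<forall>\<^sub>F n in sequentially. 0 < cmod (\<psi> n)"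
    using order_tendstoD(1)[OF lim, of 0] L_ne by simp
  then obtain N where N: "\<And>n. n \<ge> N \<Longrightarrow> \<psi> n \<noteq> 0"
    by (auto simp: eventually_sequentially)
  define k where "k = h N / \<psi> N"
  have hk: "h n = k * \<psi> n" if "n \<ge> N" for n
    using that
  proof (induction rule: dec_induct)
    case base
    then show ?case
      using N[of N] by (simp add: k_def)
  next
    case (step n)
    have "h (Suc n) * \<psi> n = k * \<psi> (Suc n) * \<psi> n"
      unfolding cross step.IH by simp
    then show ?case
      using N[of n] step by simp
  qed
  have "\<forall>\<^sub>F n in sequentially. cmod k * cmod (\<psi> n) = cmod (h n)"
    unfolding eventually_sequentially by (intro exI[of _ N]) (simp add: hk norm_mult)
  from Lim_transform_eventually[OF tendsto_mult_left[OF lim] this]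
  have "(\<lambda>n. cmod (h n)) \<longlonglongrightarrow> cmod k * cmod L" .
  then have "cmod k * cmod L = 0"
    using tendsto_norm_zero[OF h(2)] by (rule LIMSEQ_unique)
  then have "k = 0"
    using L_ne by simp
  then have "h n = 0" if "n \<ge> N" for n
    using hk that by simp
  then show ?thesis
    using backward_zero[of h "max n N" n] h(1) by simp
qed

end

section \<open>The resolvent for |w| < 1: convolution bounds and the Green kernel\<close>

lemma L2_set_pred_le:
  fixes f :: "nat \<Rightarrow> real"
  shows "L2_set (\<lambda>n. if n = 0 then 0 else f (n - 1)) {..<N} \<le> L2_set f {..<N}"
proof (cases N)
  case (Suc N)
  have "L2_set (\<lambda>n. if n = 0 then 0 else f (n - 1)) {..<Suc N} = L2_set f {..<N}"
    unfolding L2_set_def sum.lessThan_Suc_shift by simp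
  also have "\<dots> \<le> L2_set f {..<Suc N}"
    unfolding L2_set_def by simp
  finally show ?thesis
    unfolding Suc .
qed simp

lemma L2_set_lessThan_Suc_le: "L2_set f {..<Suc N} \<le> L2_set f {..<N} + \<bar>f N\<bar>"
proof -
  have "L2_set f {..<Suc N} = L2_set f (insert N {..<N})"
    by (simp add: lessThan_Suc)
  also have "\<dots> = sqrt ((f N)\<^sup>2 + (L2_set f {..<N})\<^sup>2)"
    by (subst L2_set_insert) auto
  also have "\<dots> \<le> \<bar>f N\<bar> + L2_set f {..<N}"
    using sqrt_sum_squares_le_sum_abs[of "f N" "L2_set f {..<N}"] by simp
  finally show ?thesis
    by simp
qed

text \<open>The two one-sided geometric convolutions are bounded on \<open>l2\<close>: both satisfy a first-order
  recursion, which bounds their norm by \<open>\<rho>\<close> times itself plus the norm of \<open>g\<close>.\<close>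

lemma geometric_convolution_left:
  fixes g :: "nat \<Rightarrow> complex"
  assumes "0 \<le> \<rho>" "\<rho> < 1" "g \<in> l2"
  shows "L2_set (\<lambda>m. \<Sum>n\<le>m. \<rho> ^ (m - n) * cmod (g n)) {..<N} \<le> l2norm g / (1 - \<rho>)"
proof -
  define Y where "Y m = (\<Sum>n\<le>m. \<rho> ^ (m - n) * cmod (g n))" for m
  have rec: "Y m = \<rho> * (if m = 0 then 0 else Y (m - 1)) + cmod (g m)" for m
  proof (cases m)
    case (Suc k)
    have "(\<Sum>n\<le>k. \<rho> ^ (Suc k - n) * cmod (g n)) = \<rho> * (\<Sum>n\<le>k. \<rho> ^ (k - n) * cmod (g n))"
      unfolding sum_distrib_left by (intro sum.cong refl) (simp add: Suc_diff_le)
    then show ?thesis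
      by (simp add: Suc Y_def)
  qed (simp add: Y_def)
  \<comment> \<open>On a finite section the norm of Y is finite by construction, so
    \<open>\<rho>\<close> times it may be absorbed into the left side.\<close>
  have "L2_set Y {..<N} \<le> L2_set (\<lambda>m. \<rho> * (if m = 0 then 0 else Y (m - 1))) {..<N}
      + L2_set (\<lambda>m. cmod (g m)) {..<N}"
    by (subst rec[abs_def]) (rule L2_set_triangle_ineq)
  also have "L2_set (\<lambda>m. \<rho> * (if m = 0 then 0 else Y (m - 1))) {..<N} =
      \<rho> * L2_set (\<lambda>m. if m = 0 then 0 else Y (m - 1)) {..<N}"
    using assms(1) by (simp add: L2_set_right_distrib)
  also have "\<dots> \<le> \<rho> * L2_set Y {..<N}"
    by (intro mult_left_mono L2_set_pred_le assms)
  also have "L2_set (\<lambda>m. cmod (g m)) {..<N} \<le> l2norm g"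
    by (rule L2_set_le_l2norm[OF assms(3)])
  finally show ?thesis
    using assms(2) by (simp add: Y_def field_simps)
qed

lemma geometric_convolution_right:
  fixes g :: "nat \<Rightarrow> complex"
  assumes "0 \<le> \<rho>" "\<rho> < 1" "g \<in> l2"
  defines "Z \<equiv> \<lambda>m. \<Sum>n. \<rho> ^ Suc n * cmod (g (m + Suc n))"
  shows "summable (\<lambda>n. \<rho> ^ Suc n * cmod (g (m + Suc n)))"
    and "L2_set Z {..<N} \<le> (1 / (1 - \<rho>) + 1) / (1 - \<rho>) * l2norm g"
proof -
  have gs: "summable (\<lambda>n. \<rho> ^ n)" "(\<Sum>n. \<rho> ^ n) = 1 / (1 - \<rho>)"
    using assms(1,2) by (auto simp: suminf_geometric)
  have le: "\<rho> ^ Suc n * cmod (g (m + Suc n)) \<le> \<rho> ^ n * l2norm g" for m n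
  proof (rule mult_mono)
    show "\<rho> ^ Suc n \<le> \<rho> ^ n"
      using assms(1,2) by (simp add: mult_left_le_one_le)
  qed (use assms(1,3) in \<open>auto intro: cmod_le_l2norm\<close>)
  show sm: "summable (\<lambda>n. \<rho> ^ Suc n * cmod (g (m + Suc n)))" for m
  proof (rule summable_comparison_test')
    show "summable (\<lambda>n. \<rho> ^ n * l2norm g)"
      using gs(1) by (rule summable_mult2)
    show "norm (\<rho> ^ Suc n * cmod (g (m + Suc n))) \<le> \<rho> ^ n * l2norm g" for n
      using le[of n m] assms(1) by simp
  qed
  have Z0: "0 \<le> Z m" for m
    unfolding Z_def using assms(1) by (intro suminf_nonneg sm) auto
  \<comment> \<open>The recursion for Z refers to m + 1, so the section below N meets the outside
    value Z N; this uniform bound controls it.\<close>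
  have Zb: "Z m \<le> l2norm g / (1 - \<rho>)" for m
  proof -
    have "Z m \<le> (\<Sum>n. \<rho> ^ n * l2norm g)"
      unfolding Z_def by (intro suminf_le le sm summable_mult2 gs)
    also have "\<dots> = l2norm g / (1 - \<rho>)"
      using suminf_mult2[OF gs(1), of "l2norm g"] gs(2) by simp
    finally show ?thesis .
  qed
  have rec: "Z m = \<rho> * (cmod (g (Suc m)) + Z (Suc m))" for m
  proof -
    have "Z m = (\<Sum>n. \<rho> ^ Suc (Suc n) * cmod (g (m + Suc (Suc n)))) + \<rho> * cmod (g (Suc m))"
      unfolding Z_def using suminf_split_head[OF sm[of m]] by simp
    also have "(\<Sum>n. \<rho> ^ Suc (Suc n) * cmod (g (m + Suc (Suc n)))) = \<rho> * Z (Suc m)"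
      unfolding Z_def by (subst suminf_mult[OF sm, symmetric]) (simp add: mult.assoc)
    finally show ?thesis
      by (simp add: algebra_simps)
  qed
  have "L2_set Z {..<N} = \<rho> * L2_set (\<lambda>m. cmod (g (Suc m)) + Z (Suc m)) {..<N}"
    by (subst rec[abs_def]) (simp add: L2_set_right_distrib assms(1))
  also have "\<dots> \<le> \<rho> * (L2_set (\<lambda>m. cmod (g (Suc m))) {..<N} + L2_set (\<lambda>m. Z (Suc m)) {..<N})"
    by (intro mult_left_mono L2_set_triangle_ineq assms)
  also have "\<dots> \<le> \<rho> * (l2norm g + (L2_set Z {..<N} + l2norm g / (1 - \<rho>)))"
  proof (intro mult_left_mono add_mono assms)
    show "L2_set (\<lambda>m. cmod (g (Suc m))) {..<N} \<le> l2norm g"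
      using L2_set_le_l2norm[OF l2_Suc[OF assms(3)], of N] l2norm_Suc[OF assms(3)] by linarith
    have "L2_set (\<lambda>m. Z (Suc m)) {..<N} \<le> L2_set Z {..<Suc N}"
      unfolding L2_set_def sum.lessThan_Suc_shift by simp
    also have "\<dots> \<le> L2_set Z {..<N} + Z N"
      using L2_set_lessThan_Suc_le[of Z N] Z0[of N] by simp
    finally show "L2_set (\<lambda>m. Z (Suc m)) {..<N} \<le> L2_set Z {..<N} + l2norm g / (1 - \<rho>)"
      using Zb[of N] by linarith
  qed
  also have "\<dots> \<le> \<rho> * L2_set Z {..<N} + (l2norm g + l2norm g / (1 - \<rho>))"
    using assms(1,2) l2norm_nonneg[OF assms(3)]
      mult_right_mono[of \<rho> 1 "l2norm g + l2norm g / (1 - \<rho>)"]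
    by (simp add: algebra_simps)
  finally have "(1 - \<rho>) * L2_set Z {..<N} \<le> (1 / (1 - \<rho>) + 1) * l2norm g"
    by (simp add: algebra_simps)
  then have "L2_set Z {..<N} \<le> (1 / (1 - \<rho>) + 1) * l2norm g / (1 - \<rho>)"
    using assms(2) by (subst pos_le_divide_eq) (simp_all add: mult.commute)
  then show "L2_set Z {..<N} \<le> (1 / (1 - \<rho>) + 1) / (1 - \<rho>) * l2norm g"
    by simp
qed

text \<open>D / (1 - \<open>\<rho>\<close>) is the fixed point of a -> \<open>\<rho>\<close> a + D,
  and this map preserves every upper bound that is at least the fixed point.\<close>

lemma bounded_affine_recursion:
  fixes a :: "nat \<Rightarrow> real"
  assumes "0 \<le> \<rho>" "\<rho> < 1" "\<And>n. n \<ge> N \<Longrightarrow> a (Suc n) \<le> \<rho> * a n + D" "n \<ge> N"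
  shows "a n \<le> max (a N) (D / (1 - \<rho>))"
  using \<open>n \<ge> N\<close>
proof (induction rule: dec_induct)
  case (step n)
  let ?B = "max (a N) (D / (1 - \<rho>))"
  have "D \<le> (1 - \<rho>) * ?B"
    using assms(2) by (simp add: field_simps max_def)
  moreover have "\<rho> * a n \<le> \<rho> * ?B"
    using step.IH assms(1) by (rule mult_left_mono)
  ultimately have "\<rho> * a n + D \<le> ?B"
    by (simp add: algebra_simps)
  with assms(3)[OF step(1)] show ?case
    by linarith
qed simp

context jost
begin

text \<open>The defect of \<open>\<psi>\<close> in row 0. By \<open>W_p_psi\<close> it is -1/2 times
  the Wronskian of p and \<open>\<psi>\<close>.\<close>

definition \<kappa> :: complex where
  "\<kappa> = J \<psi> 0 - z * \<psi> 0"

definition green_left :: "(nat \<Rightarrow> complex) \<Rightarrow> nat \<Rightarrow> complex" where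
  "green_left g m = (\<Sum>n\<le>m. p z n * g n)"

definition green_right :: "(nat \<Rightarrow> complex) \<Rightarrow> nat \<Rightarrow> complex" where
  "green_right g m = (\<Sum>n. \<psi> (m + Suc n) * g (m + Suc n))"

text \<open>The kernel is p at the smaller index times \<open>\<psi>\<close> at the larger one,
  divided by \<open>\<kappa>\<close>; the diagonal term belongs to
  \<open>green_left\<close>.\<close>

definition green :: "(nat \<Rightarrow> complex) \<Rightarrow> nat \<Rightarrow> complex" where
  "green g m = (\<psi> m * green_left g m + p z m * green_right g m) / \<kappa>"

lemma W_p_psi: "W (p z) \<psi> n = - 2 * \<kappa>"
proof -
  have "W (p z) \<psi> n = W (p z) \<psi> 0"
    by (rule W_const[OF J_p J_psi])
  also have "\<dots> = 2 * (z - \<beta> 0) * \<psi> 0 - s 1 * \<psi> 1"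
    by (simp add: W_def right_diff_distrib)
  also have "\<dots> = - 2 * \<kappa>"
    by (simp add: \<kappa>_def J_def field_simps)
  finally show ?thesis .
qed

lemma psi_l2:
  assumes "cmod w < 1"
  shows "\<psi> \<in> l2"
proof -
  obtain C where C: "\<And>n. cmod (\<psi> n) \<le> C * cmod w ^ n"
    by (rule psi_bound) blast
  have "(cmod (\<psi> n))\<^sup>2 \<le> C\<^sup>2 * ((cmod w)\<^sup>2) ^ n" for n
    using power_mono[OF C[of n], of 2] by (simp add: power_mult_distrib power_mult[symmetric] mult.commute)
  note le = this
  have "summable (\<lambda>n. C\<^sup>2 * ((cmod w)\<^sup>2) ^ n)"
    using assms by (intro summable_mult summable_geometric) (simp add: abs_square_less_1)
  then have "summable (\<lambda>n. (cmod (\<psi> n))\<^sup>2)"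
    by (rule summable_comparison_test'[where N = 0]) (use le in simp)
  then show ?thesis
    by (simp add: l2_def)
qed

lemma psi_ne_0: "\<psi> \<noteq> (\<lambda>_. 0)"
proof
  assume "\<psi> = (\<lambda>_. 0)"
  then have "(\<lambda>n. 0 :: complex) \<longlonglongrightarrow> L"
    using psi_lim by simp
  then show False
    using L_ne by (simp add: LIMSEQ_const_iff)
qed

text \<open>h is h 0 times p, so its Wronskian with \<open>\<psi>\<close> has the constant value -2
  \<open>\<kappa>\<close> h 0; decay of h forces that to be 0.\<close>

lemma no_l2_eigenvector:
  assumes "cmod w < 1" "\<kappa> \<noteq> 0" "h \<in> l2" "\<And>n. J h n = z * h n"
  shows "h n = 0"
proof -
  obtain C where "C > 0" and C: "\<And>n. cmod (\<psi> n) \<le> C * cmod w ^ n"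
    by (rule psi_bound) blast
  have "cmod w ^ n \<le> 1" for n
    using assms(1) by (simp add: power_le_one)
  then have "C * cmod w ^ n \<le> C" for n
    using \<open>C > 0\<close> by (simp add: mult_le_cancel_left1 mult_left_le)
  then have "cmod (\<psi> n) \<le> C" for n
    using C[of n] order.trans by blast
  then have lim: "W h \<psi> \<longlonglongrightarrow> 0"
    by (rule W_tendsto_0[OF l2_tendsto_0[OF assms(3)]])
  have h: "h n = h 0 * p z n" for n
    by (rule J_eigen_unique[OF assms(4)])
  have "W h \<psi> n = h 0 * W (p z) \<psi> n" for n
    by (simp add: W_def h[of n] h[of "Suc n"] algebra_simps)
  then have "W h \<psi> = (\<lambda>_. h 0 * (- 2 * \<kappa>))"
    by (simp add: W_p_psi fun_eq_iff)
  with lim have "h 0 * (- 2 * \<kappa>) = 0"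
    by (simp add: LIMSEQ_const_iff)
  then show ?thesis
    using h[of n] assms(2) by simp
qed

text \<open>Given \<open>\<psi>\<close>, the Wronskian identity is a first-order recursion for p.
  For r n = p z n * w^n its factor tends to w^2, of modulus less than 1, and its inhomogeneity is
  bounded.\<close>

lemma p_bound:
  assumes "cmod w < 1"
  obtains C where "C > 0" "\<And>n. cmod (p z n) * cmod w ^ n \<le> C"
proof -
  define \<rho> where "\<rho> = cmod w"
  have \<rho>: "0 < \<rho>" "\<rho> < 1"
    using w_ne assms by (auto simp: \<rho>_def)
  define \<phi> where "\<phi> n = \<psi> n / w ^ n" for n
  define r where "r n = p z n * w ^ n" for n
  have chi: "\<phi> \<longlonglongrightarrow> L"
    unfolding \<phi>_def by (rule psi_lim)
  have "(\<lambda>n. \<phi> (Suc n) / \<phi> n) \<longlonglongrightarrow> L / L"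
    by (intro tendsto_divide LIMSEQ_Suc chi L_ne)
  then have "(\<lambda>n. cmod (\<phi> (Suc n) / \<phi> n)) \<longlonglongrightarrow> 1"
    using tendsto_norm[of _ "L / L"] L_ne by fastforce
  \<comment> \<open>The ratio tends to 1 < 1 / \<open>\<rho>\<close>; this crude bound turns the
    factor \<open>\<rho>\<close> squared into \<open>\<rho>\<close>, which still contracts.\<close>
  then have "\<forall>\<^sub>F n in sequentially. cmod (\<phi> (Suc n) / \<phi> n) < 1 / \<rho>"
    by (rule order_tendstoD) (use \<rho> in simp)
  moreover have "\<forall>\<^sub>F n in sequentially. cmod L / 2 < cmod (\<phi> n)"
    by (rule order_tendstoD(1)[OF tendsto_norm[OF chi]]) (use L_ne in simp)
  ultimately have "\<forall>\<^sub>F n in sequentially. cmod (\<phi> (Suc n) / \<phi> n) < 1 / \<rho> \<and> cmod L / 2 < cmod (\<phi> n)"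
    by (rule eventually_conj)
  then obtain N where N: "\<And>n. n \<ge> N \<Longrightarrow> cmod (\<phi> (Suc n) / \<phi> n) < 1 / \<rho> \<and> cmod L / 2 < cmod (\<phi> n)"
    by (auto simp: eventually_sequentially)
  \<comment> \<open>Bounds the inhomogeneity 2 \<open>\<kappa>\<close> w / (s (Suc n)
    \<open>\<phi>\<close> n) by |w| <= 1, s (Suc n) >= c and |\<open>\<phi>\<close> n| > |L| /
    2.\<close>
  define D where "D = 2 * cmod \<kappa> / (c * (cmod L / 2))"
  have step: "cmod (r (Suc n)) \<le> \<rho> * cmod (r n) + D" if n: "n \<ge> N" for n
  proof -
    have chi_n: "\<phi> n \<noteq> 0" "cmod L / 2 < cmod (\<phi> n)"
      using N[OF n] L_ne by auto
    have psi: "\<psi> k = \<phi> k * w ^ k" for k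
      using w_ne by (simp add: \<phi>_def)
    have "p z (Suc n) * \<psi> n = p z n * \<psi> (Suc n) - 2 * \<kappa> / s (Suc n)"
      using W_p_psi[of n] by (simp add: W_def field_simps)
    then have "w * (p z (Suc n) * \<psi> n) = w * (p z n * \<psi> (Suc n) - 2 * \<kappa> / s (Suc n))"
      by simp
    then have "r (Suc n) * \<phi> n = r n * w\<^sup>2 * \<phi> (Suc n) - 2 * \<kappa> * w / s (Suc n)"
      by (simp add: r_def psi algebra_simps power2_eq_square)
    then have "r (Suc n) = r n * w\<^sup>2 * (\<phi> (Suc n) / \<phi> n) - 2 * \<kappa> * w / (s (Suc n) * \<phi> n)"
      using chi_n(1) by (simp add: field_simps)
    then have "cmod (r (Suc n)) \<le> cmod (r n * w\<^sup>2 * (\<phi> (Suc n) / \<phi> n)) + cmod (2 * \<kappa> * w / (s (Suc n) * \<phi> n))"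
      by (metis norm_triangle_ineq4)
    also have "cmod (r n * w\<^sup>2 * (\<phi> (Suc n) / \<phi> n)) = (\<rho>\<^sup>2 * cmod (r n)) * cmod (\<phi> (Suc n) / \<phi> n)"
      unfolding norm_mult by (simp add: norm_power \<rho>_def)
    also have "\<dots> \<le> (\<rho>\<^sup>2 * cmod (r n)) * (1 / \<rho>)"
      by (intro mult_left_mono less_imp_le[OF conjunct1[OF N[OF n]]]) auto
    also have "\<dots> = \<rho> * cmod (r n)"
      using \<rho> by (simp add: power2_eq_square)
    also have "cmod (2 * \<kappa> * w / (s (Suc n) * \<phi> n)) = 2 * cmod \<kappa> * \<rho> / (s (Suc n) * cmod (\<phi> n))"
      using s_nonneg[of "Suc n"] by (simp add: norm_mult norm_divide \<rho>_def)
    also have "\<dots> \<le> D"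
      unfolding D_def
    proof (rule frac_le)
      show "2 * cmod \<kappa> * \<rho> \<le> 2 * cmod \<kappa>"
        using \<rho> mult_left_mono[of \<rho> 1 "2 * cmod \<kappa>"] by simp
      show "0 < c * (cmod L / 2)"
        using c_pos L_ne by simp
      show "c * (cmod L / 2) \<le> s (Suc n) * cmod (\<phi> n)"
        using c_pos s_lower[of n] chi_n(2) s_nonneg[of "Suc n"] by (intro mult_mono) auto
    qed simp
    finally show ?thesis
      by simp
  qed
  have "cmod (r n) \<le> max (cmod (r N)) (D / (1 - \<rho>))" if "n \<ge> N" for n
    using bounded_affine_recursion[of \<rho> N "\<lambda>n. cmod (r n)" D n] \<rho> step that by simp
  then have "\<exists>K. \<forall>n. cmod (r (n + N)) \<le> K"
    by (intro exI[of _ "max (cmod (r N)) (D / (1 - \<rho>))"]) simp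
  then have "Bseq (\<lambda>n. r (n + N))"
    by (auto intro: BseqI')
  then have "Bseq r"
    by (rule Bseq_offset)
  then obtain C where "C > 0" "\<And>n. cmod (r n) \<le> C"
    by (auto simp: Bseq_def)
  with that show thesis
    by (simp add: r_def norm_mult norm_power)
qed

lemma summable_psi_mult:
  assumes "cmod w < 1" "g \<in> l2"
  shows "summable (\<lambda>n. \<psi> (m + Suc n) * g (m + Suc n))"
proof -
  obtain C where "C > 0" and C: "\<And>n. cmod (\<psi> n) \<le> C * cmod w ^ n"
    by (rule psi_bound) blast
  have "summable (\<lambda>n. \<psi> n * g n)"
  proof (rule summable_comparison_test')
    show "summable (\<lambda>n. C * cmod w ^ n * l2norm g)"
      using assms(1) by (intro summable_mult2 summable_mult summable_geometric) simp
    show "norm (\<psi> n * g n) \<le> C * cmod w ^ n * l2norm g" for n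
      unfolding norm_mult by (intro mult_mono C cmod_le_l2norm assms) (use \<open>C > 0\<close> in auto)
  qed
  then show ?thesis
    using summable_iff_shift[of "\<lambda>n. \<psi> n * g n" "Suc m"] by (simp add: add.commute)
qed

lemma green_add:
  assumes "cmod w < 1" "g \<in> l2" "h \<in> l2"
  shows "green (\<lambda>n. g n + h n) m = green g m + green h m"
proof -
  have "green_right (\<lambda>n. g n + h n) m = green_right g m + green_right h m"
    unfolding green_right_def distrib_left
    by (intro suminf_add[symmetric] summable_psi_mult assms)
  then show ?thesis
    by (simp add: green_def green_left_def distrib_left sum.distrib add_divide_distrib)
qed

lemma green_scale:
  assumes "cmod w < 1" "g \<in> l2"
  shows "green (\<lambda>n. k * g n) m = k * green g m"
proof -
  have "green_right (\<lambda>n. k * g n) m = k * green_right g m"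
    unfolding green_right_def
    by (subst suminf_mult[OF summable_psi_mult[OF assms], symmetric]) (simp add: ac_simps)
  moreover have "green_left (\<lambda>n. k * g n) m = k * green_left g m"
    by (simp add: green_left_def sum_distrib_left ac_simps)
  ultimately show ?thesis
    by (simp add: green_def algebra_simps)
qed

text \<open>|\<open>\<psi>\<close> n| is at most of order |w|^n and |p z n| of order |w|^(-n), so
  the kernel at (m, n) is dominated by a multiple of |w|^|m - n|, which splits into the two
  geometric convolutions.\<close>

lemma green_bounded:
  assumes "cmod w < 1"
  obtains K where "\<And>g. g \<in> l2 \<Longrightarrow> green g \<in> l2 \<and> l2norm (green g) \<le> K * l2norm g"
proof -
  define \<rho> where "\<rho> = cmod w"
  have \<rho>: "0 < \<rho>" "\<rho> < 1"
    using w_ne assms by (auto simp: \<rho>_def)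
  obtain C where C: "C > 0" "\<And>n. cmod (\<psi> n) \<le> C * \<rho> ^ n"
    unfolding \<rho>_def by (rule psi_bound) blast
  obtain C' where C': "C' > 0" "\<And>n. cmod (p z n) * \<rho> ^ n \<le> C'"
    unfolding \<rho>_def by (rule p_bound[OF assms]) blast
  define A where "A = C * C' / cmod \<kappa>"
  have A: "0 \<le> A"
    using C(1) C'(1) by (simp add: A_def)
  have kernel: "cmod (\<psi> (m + k)) * cmod (p z m) \<le> C * C' * \<rho> ^ k" for m k
  proof -
    have "cmod (\<psi> (m + k)) * cmod (p z m) \<le> C * \<rho> ^ (m + k) * cmod (p z m)"
      by (intro mult_right_mono C) auto
    also have "\<dots> = C * \<rho> ^ k * (cmod (p z m) * \<rho> ^ m)"
      by (simp add: power_add)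
    also have "\<dots> \<le> C * \<rho> ^ k * C'"
      using C(1) \<rho> by (intro mult_left_mono C') auto
    finally show ?thesis
      by (simp add: ac_simps)
  qed
  define B where "B = A * (1 / (1 - \<rho>) + (1 / (1 - \<rho>) + 1) / (1 - \<rho>))"
  have "green g \<in> l2 \<and> l2norm (green g) \<le> B * l2norm g" if g: "g \<in> l2" for g
  proof -
    define Y where "Y m = (\<Sum>n\<le>m. \<rho> ^ (m - n) * cmod (g n))" for m
    define Z where "Z m = (\<Sum>n. \<rho> ^ Suc n * cmod (g (m + Suc n)))" for m
    have sZ: "summable (\<lambda>n. \<rho> ^ Suc n * cmod (g (m + Suc n)))" for m
      using geometric_convolution_right(1)[of \<rho> g m] \<rho> g by simp
    have left: "cmod (\<psi> m * green_left g m) \<le> C * C' * Y m" for m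
    proof -
      have "cmod (\<psi> m * green_left g m) \<le> (\<Sum>n\<le>m. cmod (\<psi> m * (p z n * g n)))"
        unfolding green_left_def sum_distrib_left by (rule norm_sum)
      also have "\<dots> \<le> (\<Sum>n\<le>m. C * C' * (\<rho> ^ (m - n) * cmod (g n)))"
      proof (rule sum_mono)
        fix n assume "n \<in> {..m}"
        then have "cmod (\<psi> m) * cmod (p z n) \<le> C * C' * \<rho> ^ (m - n)"
          using kernel[of n "m - n"] by simp
        then show "cmod (\<psi> m * (p z n * g n)) \<le> C * C' * (\<rho> ^ (m - n) * cmod (g n))"
          using mult_right_mono[of _ _ "cmod (g n)"] by (simp add: norm_mult mult.assoc[symmetric])
      qed
      finally show ?thesis
        by (simp add: Y_def sum_distrib_left)
    qed
    have right: "cmod (p z m * green_right g m) \<le> C * C' * Z m" for m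
    proof -
      have eq: "p z m * green_right g m = (\<Sum>n. p z m * (\<psi> (m + Suc n) * g (m + Suc n)))"
        unfolding green_right_def by (rule suminf_mult[symmetric, OF summable_psi_mult[OF assms g]])
      have le: "cmod (p z m * (\<psi> (m + Suc n) * g (m + Suc n))) \<le> C * C' * (\<rho> ^ Suc n * cmod (g (m + Suc n)))" for n
        using mult_right_mono[OF kernel[of m "Suc n"], of "cmod (g (m + Suc n))"]
        by (simp add: norm_mult ac_simps)
      have sm: "summable (\<lambda>n. C * C' * (\<rho> ^ Suc n * cmod (g (m + Suc n))))"
        by (rule summable_mult[OF sZ])
      have "cmod (p z m * green_right g m) \<le> (\<Sum>n. C * C' * (\<rho> ^ Suc n * cmod (g (m + Suc n))))"
        unfolding eq by (rule norm_suminf_le[OF le sm])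
      also have "\<dots> = C * C' * Z m"
        unfolding Z_def by (rule suminf_mult[OF sZ])
      finally show ?thesis .
    qed
    have bound: "cmod (green g m) \<le> A * (Y m + Z m)" for m
    proof -
      have "cmod (\<psi> m * green_left g m + p z m * green_right g m) \<le> C * C' * (Y m + Z m)"
        using norm_triangle_ineq[of "\<psi> m * green_left g m" "p z m * green_right g m"] left[of m] right[of m]
        unfolding distrib_left by linarith
      then show ?thesis
        unfolding green_def A_def norm_divide
        using divide_right_mono[of _ _ "cmod \<kappa>"] by simp
    qed
    have "L2_set (\<lambda>m. cmod (green g m)) {..<N} \<le> B * l2norm g" for N
    proof -
      have "L2_set (\<lambda>m. cmod (green g m)) {..<N} \<le> L2_set (\<lambda>m. A * (Y m + Z m)) {..<N}"
        by (rule L2_set_mono) (use bound in auto)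
      also have "\<dots> = A * L2_set (\<lambda>m. Y m + Z m) {..<N}"
        using A by (simp add: L2_set_right_distrib)
      also have "\<dots> \<le> A * (L2_set Y {..<N} + L2_set Z {..<N})"
        by (intro mult_left_mono L2_set_triangle_ineq A)
      also have "\<dots> \<le> A * (l2norm g / (1 - \<rho>) + (1 / (1 - \<rho>) + 1) / (1 - \<rho>) * l2norm g)"
      proof (intro mult_left_mono add_mono A)
        show "L2_set Y {..<N} \<le> l2norm g / (1 - \<rho>)"
          using geometric_convolution_left[of \<rho> g N] \<rho> g by (simp add: Y_def[abs_def])
        show "L2_set Z {..<N} \<le> (1 / (1 - \<rho>) + 1) / (1 - \<rho>) * l2norm g"
          using geometric_convolution_right(2)[of \<rho> g N] \<rho> g by (simp add: Z_def[abs_def])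
      qed
      also have "\<dots> = B * l2norm g"
        by (simp add: B_def algebra_simps)
      finally show ?thesis .
    qed
    then show ?thesis
      using l2I[of "green g" "B * l2norm g"] by simp
  qed
  then show thesis
    by (rule that)
qed

lemma J_green:
  assumes "cmod w < 1" "\<kappa> \<noteq> 0" "g \<in> l2"
  shows "J (green g) m - z * green g m = g m"
proof -
  have right: "green_right g m = \<psi> (Suc m) * g (Suc m) + green_right g (Suc m)" for m
    unfolding green_right_def
    using suminf_split_head[OF summable_psi_mult[OF assms(1,3), of m]] by simp
  have left: "green_left g (Suc m) = green_left g m + p z (Suc m) * g (Suc m)" for m
    by (simp add: green_left_def)
  define X T where "X = green_left g m" and "T = green_right g m"
  \<comment> \<open>The two contributions of g (Suc m) cancel, so the sums X and T taken at m serve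
    at m + 1 as well.\<close>
  have up: "green g (Suc m) = (\<psi> (Suc m) * X + p z (Suc m) * T) / \<kappa>"
    using right[of m] by (simp add: green_def X_def T_def left algebra_simps)
  note up = this
  have here: "\<kappa> * green g m = \<psi> m * X + p z m * T"
    using assms(2) by (simp add: green_def X_def T_def)
  have up: "\<kappa> * green g (Suc m) = \<psi> (Suc m) * X + p z (Suc m) * T"
    using up assms(2) by simp
  have "\<kappa> * (J (green g) m - z * green g m) = \<kappa> * g m"
  proof (cases m)
    case 0
    \<comment> \<open>In row 0 the right-hand side comes from the defect of \<open>\<psi>\<close>:
      it is \<open>\<kappa>\<close> times X.\<close>
    have X: "X = g 0"
      by (simp add: X_def green_left_def 0)
    have "\<kappa> * (J (green g) m - z * green g m) =
        s 1 * (\<kappa> * green g (Suc m)) / 2 + \<beta> 0 * (\<kappa> * green g m) - z * (\<kappa> * green g m)"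
      by (simp add: J_def 0 algebra_simps)
    also have "\<dots> = X * (J \<psi> 0 - z * \<psi> 0) + T * (J (p z) 0 - z * p z 0)"
      unfolding up here by (simp add: J_def 0 del: p.simps) (simp add: add_divide_distrib algebra_simps del: p.simps)
    also have "\<dots> = \<kappa> * g m"
      unfolding J_p X \<kappa>_def by (simp add: 0)
    finally show ?thesis .
  next
    case (Suc k)
    \<comment> \<open>One index back, the term n = m moves from the left sum to the right one. In
      the row equation this mismatch leaves g m times the Wronskian, that is \<open>\<kappa>\<close>
      g m; the parts with X and T vanish.\<close>
    have "green g k = (\<psi> k * (X - p z m * g m) + p z k * (T + \<psi> m * g m)) / \<kappa>"
      using left[of k] right[of k] by (simp add: green_def X_def T_def Suc algebra_simps)
    then have down: "\<kappa> * green g k = \<psi> k * (X - p z m * g m) + p z k * (T + \<psi> m * g m)"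
      using assms(2) by simp
    have "\<kappa> * (J (green g) m - z * green g m) =
        (s (Suc m) * (\<kappa> * green g (Suc m)) + s m * (\<kappa> * green g k)) / 2
        + \<beta> m * (\<kappa> * green g m) - z * (\<kappa> * green g m)"
      by (simp add: J_def Suc add_divide_distrib algebra_simps)
    also have "\<dots> = X * (J \<psi> m - z * \<psi> m) + T * (J (p z) m - z * p z m) - g m * W (p z) \<psi> k / 2"
      unfolding up here down
      by (simp add: J_def W_def Suc add_divide_distrib diff_divide_distrib algebra_simps del: p.simps)
    also have "\<dots> = \<kappa> * g m"
      using J_psi[of k] by (simp add: J_p W_p_psi Suc)
    finally show ?thesis .
  qed
  then show ?thesis
    using assms(2) by simp
qed

text \<open>By \<open>J_green\<close> the difference of the two sides is a square-summable solution
  of the homogeneous equation, hence 0.\<close>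

lemma green_J:
  assumes "cmod w < 1" "\<kappa> \<noteq> 0" "g \<in> l2"
  shows "green (\<lambda>n. J g n - z * g n) m = g m"
proof -
  obtain K where K: "\<And>g. g \<in> l2 \<Longrightarrow> green g \<in> l2 \<and> l2norm (green g) \<le> K * l2norm g"
    by (rule green_bounded[OF assms(1)]) blast
  define f where "f = green (\<lambda>n. J g n - z * g n)"
  have gl: "(\<lambda>n. J g n - z * g n) \<in> l2"
    by (intro l2_diff l2_scale J_l2 assms)
  then have "f \<in> l2"
    using K by (simp add: f_def)
  have "J (\<lambda>n. f n - g n) n = z * (f n - g n)" for n
    using J_green[OF assms(1,2) gl, of n] by (simp add: J_diff f_def algebra_simps)
  then have "f m - g m = 0"
    by (intro no_l2_eigenvector[OF assms(1,2)] l2_diff \<open>f \<in> l2\<close> assms)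
  then show ?thesis
    by (simp add: f_def)
qed

end


section \<open>The Al-Salam--Chihara recurrence\<close>

lemma qpoch_0 [simp]: "qpoch a q 0 = 1"
  by (simp add: qpoch_def)

lemma qpoch_Suc: "qpoch a q (Suc n) = qpoch a q n * (1 - a * q ^ n)"
  by (simp add: qpoch_def)

lemma qpoch_of_real:
  "qpoch (of_real a :: complex) (of_real q) n = of_real (qpoch a q n)"
  by (simp add: qpoch_def)

lemma convergent_prod_qpoch:
  fixes a q :: complex
  assumes "cmod q < 1"
  shows "convergent_prod (\<lambda>r. 1 - a * q ^ r)"
proof -
  have "summable (\<lambda>r. cmod a * cmod q ^ r)"
    using assms by (intro summable_mult summable_geometric) simp
  then have "summable (\<lambda>r. norm ((1 - a * q ^ r) - 1))"
    by (simp add: norm_mult norm_power)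
  then show ?thesis
    by (intro abs_convergent_prod_imp_convergent_prod summable_imp_abs_convergent_prod)
qed

lemma qpoch_LIMSEQ:
  fixes a q :: complex
  assumes "cmod q < 1"
  shows "qpoch a q \<longlonglongrightarrow> qpoch_inf a q"
proof -
  have "(\<lambda>n. qpoch a q (Suc n)) \<longlonglongrightarrow> qpoch_inf a q"
    using convergent_prod_LIMSEQ[OF convergent_prod_qpoch[OF assms, of a]]
    by (simp add: qpoch_def qpoch_inf_def lessThan_Suc_atMost)
  then show ?thesis
    by (rule LIMSEQ_imp_Suc)
qed

lemma qpoch_factor_ne_0:
  fixes a q :: complex
  assumes "cmod q \<le> 1" "cmod a < 1"
  shows "1 - a * q ^ r \<noteq> 0"
proof
  assume "1 - a * q ^ r = 0"
  then have "cmod (a * q ^ r) = 1"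
    by (metis eq_iff_diff_eq_0 norm_one)
  moreover have "cmod q ^ r \<le> 1"
    using assms(1) by (simp add: power_le_one)
  then have "cmod (a * q ^ r) \<le> cmod a"
    by (simp add: norm_mult norm_power mult_left_le)
  ultimately show False
    using assms(2) by simp
qed

lemma qpoch_inf_ne_0:
  assumes "cmod q < 1" "cmod a < 1"
  shows "qpoch_inf a q \<noteq> 0"
  unfolding qpoch_inf_def
  using prodinf_nonzero[OF convergent_prod_qpoch[OF assms(1)]] qpoch_factor_ne_0[of q a] assms by simp

locale q_laguerre =
  fixes q l :: real
  assumes q_pos: "0 < q" and q_less: "q < 1" and l_pos: "0 < l"
begin

text \<open>The Al-Salam--Chihara parameters q^(alpha/2 + 1/4) and q^(alpha/2 + 3/4) for alpha = 2 l
  - 1. A exceeds 1 precisely when l < 1/4.\<close>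

definition A :: real where "A = q powr (l - 1/4)"
definition B :: real where "B = q powr (l + 1/4)"

definition sq :: "nat \<Rightarrow> real" where
  "sq n = sqrt ((1 - A * B * q ^ (n - 1)) * (1 - q ^ n))"

definition bq :: "nat \<Rightarrow> real" where
  "bq n = (A + B) * q ^ n / 2"

text \<open>\<open>basis_coeff\<close> without its power of q; it also converts orthonormal
  polynomials into solutions of a recurrence without square roots.\<close>

definition g :: "nat \<Rightarrow> real" where
  "g n = sqrt (qpoch (A * B) q n / qpoch q q n)"

lemma A_pos: "0 < A" and B_pos: "0 < B"
  using q_pos by (simp_all add: A_def B_def)

lemma B_less: "B < 1"
  using powr_less_mono'[of q 0 "l + 1/4"] q_pos q_less l_pos by (simp add: B_def)

lemma AB_eq: "A * B = q powr (2 * l)"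
  by (simp add: A_def B_def powr_add[symmetric])

lemma AB_pos: "0 < A * B" and AB_less: "A * B < 1"
  using A_pos B_pos powr_less_mono'[of q 0 "2 * l"] q_pos q_less l_pos by (simp_all add: AB_eq)

lemma q_power_le: "q ^ n \<le> 1"
  using q_pos q_less by (simp add: power_le_one)

lemma AB_factor: "1 - A * B \<le> 1 - A * B * q ^ n" "0 < 1 - A * B * q ^ n" "1 - A * B * q ^ n \<le> 1"
proof -
  show 1: "1 - A * B \<le> 1 - A * B * q ^ n"
    using mult_left_mono[OF q_power_le[of n], of "A * B"] AB_pos by simp
  show "0 < 1 - A * B * q ^ n"
    using 1 AB_less by linarith
  show "1 - A * B * q ^ n \<le> 1"
    using AB_pos q_pos by (simp add: less_imp_le)
qed

lemma q_factor: "1 - q \<le> 1 - q ^ Suc n" "0 < 1 - q ^ Suc n" "1 - q ^ n \<le> 1"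
proof -
  have "q * q ^ n \<le> q * 1"
    using q_power_le q_pos by (intro mult_left_mono) auto
  then show "1 - q \<le> 1 - q ^ Suc n" "0 < 1 - q ^ Suc n" "1 - q ^ n \<le> 1"
    unfolding power_Suc using q_pos q_less by (linarith, linarith, simp)
qed

text \<open>Both factors under the root increase with n, so the lower bound for the weights is
  \<open>sq 1\<close>. The bound on the diagonal is its entry at n = 0.\<close>

sublocale jacobi sq bq "sqrt ((1 - A * B) * (1 - q))" "(A + B) / 2"
proof
  show "sq 0 = 0"
    by (simp add: sq_def)
  show "0 < sqrt ((1 - A * B) * (1 - q))"
    using AB_less q_less by simp
  show "sqrt ((1 - A * B) * (1 - q)) \<le> sq (Suc n)" for n
    using AB_less q_less AB_factor[of n] q_factor[of n]
    by (auto simp: sq_def simp del: power_Suc intro!: mult_mono)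
  show "sq n \<le> 1" for n
  proof -
    have "(1 - A * B * q ^ (n - 1)) * (1 - q ^ n) \<le> 1 * 1"
      using AB_factor[of "n - 1"] q_factor(3)[of n] q_power_le[of n] by (intro mult_mono) auto
    then show ?thesis
      by (simp add: sq_def)
  qed
  show "\<bar>bq n\<bar> \<le> (A + B) / 2" for n
    using A_pos B_pos q_power_le[of n] q_pos mult_left_mono[of "q ^ n" 1 "A + B"]
    by (simp add: bq_def abs_mult)
qed

lemma qpoch_ab_pos: "0 < qpoch (A * B) q n" and qpoch_qq_pos: "0 < qpoch q q n"
  using qpoch_pos[of q] q_pos q_less AB_pos AB_less by auto

lemma g_pos: "0 < g n"
  using qpoch_ab_pos qpoch_qq_pos by (simp add: g_def)

lemma g_0 [simp]: "g 0 = 1"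
  by (simp add: g_def)

lemma g_Suc:
  "g (Suc n) = g n * sqrt (1 - A * B * q ^ n) / sqrt (1 - q ^ Suc n)"
  unfolding g_def qpoch_Suc by (simp add: real_sqrt_mult real_sqrt_divide)

lemma sq_g:
  "sq (Suc n) * g n = (1 - q ^ Suc n) * g (Suc n)"
  "sq (Suc n) * g (Suc n) = (1 - A * B * q ^ n) * g n"
proof -
  have sq: "sq (Suc n) = sqrt (1 - A * B * q ^ n) * sqrt (1 - q ^ Suc n)"
    by (simp add: sq_def real_sqrt_mult)
  define u v where "u = sqrt (1 - A * B * q ^ n)" and "v = sqrt (1 - q ^ Suc n)"
  have uv: "v > 0" "u\<^sup>2 = 1 - A * B * q ^ n" "v\<^sup>2 = 1 - q ^ Suc n"
    using AB_factor[of n] q_factor[of n] by (auto simp: u_def v_def simp del: power_Suc)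
  show "sq (Suc n) * g n = (1 - q ^ Suc n) * g (Suc n)"
    unfolding g_Suc sq u_def[symmetric] v_def[symmetric] uv(3)[symmetric]
    using uv(1) by (simp add: power2_eq_square)
  show "sq (Suc n) * g (Suc n) = (1 - A * B * q ^ n) * g n"
    unfolding g_Suc sq u_def[symmetric] v_def[symmetric] uv(2)[symmetric]
    using uv(1) by (simp add: power2_eq_square)
qed

text \<open>In terms of \<open>y n = g n * u n\<close> the eigenvalue equation has rational coefficients.\<close>

definition rec :: "complex \<Rightarrow> (nat \<Rightarrow> complex) \<Rightarrow> nat \<Rightarrow> bool" where
  "rec z y n \<longleftrightarrow> complex_of_real (1 - q ^ Suc n) * y (Suc n)
     + (if n = 0 then 0 else complex_of_real (1 - A * B * q ^ (n - 1)) * y (n - 1))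
     = (2 * z - complex_of_real ((A + B) * q ^ n)) * y n"

lemma J_iff_rec:
  fixes u :: "nat \<Rightarrow> complex" and z :: complex
  shows "J u n = z * u n \<longleftrightarrow> rec z (\<lambda>n. complex_of_real (g n) * u n) n"
proof -
  have g: "complex_of_real (g n) \<noteq> 0"
    using g_pos[of n] by simp
  have 1: "complex_of_real (g n) * (sq (Suc n) * u (Suc n)) = complex_of_real (1 - q ^ Suc n) * (g (Suc n) * u (Suc n))"
    using arg_cong[OF sq_g(1)[of n], of complex_of_real] by (simp add: mult_ac)
  have 2: "complex_of_real (g n) * (sq n * u (n - 1)) =
      (if n = 0 then 0 else complex_of_real (1 - A * B * q ^ (n - 1)) * (g (n - 1) * u (n - 1)))"
  proof (cases n)
    case (Suc m)
    show ?thesis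
      using arg_cong[OF sq_g(2)[of m], of complex_of_real] by (simp add: Suc mult_ac)
  qed simp
  have "J u n = z * u n \<longleftrightarrow> complex_of_real (g n) * (2 * J u n) = complex_of_real (g n) * (2 * (z * u n))"
    using g by simp
  also have "complex_of_real (g n) * (2 * J u n) = complex_of_real (g n) * (sq (Suc n) * u (Suc n))
      + complex_of_real (g n) * (sq n * u (n - 1)) + complex_of_real ((A + B) * q ^ n) * (g n * u n)"
    by (simp add: J_def bq_def add_divide_distrib algebra_simps)
  finally show ?thesis
    unfolding 1 2 rec_def by (auto simp: algebra_simps)
qed

text \<open>The Al-Salam--Chihara polynomials with parameters A, B, divided by the q-shifted
  factorial of q.\<close>

definition Q :: "complex \<Rightarrow> nat \<Rightarrow> complex" where
  "Q z n = complex_of_real (g n) * p z n"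

lemma rec_Q: "rec z (Q z) n"
  using J_iff_rec[of "p z" n z] J_p[of z n] by (simp add: Q_def[abs_def])

lemma Q_0: "Q z 0 = 1"
  by (simp add: Q_def)

text \<open>The bridge to explicit formulas: any sequence shown to satisfy \<open>rec\<close> with
  initial value 1 is \<open>Q\<close>.\<close>

lemma rec_unique:
  fixes y :: "nat \<Rightarrow> complex"
  assumes "\<And>n. rec z y n" "y 0 = 1"
  shows "y n = Q z n"
proof -
  have g: "complex_of_real (g n) \<noteq> 0" for n
    using g_pos[of n] by simp
  have "(\<lambda>n. complex_of_real (g n) * (y n / g n)) = y"
    using g by simp
  then have "J (\<lambda>n. y n / g n) n = z * (y n / g n)" for n
    using J_iff_rec[of "\<lambda>n. y n / g n" n z] assms(1)[of n] by simp
  from J_eigen_unique[OF this, of n] show ?thesis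
    using g[of n] assms(2) by (simp add: Q_def field_simps)
qed

lemma qpoch_real_LIMSEQ:
  assumes "0 < a" "a < 1"
  obtains L where "qpoch a q \<longlonglongrightarrow> L" "L > 0"
proof -
  let ?L = "qpoch_inf (complex_of_real a) (complex_of_real q)"
  have lim: "(\<lambda>n. complex_of_real (qpoch a q n)) \<longlonglongrightarrow> ?L"
    using qpoch_LIMSEQ[of "complex_of_real q" "complex_of_real a"] q_pos q_less
    by (simp add: qpoch_of_real[abs_def])
  from tendsto_norm[OF this] have "(\<lambda>n. \<bar>qpoch a q n\<bar>) \<longlonglongrightarrow> cmod ?L"
    by simp
  then have "qpoch a q \<longlonglongrightarrow> cmod ?L"
    using qpoch_pos[OF q_pos q_less assms(2,1)] by (simp add: abs_of_pos)
  moreover have "cmod ?L > 0"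
    using qpoch_inf_ne_0[of "complex_of_real q" "complex_of_real a"] q_pos q_less assms by simp
  ultimately show thesis
    by (rule that)
qed

text \<open>The positive limit makes division by g harmless for asymptotics of type w^n.\<close>

lemma g_LIMSEQ:
  obtains G where "g \<longlonglongrightarrow> G" "G > 0"
proof -
  obtain L where L: "qpoch (A * B) q \<longlonglongrightarrow> L" "L > 0"
    using qpoch_real_LIMSEQ[OF AB_pos AB_less] .
  obtain L' where L': "qpoch q q \<longlonglongrightarrow> L'" "L' > 0"
    using qpoch_real_LIMSEQ[OF q_pos q_less] .
  have "g \<longlonglongrightarrow> sqrt (L / L')"
    unfolding g_def[abs_def] using L'(2) by (intro tendsto_intros L(1) L'(1)) auto
  moreover have "sqrt (L / L') > 0"
    using L L' by simp
  ultimately show thesis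
    by (rule that)
qed

subsection \<open>The Jost solution\<close>

text \<open>Comparing coefficients of \<open>q\<^sup>n\<^sup>k\<close> in the recurrence for \<open>w\<^sup>n (\<Sum>k. c\<^sub>k q\<^sup>n\<^sup>k)\<close> gives a two-term recursion
  for the \<open>c\<^sub>k\<close>.\<close>

definition jc :: "complex \<Rightarrow> nat \<Rightarrow> complex" where
  "jc w k = (\<Prod>j<k. (w * complex_of_real q ^ Suc j - complex_of_real A) * (w * complex_of_real q ^ Suc j - complex_of_real B)
     / ((1 - complex_of_real q ^ Suc j) * (1 - w\<^sup>2 * complex_of_real q ^ Suc j)))"

text \<open>Apart from 1 / g n this is w^n times the basic hypergeometric series 2phi1 with
  parameters w q / A, w q / B over w^2 q, base q and argument A B q^n.\<close>

definition jost_sol :: "complex \<Rightarrow> nat \<Rightarrow> complex" where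
  "jost_sol w n = w ^ n * (\<Sum>k. jc w k * (complex_of_real q ^ n) ^ k) / complex_of_real (g n)"

context
  fixes w :: complex
  assumes w_le: "cmod w \<le> 1"
begin

text \<open>The powers of q in \<open>jc\<close> start at q^1, so the denominators survive on the
  whole closed disc, including w = 1 and w = -1.\<close>

lemma w_factor_ne: "1 - w\<^sup>2 * complex_of_real q ^ Suc j \<noteq> 0"
proof -
  have "cmod (w\<^sup>2) \<le> 1"
    using w_le by (simp add: norm_power power_le_one)
  then have "cmod (w\<^sup>2) * q \<le> 1 * q"
    using q_pos by (intro mult_right_mono) auto
  then have "cmod (w\<^sup>2 * q) < 1"
    using q_pos q_less by (simp only: norm_mult norm_of_real abs_of_pos mult_1)
  then show ?thesis
    using qpoch_factor_ne_0[of "complex_of_real q" "w\<^sup>2 * q" j] q_pos q_less by (simp add: mult.assoc)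
qed

lemma q_factor_ne: "1 - complex_of_real q ^ Suc j \<noteq> 0"
proof -
  have "complex_of_real (1 - q ^ Suc j) \<noteq> 0"
    using q_factor(2)[of j] by (simp only: of_real_eq_0_iff)
  then show ?thesis
    by simp
qed

lemma jc_Suc:
  "jc w (Suc k) * ((1 - q ^ Suc k) * (1 - w\<^sup>2 * q ^ Suc k)) = jc w k * ((w * q ^ Suc k - A) * (w * q ^ Suc k - B))"
  using w_factor_ne[of k] q_factor_ne[of k] by (simp add: jc_def)

text \<open>Ratio test: consecutive terms have ratio tending to A B < 1. The point x = q^0 = 1 is
  needed, hence absolute summability of the bare coefficients.\<close>

lemma summable_jc: "summable (\<lambda>k. cmod (jc w k))"
proof -
  let ?c = complex_of_real
  let ?R = "\<lambda>k. (w * ?c q ^ Suc k - ?c A) * (w * ?c q ^ Suc k - ?c B) / ((1 - ?c q ^ Suc k) * (1 - w\<^sup>2 * ?c q ^ Suc k))"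
  have q0: "(\<lambda>k. complex_of_real q ^ Suc k) \<longlonglongrightarrow> 0"
    using q_pos q_less by (intro LIMSEQ_Suc[of "\<lambda>k. complex_of_real q ^ k"] LIMSEQ_power_zero) simp
  have "?R \<longlonglongrightarrow> (w * 0 - A) * (w * 0 - B) / ((1 - 0) * (1 - w\<^sup>2 * 0))"
    by (intro tendsto_intros q0) simp_all
  then have "(\<lambda>k. cmod (?R k)) \<longlonglongrightarrow> cmod ((w * 0 - A) * (w * 0 - B) / ((1 - 0) * (1 - w\<^sup>2 * 0)))"
    by (rule tendsto_norm)
  then have lim: "(\<lambda>k. cmod (?R k)) \<longlonglongrightarrow> A * B"
    using A_pos B_pos by (simp add: norm_mult)
  obtain \<rho> where \<rho>: "A * B < \<rho>" "\<rho> < 1"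
    using dense AB_less by blast
  have "\<forall>\<^sub>F k in sequentially. cmod (?R k) < \<rho>"
    by (rule order_tendstoD(2)[OF lim \<rho>(1)])
  then obtain N where N: "\<And>k. k \<ge> N \<Longrightarrow> cmod (?R k) < \<rho>"
    by (auto simp: eventually_sequentially)
  show ?thesis
  proof (rule summable_ratio_test[OF \<rho>(2)])
    fix k assume "k \<ge> N"
    have "jc w (Suc k) = jc w k * ?R k"
      by (simp add: jc_def)
    then have "cmod (jc w (Suc k)) = cmod (?R k) * cmod (jc w k)"
      by (simp only: norm_mult mult.commute)
    also have "\<dots> \<le> \<rho> * cmod (jc w k)"
      using N[OF \<open>k \<ge> N\<close>] by (intro mult_right_mono) auto
    finally show "norm (cmod (jc w (Suc k))) \<le> \<rho> * norm (cmod (jc w k))"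
      by simp
  qed
qed

lemma summable_jc_power:
  assumes "cmod x \<le> 1"
  shows "summable (\<lambda>k. jc w k * x ^ k)"
proof (rule summable_comparison_test'[OF summable_jc])
  show "norm (jc w k * x ^ k) \<le> cmod (jc w k)" for k
    using assms by (simp add: norm_mult norm_power power_le_one mult_left_le)
qed

lemma jc_series_LIMSEQ: "(\<lambda>n. \<Sum>k. jc w k * (complex_of_real q ^ n) ^ k) \<longlonglongrightarrow> 1"
proof -
  define S where "S = (\<Sum>k. cmod (jc w (Suc k)))"
  have sS: "summable (\<lambda>k. cmod (jc w (Suc k)))"
    using summable_jc summable_Suc_iff[of "\<lambda>k. cmod (jc w k)"] by simp
  have bound: "cmod ((\<Sum>k. jc w k * (complex_of_real q ^ n) ^ k) - 1) \<le> S * q ^ n" for n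
  proof -
    let ?x = "complex_of_real q ^ n"
    have x: "cmod ?x = q ^ n" "cmod ?x \<le> 1"
      using q_pos q_power_le[of n] by (simp_all add: norm_power)
    have "(\<Sum>k. jc w k * ?x ^ k) - 1 = (\<Sum>k. jc w (Suc k) * ?x ^ Suc k)"
      using suminf_split_head[OF summable_jc_power[OF x(2)]] by (simp add: jc_def)
    also have "cmod \<dots> \<le> (\<Sum>k. cmod (jc w (Suc k)) * q ^ n)"
    proof (rule norm_suminf_le)
      show "summable (\<lambda>k. cmod (jc w (Suc k)) * q ^ n)"
        by (rule summable_mult2[OF sS])
      show "cmod (jc w (Suc k) * ?x ^ Suc k) \<le> cmod (jc w (Suc k)) * q ^ n" for k
      proof -
        have "cmod (?x ^ Suc k) = q ^ n * cmod (?x ^ k)"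
          by (simp add: norm_mult x(1))
        also have "\<dots> \<le> q ^ n"
          using x(2) q_pos by (simp add: norm_power power_le_one mult_left_le)
        finally show ?thesis
          unfolding norm_mult by (intro mult_left_mono) auto
      qed
    qed
    also have "\<dots> = S * q ^ n"
      unfolding S_def by (rule suminf_mult2[OF sS, symmetric])
    finally show ?thesis .
  qed
  have "(\<lambda>n. (\<Sum>k. jc w k * (complex_of_real q ^ n) ^ k) - 1) \<longlonglongrightarrow> 0"
  proof (rule Lim_null_comparison)
    show "\<forall>\<^sub>F n in sequentially. cmod ((\<Sum>k. jc w k * (complex_of_real q ^ n) ^ k) - 1) \<le> S * q ^ n"
      using bound by simp
    show "(\<lambda>n. S * q ^ n) \<longlonglongrightarrow> 0"
      using tendsto_mult_left[OF LIMSEQ_power_zero[of q], of S] q_pos q_less by simp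
  qed
  then show ?thesis
    by (rule LIM_zero_cancel)
qed

lemma jc_series_equation:
  fixes x :: complex
  assumes "cmod x \<le> 1"
  defines "f \<equiv> \<lambda>x::complex. \<Sum>k. jc w k * x ^ k"
  shows "w\<^sup>2 * (1 - q\<^sup>2 * x) * f (q\<^sup>2 * x) + (1 - A * B * x) * f x = (w\<^sup>2 + 1 - w * (A + B) * (q * x)) * f (q * x)"
proof -
  have le: "cmod (q * x) \<le> 1" "cmod (q\<^sup>2 * x) \<le> 1"
    using assms(1) q_pos q_less
    by (auto simp: norm_mult norm_power intro!: mult_le_one power_le_one)
  note s = summable_sums[OF summable_jc_power[OF assms(1)]]
    summable_sums[OF summable_jc_power[OF le(1)]] summable_sums[OF summable_jc_power[OF le(2)]]
  \<comment> \<open>The weight is 1 - (w^2 + 1) q^k + w^2 q^(2 k). The series of d is summed twice: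
    directly, and after an index shift by \<open>jc_Suc\<close>, which loses nothing because d 0 =
    0.\<close>
  define d where "d k = jc w k * x ^ k * ((1 - q ^ k) * (1 - w\<^sup>2 * q ^ k))" for k
  have "(\<lambda>k. w\<^sup>2 * (jc w k * (q\<^sup>2 * x) ^ k) + jc w k * x ^ k - (w\<^sup>2 + 1) * (jc w k * (q * x) ^ k)) sums
      (w\<^sup>2 * f (q\<^sup>2 * x) + f x - (w\<^sup>2 + 1) * f (q * x))"
    unfolding f_def by (intro sums_add sums_diff sums_mult s)
  moreover have "w\<^sup>2 * (jc w k * (q\<^sup>2 * x) ^ k) + jc w k * x ^ k - (w\<^sup>2 + 1) * (jc w k * (q * x) ^ k) = d k" for k
    by (simp add: d_def power_mult_distrib power2_eq_square algebra_simps)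
  ultimately have d1: "d sums (w\<^sup>2 * f (q\<^sup>2 * x) + f x - (w\<^sup>2 + 1) * f (q * x))"
    by simp
  have "(\<lambda>k. (w\<^sup>2 * (q\<^sup>2 * x)) * (jc w k * (q\<^sup>2 * x) ^ k) + (A * B * x) * (jc w k * x ^ k)
        - (w * (A + B) * (q * x)) * (jc w k * (q * x) ^ k)) sums
      ((w\<^sup>2 * (q\<^sup>2 * x)) * f (q\<^sup>2 * x) + (A * B * x) * f x - (w * (A + B) * (q * x)) * f (q * x))"
    unfolding f_def by (intro sums_add sums_diff sums_mult s)
  moreover have "(w\<^sup>2 * (q\<^sup>2 * x)) * (jc w k * (q\<^sup>2 * x) ^ k) + (A * B * x) * (jc w k * x ^ k)
        - (w * (A + B) * (q * x)) * (jc w k * (q * x) ^ k) = d (Suc k)" for k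
  proof -
    have "d (Suc k) = x ^ Suc k * (jc w (Suc k) * ((1 - q ^ Suc k) * (1 - w\<^sup>2 * q ^ Suc k)))"
      by (simp add: d_def mult_ac)
    also have "\<dots> = x ^ Suc k * (jc w k * ((w * q ^ Suc k - A) * (w * q ^ Suc k - B)))"
      by (simp only: jc_Suc)
    finally show ?thesis
      by (simp add: power_mult_distrib power2_eq_square algebra_simps)
  qed
  ultimately have "(\<lambda>k. d (Suc k)) sums
      ((w\<^sup>2 * (q\<^sup>2 * x)) * f (q\<^sup>2 * x) + (A * B * x) * f x - (w * (A + B) * (q * x)) * f (q * x))"
    by simp
  then have "d sums
      ((w\<^sup>2 * (q\<^sup>2 * x)) * f (q\<^sup>2 * x) + (A * B * x) * f x - (w * (A + B) * (q * x)) * f (q * x))"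
    unfolding sums_Suc_iff by (simp add: d_def)
  from sums_unique2[OF d1 this] show ?thesis
    by (simp add: algebra_simps)
qed

text \<open>The equation of the series at x = q^n is row n + 1, so n >= 0 gives all rows except the
  boundary row. The series tends to 1, whence L is 1 over the limit of g.\<close>

lemma jost_jost_sol:
  assumes "w \<noteq> 0" "2 * z = w + 1 / w"
  obtains L where "jost sq bq (sqrt ((1 - A * B) * (1 - q))) ((A + B) / 2) z w L (jost_sol w)"
proof -
  obtain G where G: "g \<longlonglongrightarrow> G" "G > 0"
    by (rule g_LIMSEQ)
  define f where "f x = (\<Sum>k. jc w k * x ^ k)" for x :: complex
  have gne: "complex_of_real (g n) \<noteq> 0" for n
    using g_pos[of n] by simp
  have y: "complex_of_real (g n) * jost_sol w n = w ^ n * f (q ^ n)" for n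
    using gne[of n] by (simp add: jost_sol_def f_def)
  have "jost sq bq (sqrt ((1 - A * B) * (1 - q))) ((A + B) / 2) z w (1 / G) (jost_sol w)"
  proof
    show "w \<noteq> 0" "cmod w \<le> 1"
      by (rule assms w_le)+
    show "J (jost_sol w) (Suc n) = z * jost_sol w (Suc n)" for n
    proof -
      let ?x = "complex_of_real q ^ n"
      have "cmod ?x \<le> 1"
        using q_pos q_power_le[of n] by (simp add: norm_power)
      note eq = jc_series_equation[OF this, folded f_def]
      have "2 * z * w = w\<^sup>2 + 1"
        using assms by (simp add: power2_eq_square field_simps)
      then have "(w\<^sup>2 + 1 - w * (A + B) * (q * ?x)) = w * (2 * z - (A + B) * q ^ Suc n)"
        by (simp add: algebra_simps)
      with eq have "w ^ n * (w\<^sup>2 * (1 - q\<^sup>2 * ?x) * f (q\<^sup>2 * ?x) + (1 - A * B * ?x) * f ?x) =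
          w ^ n * (w * (2 * z - (A + B) * q ^ Suc n) * f (q * ?x))"
        by simp
      then have "rec z (\<lambda>n. w ^ n * f (q ^ n)) (Suc n)"
        by (simp add: rec_def power2_eq_square algebra_simps)
      then show ?thesis
        unfolding J_iff_rec y .
    qed
    have "(\<lambda>n. f (q ^ n) / g n) \<longlonglongrightarrow> 1 / complex_of_real G"
      using G jc_series_LIMSEQ unfolding f_def by (intro tendsto_intros) auto
    moreover have "jost_sol w n / w ^ n = f (q ^ n) / g n" for n
      using assms(1) by (simp add: jost_sol_def f_def)
    ultimately show "(\<lambda>n. jost_sol w n / w ^ n) \<longlonglongrightarrow> complex_of_real (1 / G)"
      by simp
    show "complex_of_real (1 / G) \<noteq> 0"
      using G by simp
  qed
  then show thesis
    by (rule that)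
qed

end

end


subsection \<open>The continuous \<open>q\<close>-Laguerre polynomials\<close>

lemma qpoch_shift: "(1 - a) * qpoch (a * q) q k = qpoch a q (Suc k)"
  unfolding qpoch_def prod.lessThan_Suc_shift by (simp add: mult.assoc)

text \<open>The product of the q-shifted factorials of a e^(i theta) and a e^(-i theta), written in
  z = cos theta to eliminate the angle.\<close>

definition aw_factor :: "complex \<Rightarrow> complex \<Rightarrow> complex \<Rightarrow> nat \<Rightarrow> complex" where
  "aw_factor a q z k = (\<Prod>r<k. 1 - 2 * a * q ^ r * z + (a * q ^ r)\<^sup>2)"

definition aw_weight :: "complex \<Rightarrow> complex \<Rightarrow> complex \<Rightarrow> complex \<Rightarrow> nat \<Rightarrow> complex" where
  "aw_weight a b q z k = aw_factor a q z k * q ^ k / (qpoch (a * b) q k * qpoch q q k)"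

text \<open>x stands for q^(-n). The shifts of n then become the dilations x / q and x q, and a
  recurrence in n becomes a q-difference equation in x.\<close>

definition aw_sum :: "complex \<Rightarrow> complex \<Rightarrow> complex \<Rightarrow> complex \<Rightarrow> nat \<Rightarrow> complex \<Rightarrow> complex" where
  "aw_sum a b q z N x = (\<Sum>k\<le>N. aw_weight a b q z k * qpoch x q k)"

text \<open>The difference equation in \<open>x\<close> holds for the sum truncated at any \<open>N\<close> with an error term that
  vanishes when \<open>x = q\<^sup>-\<^sup>n\<close> and \<open>n < N\<close>.\<close>

lemma aw_sum_difference_equation:
  fixes a b q z x :: complex
  assumes "a \<noteq> 0" "q \<noteq> 0" "x \<noteq> 0"
    and "\<And>k. 1 - a * b * q ^ k \<noteq> 0" "\<And>k. 1 - q * q ^ k \<noteq> 0"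
  shows "(1 - a * b / x) / a * (aw_sum a b q z N (x / q) - aw_sum a b q z N x)
      + a * (1 - 1 / x) * (aw_sum a b q z N (x * q) - aw_sum a b q z N x)
      - (2 * z - a - 1 / a) * aw_sum a b q z N x
    = aw_weight a b q z N * (1 - 2 * a * q ^ N * z + (a * q ^ N)\<^sup>2) / (q ^ N * a) * qpoch x q N"
    (is "?L N = ?d N")
proof (induction N)
  case 0
  show ?case
    using assms(1) by (simp add: aw_sum_def aw_weight_def aw_factor_def field_simps power2_eq_square)
next
  case (Suc N)
  define e F K where "e = aw_weight a b q z" and "F = qpoch x q N" and "K = q ^ N"
  have K: "K \<noteq> 0"
    using assms(2) by (simp add: K_def)
  have qab: "qpoch (a * b) q k \<noteq> 0" "qpoch q q k \<noteq> 0" for k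
    using assms(4,5) by (auto simp: qpoch_def)
  have e_Suc: "e N * (1 - 2 * a * K * z + (a * K)\<^sup>2) * q = e (Suc N) * ((1 - a * b * K) * (1 - q * K))"
    using qab[of N] assms(4)[of N] assms(5)[of N]
    by (simp add: e_def aw_weight_def aw_factor_def qpoch_Suc K_def)
  have p0: "qpoch x q (Suc N) = F * (1 - x * K)"
    by (simp add: qpoch_Suc F_def K_def)
  have p1: "qpoch (x / q) q (Suc N) = (1 - x / q) * F"
    using qpoch_shift[of "x / q" q N] assms(2) by (simp add: F_def)
  \<comment> \<open>Kept multiplied by 1 - x: the value x = 1, that is n = 0, is needed, and the
    coefficient 1 - 1/x supplies this factor.\<close>
  have p2: "(1 - x) * qpoch (x * q) q (Suc N) = F * (1 - x * K) * (1 - x * (q * K))"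
    using qpoch_shift[of x q "Suc N"] by (simp add: qpoch_Suc F_def K_def)
  define G where "G = qpoch (x * q) q (Suc N)"
  have s: "aw_sum a b q z (Suc N) y = aw_sum a b q z N y + e (Suc N) * qpoch y q (Suc N)" for y
    by (simp add: aw_sum_def e_def)
  have mid: "(1 - 1 / x) * (G - F * (1 - x * K)) = (q * K - 1) * (F * (1 - x * K))"
  proof -
    have "x * ((1 - 1 / x) * (G - F * (1 - x * K))) = - ((1 - x) * G) + (1 - x) * (F * (1 - x * K))"
      using assms(3) by (simp add: field_simps)
    also have "\<dots> = x * ((q * K - 1) * (F * (1 - x * K)))"
      unfolding G_def p2 by (simp add: algebra_simps)
    finally show ?thesis
      using assms(3) by simp
  qed
  have factor_F: "k * (C * ((1 - x / q) * F - F * (1 - x * K)) + a * ((q * K - 1) * (F * (1 - x * K)))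
      - D * (F * (1 - x * K))) = k * F * (C * (x * K - x / q) + a * ((q * K - 1) * (1 - x * K)) - D * (1 - x * K))"
    for k C D :: complex
    by (simp add: algebra_simps)
  have split_step: "C * ((S1 + k * P1) - (S0 + k * P0)) + a * E * ((S2 + k * P2) - (S0 + k * P0)) - D * (S0 + k * P0)
      = (C * (S1 - S0) + a * E * (S2 - S0) - D * S0) + k * (C * (P1 - P0) + a * (E * (P2 - P0)) - D * P0)"
    for C D E S0 S1 S2 P0 P1 P2 k :: complex
    by (simp add: algebra_simps)
  have "?L (Suc N) = ?L N + e (Suc N) * ((1 - a * b / x) / a * ((1 - x / q) * F - F * (1 - x * K))
      + a * ((1 - 1 / x) * (G - F * (1 - x * K))) - (2 * z - a - 1 / a) * (F * (1 - x * K)))"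
    unfolding s p0 p1 G_def[symmetric] split_step ..
  also have "\<dots> = ?L N + e (Suc N) * F * ((1 - a * b / x) / a * (x * K - x / q)
      + a * ((q * K - 1) * (1 - x * K)) - (2 * z - a - 1 / a) * (1 - x * K))"
    unfolding mid factor_F ..
  \<comment> \<open>The first part is the new error term; the second cancels the induction
    hypothesis by means of \<open>e_Suc\<close>.\<close>
  also have "(1 - a * b / x) / a * (x * K - x / q)
      + a * ((q * K - 1) * (1 - x * K)) - (2 * z - a - 1 / a) * (1 - x * K)
      = (1 - 2 * a * (q * K) * z + (a * (q * K))\<^sup>2) / (q * K * a) * (1 - x * K)
        - (1 - a * b * K) * (1 - q * K) / (q * K * a)"
    using assms(1,2,3) K by (simp add: field_simps power2_eq_square)
  also have "?L N = e (Suc N) * ((1 - a * b * K) * (1 - q * K)) / (q * K * a) * F"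
    unfolding Suc.IH e_Suc[symmetric] using assms(2) by (simp add: e_def K_def F_def mult_ac)
  finally have "?L (Suc N) = e (Suc N) * F * ((1 - 2 * a * (q * K) * z + (a * (q * K))\<^sup>2) / (q * K * a) * (1 - x * K))"
    by (simp add: algebra_simps)
  then show ?case
    unfolding p0 by (simp add: e_def K_def mult_ac)
qed

context q_laguerre
begin

definition laguerre_sum :: "complex \<Rightarrow> nat \<Rightarrow> complex" where
  "laguerre_sum z n = aw_sum A B q z n (inverse (complex_of_real q) ^ n)"

lemma qpoch_inverse_power_eq_0:
  assumes "n < k"
  shows "qpoch (inverse (complex_of_real q) ^ n) (complex_of_real q) k = 0"
proof -
  have "1 - inverse (complex_of_real q) ^ n * complex_of_real q ^ n = 0"
    using q_pos by (simp add: power_mult_distrib[symmetric])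
  then show ?thesis
    using assms by (auto simp: qpoch_def intro!: prod_zero)
qed

text \<open>The series terminates at n, so the sums for n - 1, n and n + 1 can share the truncation
  n + 1.\<close>

lemma aw_sum_eq_laguerre_sum:
  assumes "n \<le> N"
  shows "aw_sum A B q z N (inverse (complex_of_real q) ^ n) = laguerre_sum z n"
  unfolding aw_sum_def laguerre_sum_def
  by (rule sum.mono_neutral_right) (use assms in \<open>auto simp: qpoch_inverse_power_eq_0\<close>)

lemma laguerre_sum_recurrence:
  "complex_of_real (1 - A * B * q ^ n) / A * laguerre_sum z (Suc n)
     + complex_of_real (A * (1 - q ^ n)) * laguerre_sum z (n - 1)
   = (2 * z - complex_of_real ((A + B) * q ^ n)) * laguerre_sum z n"
proof -
  let ?q = "complex_of_real q" and ?A = "complex_of_real A" and ?B = "complex_of_real B"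
  let ?x = "inverse ?q ^ n"
  have ne: "?A \<noteq> 0" "?q \<noteq> 0" "?x \<noteq> 0"
    using A_pos q_pos by auto
  have ab: "1 - ?A * ?B * ?q ^ k \<noteq> 0" for k
  proof -
    have "complex_of_real (1 - A * B * q ^ k) \<noteq> 0"
      unfolding of_real_eq_0_iff using AB_factor(2)[of k] by linarith
    then show ?thesis
      by simp
  qed
  have qq: "1 - ?q * ?q ^ k \<noteq> 0" for k
    using q_factor_ne[of 0 k] by simp
  have xi: "1 / ?x = ?q ^ n"
    by (simp add: power_inverse[symmetric] divide_inverse)
  have abx: "?A * ?B / ?x = ?A * ?B * ?q ^ n"
    using xi by (simp add: divide_inverse)
  have x1: "?x / ?q = inverse ?q ^ Suc n"
    by (simp add: divide_inverse mult.commute)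
  have R: "aw_sum ?A ?B ?q z (Suc n) ?x = laguerre_sum z n"
    "aw_sum ?A ?B ?q z (Suc n) (inverse ?q ^ Suc n) = laguerre_sum z (Suc n)"
    by (rule aw_sum_eq_laguerre_sum; simp)+
  \<comment> \<open>For n = 0 the point x q = q is no power q^(-m), and n - 1 is 0; the factor 1 -
    q^0 = 0 disposes of both.\<close>
  have R': "(1 - ?q ^ n) * aw_sum ?A ?B ?q z (Suc n) (?x * ?q) = (1 - ?q ^ n) * laguerre_sum z (n - 1)"
  proof (cases n)
    case (Suc m)
    have eq: "inverse ?q ^ Suc m * ?q = inverse ?q ^ m"
      using ne(2) by simp
    show ?thesis
      unfolding Suc eq using aw_sum_eq_laguerre_sum[of m "Suc (Suc m)" z] by simp
  qed simp
  have "(1 - ?A * ?B * ?q ^ n) / ?A * (laguerre_sum z (Suc n) - laguerre_sum z n)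
      + ?A * ((1 - ?q ^ n) * aw_sum ?A ?B ?q z (Suc n) (?x * ?q) - (1 - ?q ^ n) * laguerre_sum z n)
      - (2 * z - ?A - 1 / ?A) * laguerre_sum z n = 0"
    using aw_sum_difference_equation[OF ne ab qq, of z "Suc n"]
    unfolding xi abx x1 R by (simp add: qpoch_inverse_power_eq_0 algebra_simps)
  then show ?thesis
    unfolding R' using ne(1) by (simp add: field_simps)
qed

text \<open>A factor h_n turns \<open>laguerre_sum_recurrence\<close> into \<open>rec\<close> if
  h_(n+1) / h_n = (1 - A B q^n) / (A (1 - q^(n+1))); with h_0 = 1 this is A^(-n) g_n^2.\<close>

lemma Q_eq_laguerre_sum:
  "Q z n = complex_of_real (inverse A ^ n * (g n)\<^sup>2) * laguerre_sum z n"
proof (rule rec_unique[symmetric])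
  show "complex_of_real (inverse A ^ 0 * (g 0)\<^sup>2) * laguerre_sum z 0 = 1"
    by (simp add: laguerre_sum_def aw_sum_def aw_weight_def aw_factor_def)
  fix n
  have g1: "(1 - q ^ Suc n) * (g (Suc n))\<^sup>2 = (1 - A * B * q ^ n) * (g n)\<^sup>2" for n
  proof -
    have "(1 - q ^ Suc n) * (g (Suc n))\<^sup>2 = ((1 - q ^ Suc n) * g (Suc n)) * g (Suc n)"
      by (simp add: power2_eq_square)
    also have "\<dots> = (sq (Suc n) * g (Suc n)) * g n"
      unfolding sq_g(1)[symmetric] by (simp only: mult_ac)
    finally show ?thesis
      by (simp only: sq_g(2) power2_eq_square mult.assoc)
  qed
  have up: "(1 - q ^ Suc n) * (inverse A ^ Suc n * (g (Suc n))\<^sup>2) = inverse A ^ n * (g n)\<^sup>2 * ((1 - A * B * q ^ n) / A)"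
    using g1[of n] by (simp add: divide_inverse mult_ac)
  have down: "(if n = 0 then 0 else (1 - A * B * q ^ (n - 1)) * (inverse A ^ (n - 1) * (g (n - 1))\<^sup>2)) =
      inverse A ^ n * (g n)\<^sup>2 * (A * (1 - q ^ n))"
  proof (cases n)
    case (Suc m)
    then show ?thesis
      using g1[of m] A_pos by (simp add: mult_ac)
  qed simp
  let ?c = complex_of_real
  have "?c (1 - q ^ Suc n) * (?c (inverse A ^ Suc n * (g (Suc n))\<^sup>2) * laguerre_sum z (Suc n))
      + (if n = 0 then 0 else ?c (1 - A * B * q ^ (n - 1)) * (?c (inverse A ^ (n - 1) * (g (n - 1))\<^sup>2) * laguerre_sum z (n - 1)))
      = ?c ((1 - q ^ Suc n) * (inverse A ^ Suc n * (g (Suc n))\<^sup>2)) * laguerre_sum z (Suc n)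
       + ?c (if n = 0 then 0 else (1 - A * B * q ^ (n - 1)) * (inverse A ^ (n - 1) * (g (n - 1))\<^sup>2)) * laguerre_sum z (n - 1)"
    by simp
  also have "\<dots> = ?c (inverse A ^ n * (g n)\<^sup>2) * (?c (1 - A * B * q ^ n) / A * laguerre_sum z (Suc n)
      + ?c (A * (1 - q ^ n)) * laguerre_sum z (n - 1))"
    unfolding up down by (simp add: algebra_simps)
  also have "\<dots> = (2 * z - ?c ((A + B) * q ^ n)) * (?c (inverse A ^ n * (g n)\<^sup>2) * laguerre_sum z n)"
    unfolding laguerre_sum_recurrence by (simp only: mult_ac)
  finally show "rec z (\<lambda>n. ?c (inverse A ^ n * (g n)\<^sup>2) * laguerre_sum z n) n"
    unfolding rec_def .
qed

text \<open>The two factors with e^(i theta) and e^(-i theta) combine to a function of cos theta,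
  which removes \<open>Arccos\<close>; the prefactor of the polynomial is g_n^2.\<close>

lemma cq_laguerre_eq:
  "cq_laguerre q (2 * l - 1) n z = complex_of_real ((g n)\<^sup>2) * laguerre_sum z n"
proof -
  have A': "q powr ((2 * l - 1) / 2 + 1 / 4) = A"
    by (simp add: A_def diff_divide_distrib)
  have AB': "q powr (2 * l - 1 + 1) = A * B"
    by (simp add: AB_eq)
  have qn: "q powr (- real n) = inverse q ^ n"
    using q_pos by (simp add: powr_minus powr_realpow power_inverse)
  have g2: "(g n)\<^sup>2 = qpoch (A * B) q n / qpoch q q n"
    using qpoch_ab_pos[of n] qpoch_qq_pos[of n] by (simp add: g_def)
  show ?thesis
    unfolding cq_laguerre_def cq_laguerre_trig_def A' AB' qn g2[symmetric] laguerre_sum_def aw_sum_def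
      aw_weight_def aw_factor_def
    unfolding mult.assoc[of _ "qpoch _ _ _" "qpoch _ _ _"] qpoch_exp_mult
    by (rule arg_cong[where f = "times _"], rule sum.cong)
       (simp_all add: qpoch_of_real[symmetric] divide_inverse mult_ac)
qed

text \<open>The normalization in \<open>p_coeff\<close> is A^(-n) / g_n; together with g_n^2 from
  the Laguerre polynomial it leaves Q_n / g_n.\<close>

lemma p_coeff_eq:
  "p_coeff q l n \<mu> = p (complex_of_real (1 - (q powr (-1/2) - q powr (1/2)) * \<mu>)) n"
proof -
  define z where "z = complex_of_real (1 - (q powr (-1/2) - q powr (1/2)) * \<mu>)"
  have An: "q powr ((1/4 - l) * real n) = inverse A ^ n"
  proof -
    have "q powr ((1/4 - l) * real n) = (q powr (1/4 - l)) powr real n"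
      by (simp add: powr_powr)
    also have "q powr (1/4 - l) = inverse A"
      by (simp add: A_def powr_minus[symmetric])
    finally show ?thesis
      using A_pos by (simp add: powr_realpow)
  qed
  have gi: "sqrt (qpoch q q n) / sqrt (qpoch (q powr (2 * l)) q n) = 1 / g n"
    by (simp add: g_def AB_eq real_sqrt_divide)
  have "p_coeff q l n \<mu> = complex_of_real (inverse A ^ n / g n) * (complex_of_real ((g n)\<^sup>2) * laguerre_sum z n)"
    using gi unfolding p_coeff_def z_def[symmetric] cq_laguerre_eq An
    by (metis times_divide_eq_right mult_1_right)
  also have "\<dots> = complex_of_real (inverse A ^ n * (g n)\<^sup>2) * laguerre_sum z n / g n"
    by simp
  also have "\<dots> = p z n"
    using g_pos[of n] unfolding Q_eq_laguerre_sum[symmetric] Q_def by simp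
  finally show ?thesis
    by (simp add: z_def)
qed

end


subsection \<open>The generating function\<close>

lemma fps_nth_mult_linear:
  fixes G :: "complex fps"
  shows "fps_nth (G * (1 - fps_const c * fps_X)) n = fps_nth G n - (if n = 0 then 0 else c * fps_nth G (n - 1))"
proof -
  have "G * (1 - fps_const c * fps_X) = G - fps_const c * (G * fps_X)"
    by (simp add: algebra_simps)
  then show ?thesis
    by simp
qed

lemma fps_conv_radius_linear [simp]: "fps_conv_radius (1 - fps_const c * fps_X :: complex fps) = \<infinity>"
proof (cases "c = 0")
  case False
  then show ?thesis
    using fps_conv_radius_diff[of 1 "fps_const c * fps_X :: complex fps"]
    by (simp add: fps_conv_radius_cmult_left)
qed simp

lemma eval_fps_linear: "eval_fps (1 - fps_const c * fps_X :: complex fps) t = 1 - c * t"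
proof (cases "c = 0")
  case False
  then show ?thesis
    by (simp add: eval_fps_diff eval_fps_mult fps_conv_radius_cmult_left)
qed simp

lemma fps_conv_radius_bounded:
  assumes "\<And>n. cmod (fps_nth F n) \<le> C"
  shows "1 \<le> fps_conv_radius F"
  unfolding fps_conv_radius_def
proof (rule conv_radius_geI_ex')
  fix r :: real assume r: "0 < r" "ereal r < 1"
  show "summable (\<lambda>n. fps_nth F n * of_real r ^ n)"
  proof (rule summable_comparison_test')
    show "summable (\<lambda>n. C * r ^ n)"
      using r by (intro summable_mult summable_geometric) simp
    show "norm (fps_nth F n * of_real r ^ n) \<le> C * r ^ n" for n
      using r assms[of n] by (simp add: norm_mult norm_power mult_right_mono)
  qed
qed

context q_laguerre
begin

definition genfun :: "complex \<Rightarrow> complex fps" where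
  "genfun z = Abs_fps (Q z)"

text \<open>The coefficient of the n-th power, for n >= 1, is \<open>rec\<close> at n - 1: on the
  left it collects the terms free of q, on the right those with powers of q.\<close>

lemma genfun_equation:
  assumes "u * v = 1" "u + v = 2 * z"
  shows "genfun z * (1 - fps_const u * fps_X) * (1 - fps_const v * fps_X) =
    Abs_fps (\<lambda>n. of_real q ^ n * Q z n) * (1 - fps_const (of_real A) * fps_X) * (1 - fps_const (of_real B) * fps_X)"
    (is "?l = ?r")
proof (rule fps_ext)
  fix n
  have uv: "u * (v * x) = x" for x
    using assms(1) by (simp add: mult.assoc[symmetric])
  show "fps_nth ?l n = fps_nth ?r n"
  proof (cases n)
    case 0
    show ?thesis
      by (simp add: 0 genfun_def)
  next
    case (Suc m)
    show ?thesis
    proof (cases m)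
      case 0
      have "Q z 1 * (1 - of_real q) = (u + v - (of_real A + of_real B)) * Q z 0"
        using rec_Q[of z 0] assms(2) by (simp add: rec_def mult.commute)
      then show ?thesis
        by (simp add: fps_nth_mult_linear genfun_def Suc 0 algebra_simps)
    next
      case (Suc k)
      have "(1 - of_real q ^ Suc (Suc k)) * Q z (Suc (Suc k)) + (1 - of_real A * of_real B * of_real q ^ k) * Q z k
          = (u + v - (of_real A + of_real B) * of_real q ^ Suc k) * Q z (Suc k)"
        using rec_Q[of z "Suc k"] assms(2) by (simp add: rec_def)
      then show ?thesis
        by (simp add: fps_nth_mult_linear genfun_def \<open>n = Suc m\<close> Suc algebra_simps uv)
    qed
  qed
qed

lemma fps_conv_radius_dilate:
  "fps_conv_radius (Abs_fps (\<lambda>n. of_real q ^ n * Q z n)) = fps_conv_radius (genfun z) / ereal q"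
  using conv_radius_mult_power[of "complex_of_real q" "Q z"] q_pos
  by (simp add: fps_conv_radius_def genfun_def)

lemma fps_conv_radius_dilate_ge:
  "fps_conv_radius (genfun z) \<le> fps_conv_radius (Abs_fps (\<lambda>n. of_real q ^ n * Q z n))"
proof (cases "fps_conv_radius (genfun z)")
  case (real r)
  have "0 \<le> r"
    using conv_radius_nonneg[of "fps_nth (genfun z)"] real by (simp add: fps_conv_radius_def)
  then show ?thesis
    using q_pos q_less mult_left_mono[of q 1 r] unfolding fps_conv_radius_dilate real by (simp add: field_simps)
qed (use q_pos in \<open>auto simp: fps_conv_radius_dilate\<close>)

lemma eval_dilate: "eval_fps (Abs_fps (\<lambda>n. of_real q ^ n * Q z n)) t = eval_fps (genfun z) (of_real q * t)"
  by (simp add: eval_fps_def genfun_def power_mult_distrib mult_ac)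

lemma eval_genfun_equation:
  fixes u v z t :: complex
  assumes "u * v = 1" "u + v = 2 * z" "cmod t < fps_conv_radius (genfun z)"
  shows "eval_fps (genfun z) t * (1 - u * t) * (1 - v * t) =
    eval_fps (genfun z) (of_real q * t) * (1 - of_real A * t) * (1 - of_real B * t)"
proof -
  have r: "cmod t < fps_conv_radius (Abs_fps (\<lambda>n. of_real q ^ n * Q z n))"
    using assms(3) fps_conv_radius_dilate_ge by (rule less_le_trans)
  have rm: "cmod t < fps_conv_radius (F * (1 - fps_const c * fps_X))" if "cmod t < fps_conv_radius F" for F :: "complex fps" and c
  proof (rule less_le_trans[OF that])
    show "fps_conv_radius F \<le> fps_conv_radius (F * (1 - fps_const c * fps_X))"
      using fps_conv_radius_mult[of F "1 - fps_const c * fps_X"] by simp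
  qed
  have "eval_fps (genfun z * (1 - fps_const u * fps_X) * (1 - fps_const v * fps_X)) t =
      eval_fps (genfun z) t * (1 - u * t) * (1 - v * t)"
    using assms(3) by (simp add: eval_fps_mult rm eval_fps_linear)
  moreover have "eval_fps (Abs_fps (\<lambda>n. of_real q ^ n * Q z n) * (1 - fps_const (of_real A) * fps_X)
        * (1 - fps_const (of_real B) * fps_X)) t =
      eval_fps (Abs_fps (\<lambda>n. of_real q ^ n * Q z n)) t * (1 - of_real A * t) * (1 - of_real B * t)"
    using r by (simp add: eval_fps_mult rm eval_fps_linear)
  ultimately show ?thesis
    using genfun_equation[OF assms(1,2)] by (simp add: eval_dilate)
qed

text \<open>A crude geometric bound from the recurrence. Enlarging the radius by the functional
  equation needs some positive radius to start from.\<close>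

lemma fps_conv_radius_genfun_pos: "0 < fps_conv_radius (genfun z)"
proof -
  define D where "D = 2 * cmod z + (A + B)"
  \<comment> \<open>One step of the recurrence gives at most (D |Q_n| + |Q_(n-1)|) / (1 - q); this K
    makes K^n stable under it.\<close>
  define K where "K = (D + 1) / (1 - q)"
  have D: "0 \<le> D"
    using A_pos B_pos by (simp add: D_def)
  have K: "1 \<le> K" "D + 1 = K * (1 - q)"
    using D q_pos q_less by (simp_all add: K_def field_simps)
  have D_le: "cmod (2 * z - of_real ((A + B) * q ^ n)) \<le> D" for n
  proof -
    have "cmod (2 * z - of_real ((A + B) * q ^ n)) \<le> cmod (2 * z) + cmod (complex_of_real ((A + B) * q ^ n))"
      by (rule norm_triangle_ineq4)
    also have "cmod (complex_of_real ((A + B) * q ^ n)) = (A + B) * q ^ n"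
      unfolding norm_of_real using A_pos B_pos q_pos by (intro abs_of_nonneg) simp
    also have "\<dots> \<le> (A + B) * 1"
      using A_pos B_pos q_power_le by (intro mult_left_mono) auto
    finally show ?thesis
      by (simp add: D_def norm_mult)
  qed
  have step: "cmod (Q z (Suc n)) \<le> (D * cmod (Q z n) + (if n = 0 then 0 else cmod (Q z (n - 1)))) / (1 - q)" for n
  proof -
    let ?X = "(2 * z - of_real ((A + B) * q ^ n)) * Q z n"
    let ?Y = "if n = 0 then 0 else complex_of_real (1 - A * B * q ^ (n - 1)) * Q z (n - 1)"
    have "complex_of_real (1 - q ^ Suc n) * Q z (Suc n) = ?X - ?Y"
      using rec_Q[of z n] unfolding rec_def by (simp add: algebra_simps split: if_splits)
    then have "cmod (complex_of_real (1 - q ^ Suc n) * Q z (Suc n)) \<le> cmod ?X + cmod ?Y"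
      by (simp only: norm_triangle_ineq4)
    also have "cmod (complex_of_real (1 - q ^ Suc n) * Q z (Suc n)) = (1 - q ^ Suc n) * cmod (Q z (Suc n))"
      using q_factor(2)[of n] by (simp only: norm_mult norm_of_real abs_of_pos)
    finally have 1: "(1 - q ^ Suc n) * cmod (Q z (Suc n)) \<le> cmod ?X + cmod ?Y" .
    have 2: "(1 - q) * cmod (Q z (Suc n)) \<le> (1 - q ^ Suc n) * cmod (Q z (Suc n))"
      by (intro mult_right_mono q_factor) auto
    have 3: "cmod ?X \<le> D * cmod (Q z n)"
      unfolding norm_mult by (intro mult_right_mono D_le) auto
    have 4: "cmod ?Y \<le> (if n = 0 then 0 else cmod (Q z (n - 1)))"
    proof -
      have "cmod (complex_of_real (1 - A * B * q ^ m)) \<le> 1" for m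
        unfolding norm_of_real using AB_factor[of m] by simp
      then show ?thesis
        using mult_right_mono[of _ 1 "cmod (Q z (n - 1))"] by (simp add: norm_mult)
    qed
    have "(1 - q) * cmod (Q z (Suc n)) \<le> D * cmod (Q z n) + (if n = 0 then 0 else cmod (Q z (n - 1)))"
      using 1 2 3 4 by linarith
    then show ?thesis
      using q_less by (simp only: pos_le_divide_eq diff_gt_0_iff_gt mult.commute)
  qed
  have bound: "cmod (Q z n) \<le> K ^ n" for n
  proof (induction n rule: less_induct)
    case (less n)
    show ?case
    proof (cases n)
      case 0
      then show ?thesis
        by (simp add: Q_0)
    next
      case (Suc m)
      have "cmod (Q z (m - 1)) \<le> K ^ m" if "m \<noteq> 0"
        using less[of "m - 1"] power_increasing[of "m - 1" m K] K(1) Suc that by force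
      then have "(if m = 0 then 0 else cmod (Q z (m - 1))) \<le> K ^ m"
        using K(1) by simp
      moreover have "D * cmod (Q z m) \<le> D * K ^ m"
        using less[of m] Suc D by (intro mult_left_mono) auto
      ultimately have "cmod (Q z (Suc m)) \<le> (D * K ^ m + K ^ m) / (1 - q)"
        using q_less by (intro order.trans[OF step] divide_right_mono add_mono) auto
      also have "D * K ^ m + K ^ m = K * (1 - q) * K ^ m"
        unfolding K(2)[symmetric] by (simp add: algebra_simps)
      finally show ?thesis
        using q_less Suc by simp
    qed
  qed
  have "summable (\<lambda>n. Q z n * of_real (1 / (2 * K)) ^ n)"
  proof (rule summable_comparison_test')
    show "summable (\<lambda>n. (1 / 2 :: real) ^ n)"
      by (simp add: summable_geometric)
    show "norm (Q z n * of_real (1 / (2 * K)) ^ n) \<le> (1 / 2) ^ n" for n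
    proof -
      have "norm (Q z n * of_real (1 / (2 * K)) ^ n) = cmod (Q z n) * (1 / (2 * K)) ^ n"
        using K(1) by (simp add: norm_mult norm_power norm_divide)
      also have "\<dots> \<le> K ^ n * (1 / (2 * K)) ^ n"
        using K(1) by (intro mult_right_mono bound) auto
      also have "\<dots> = (1 / 2) ^ n"
        using K(1) by (simp add: power_mult_distrib[symmetric])
      finally show ?thesis .
    qed
  qed
  then have "norm (complex_of_real (1 / (2 * K))) \<le> fps_conv_radius (genfun z)"
    unfolding fps_conv_radius_def genfun_def fps_nth_Abs_fps by (rule conv_radius_geI)
  moreover have "0 < norm (complex_of_real (1 / (2 * K)))"
    using K(1) by simp
  ultimately show ?thesis
    using less_le_trans ereal_less(2) by blast
qed

text \<open>The functional equation expresses the generating function through its dilate, so a radius of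
  convergence \<open>R < 1\<close> would be at least \<open>R / q\<close>.\<close>

lemma fps_conv_radius_genfun_ge_1:
  fixes u v z :: complex
  assumes "cmod u = 1" "u * v = 1" "u + v = 2 * z"
  shows "1 \<le> fps_conv_radius (genfun z)"
proof (rule ccontr)
  assume "\<not> ?thesis"
  then obtain R where R: "fps_conv_radius (genfun z) = ereal R" "0 < R" "R < 1"
    using fps_conv_radius_genfun_pos[of z] by (cases "fps_conv_radius (genfun z)") auto
  have v: "cmod v = 1"
    using assms(1,2) by (metis mult_1 norm_mult norm_one)
  let ?D = "Abs_fps (\<lambda>n. of_real q ^ n * Q z n) :: complex fps"
  let ?P = "\<lambda>c. 1 - fps_const c * fps_X :: complex fps"
  have geo: "?P c * Abs_fps (\<lambda>n. c ^ n) = 1" for c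
    by (rule fps_ext) (simp add: mult.commute[of "?P c"] fps_nth_mult_linear power_eq_if)
  have geo_radius: "1 \<le> fps_conv_radius (Abs_fps (\<lambda>n. c ^ n))" if "cmod c = 1" for c
    by (rule fps_conv_radius_bounded[of _ 1]) (simp add: norm_power that)
  have "genfun z = genfun z * (?P u * Abs_fps (\<lambda>n. u ^ n)) * (?P v * Abs_fps (\<lambda>n. v ^ n))"
    by (simp add: geo)
  also have "\<dots> = (genfun z * ?P u * ?P v) * Abs_fps (\<lambda>n. u ^ n) * Abs_fps (\<lambda>n. v ^ n)"
    by (simp only: mult_ac)
  also have "\<dots> = ?D * ?P (of_real A) * ?P (of_real B) * Abs_fps (\<lambda>n. u ^ n) * Abs_fps (\<lambda>n. v ^ n)"
    unfolding genfun_equation[OF assms(2,3)] ..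
  finally have F: "genfun z = \<dots>" .
  have mult: "r \<le> fps_conv_radius (F * G)" if "r \<le> fps_conv_radius F" "r \<le> fps_conv_radius G" for F G :: "complex fps" and r
    using fps_conv_radius_mult[of F G] that by (meson min.boundedI order_trans)
  \<comment> \<open>The dilate has radius R / q, the geometric series that invert 1 - u t and 1 - v
    t have radius at least 1, and the minimum still exceeds R.\<close>
  define r where "r = min 1 (ereal (R / q))"
  have "r \<le> fps_conv_radius ?D"
    using fps_conv_radius_dilate[of z] q_pos by (simp add: r_def R)
  moreover have "r \<le> 1"
    by (simp add: r_def)
  ultimately have "r \<le> fps_conv_radius (genfun z)"
    unfolding F using geo_radius[OF assms(1)] geo_radius[OF v] by (intro mult) auto
  moreover have "ereal R < r"
    using R q_pos q_less by (simp add: r_def field_simps)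
  ultimately show False
    using R(1) by simp
qed

lemma isCont_eval_genfun: "isCont (eval_fps (genfun z)) 0"
  using continuous_eval_fps[of 0 "genfun z" UNIV] fps_conv_radius_genfun_pos[of z] by (simp add: zero_ereal_def)

lemma eval_genfun_LIMSEQ: "(\<lambda>m. eval_fps (genfun z) (of_real q ^ m * t)) \<longlonglongrightarrow> 1"
proof -
  have "(\<lambda>m. complex_of_real q ^ m * t) \<longlonglongrightarrow> 0 * t"
    using q_pos q_less by (intro tendsto_intros LIMSEQ_power_zero) simp
  from isCont_tendsto_compose[OF isCont_eval_genfun, of "\<lambda>m. complex_of_real q ^ m * t"] this show ?thesis
    by (simp add: eval_fps_at_0 genfun_def Q_0)
qed

lemma norm_q_power_mult_le: "cmod (of_real q ^ m * t) \<le> cmod t"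
  using q_pos q_power_le[of m] by (simp add: norm_mult norm_power mult_left_le_one_le)

text \<open>Multiplied out, so that neither the iteration nor the limit involves a division.\<close>

lemma genfun_product:
  fixes u v z t :: complex
  assumes u: "cmod u = 1" "u * v = 1" "u + v = 2 * z" and t: "cmod t < 1"
  shows "eval_fps (genfun z) t * (qpoch_inf (u * t) q * qpoch_inf (v * t) q) =
    qpoch_inf (A * t) q * qpoch_inf (B * t) q"
proof -
  let ?q = "complex_of_real q" and ?A = "complex_of_real A" and ?B = "complex_of_real B"
  have iter: "eval_fps (genfun z) t * (qpoch (u * t) ?q m * qpoch (v * t) ?q m) =
      eval_fps (genfun z) (?q ^ m * t) * (qpoch (?A * t) ?q m * qpoch (?B * t) ?q m)" for m
  proof (induction m)
    case (Suc m)
    have "ereal (cmod (?q ^ m * t)) < fps_conv_radius (genfun z)"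
      using norm_q_power_mult_le[of m t] t fps_conv_radius_genfun_ge_1[OF u]
      by (metis ereal_less(3) le_less_trans less_le_trans)
    from eval_genfun_equation[OF u(2,3) this]
    have eq: "eval_fps (genfun z) (?q ^ m * t) * (1 - u * (?q ^ m * t)) * (1 - v * (?q ^ m * t)) =
        eval_fps (genfun z) (?q ^ Suc m * t) * (1 - ?A * (?q ^ m * t)) * (1 - ?B * (?q ^ m * t))"
      by (simp add: mult.assoc)
    have "eval_fps (genfun z) t * (qpoch (u * t) ?q (Suc m) * qpoch (v * t) ?q (Suc m)) =
        (eval_fps (genfun z) t * (qpoch (u * t) ?q m * qpoch (v * t) ?q m))
          * ((1 - u * (?q ^ m * t)) * (1 - v * (?q ^ m * t)))"
      by (simp add: qpoch_Suc mult_ac)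
    also have "\<dots> = (qpoch (?A * t) ?q m * qpoch (?B * t) ?q m) *
        (eval_fps (genfun z) (?q ^ m * t) * (1 - u * (?q ^ m * t)) * (1 - v * (?q ^ m * t)))"
      unfolding Suc.IH by (simp only: mult_ac)
    also have "\<dots> = eval_fps (genfun z) (?q ^ Suc m * t) * (qpoch (?A * t) ?q (Suc m) * qpoch (?B * t) ?q (Suc m))"
      unfolding eq by (simp add: qpoch_Suc mult_ac)
    finally show ?case .
  qed simp
  have q1: "cmod ?q < 1"
    using q_pos q_less by simp
  have "(\<lambda>m. eval_fps (genfun z) t * (qpoch (u * t) ?q m * qpoch (v * t) ?q m)) \<longlonglongrightarrow>
      eval_fps (genfun z) t * (qpoch_inf (u * t) ?q * qpoch_inf (v * t) ?q)"
    by (intro tendsto_intros qpoch_LIMSEQ q1)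
  moreover have "(\<lambda>m. eval_fps (genfun z) t * (qpoch (u * t) ?q m * qpoch (v * t) ?q m)) \<longlonglongrightarrow>
      1 * (qpoch_inf (?A * t) ?q * qpoch_inf (?B * t) ?q)"
    unfolding iter by (intro tendsto_intros qpoch_LIMSEQ q1 eval_genfun_LIMSEQ)
  ultimately show ?thesis
    using LIMSEQ_unique by fastforce
qed

text \<open>At \<open>t = w\<close> the left-hand side of the functional equation vanishes, hence the generating
  function vanishes at all \<open>q\<^sup>m w\<close>, although its value at \<open>0\<close> is \<open>1\<close>.\<close>

lemma p_not_l2:
  fixes w z :: complex
  assumes "1/4 \<le> l" "w \<noteq> 0" "cmod w < 1" "2 * z = w + 1 / w"
  shows "p z \<notin> l2"
proof
  assume p: "p z \<in> l2"
  let ?q = "complex_of_real q"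
  have A1: "A \<le> 1"
    using assms(1) q_pos q_less powr_le1[of "l - 1/4" q] by (simp add: A_def)
  have uv: "w * (1 / w) = 1" "w + 1 / w = 2 * z"
    using assms by auto
  obtain G where "g \<longlonglongrightarrow> G"
    by (rule g_LIMSEQ)
  then have "Bseq g"
    using convergentI convergent_imp_Bseq by blast
  then obtain C where C: "C > 0" "\<And>n. \<bar>g n\<bar> \<le> C"
    by (auto simp: Bseq_def)
  \<comment> \<open>A square-summable p is bounded, hence so is Q, and the generating function
    converges on the open unit disc, which contains all q^m w.\<close>
  have "1 \<le> fps_conv_radius (genfun z)"
  proof (rule fps_conv_radius_bounded)
    show "cmod (fps_nth (genfun z) n) \<le> C * l2norm (p z)" for n
      using C cmod_le_l2norm[OF p, of n] by (auto simp: genfun_def Q_def norm_mult intro!: mult_mono)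
  qed
  then have r: "ereal (cmod (?q ^ m * w)) < fps_conv_radius (genfun z)" for m
    using norm_q_power_mult_le[of m w] assms(3) by (metis ereal_less(3) le_less_trans less_le_trans)
  \<comment> \<open>Here l >= 1/4 enters, through A <= 1: for A > 1 the factor 1 - A t has the zero
    t = 1/A in the disc.\<close>
  have ne: "1 - of_real c * (?q ^ m * w) \<noteq> 0" if "0 < c" "c \<le> 1" for c m
  proof -
    have "cmod (of_real c * w) < 1"
      using that assms(3) mult_right_mono[of c 1 "cmod w"] by (simp add: norm_mult)
    then show ?thesis
      using qpoch_factor_ne_0[of ?q "of_real c * w" m] q_pos q_less by (simp add: mult_ac)
  qed
  \<comment> \<open>Starts at q w: at t = w the factor 1 - t/w vanishes, so the equation does not
    constrain the value at w itself.\<close>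
  have zero: "eval_fps (genfun z) (?q ^ Suc m * w) = 0" for m
  proof (induction m)
    case 0
    have "eval_fps (genfun z) (?q * w) * (1 - of_real A * w) * (1 - of_real B * w) = 0"
      using eval_genfun_equation[OF uv, of w] r[of 0] assms(2) by simp
    then show ?case
      using ne[of A 0] ne[of B 0] A_pos A1 B_pos B_less by simp
  next
    case (Suc m)
    have "eval_fps (genfun z) (?q * (?q ^ Suc m * w)) * (1 - of_real A * (?q ^ Suc m * w)) * (1 - of_real B * (?q ^ Suc m * w)) = 0"
      using eval_genfun_equation[OF uv r[of "Suc m"]] unfolding Suc.IH by simp
    then show ?case
      using ne[of A "Suc m"] ne[of B "Suc m"] A_pos A1 B_pos B_less by (simp add: mult.assoc)
  qed
  have "(\<lambda>m. eval_fps (genfun z) (?q ^ Suc m * w)) \<longlonglongrightarrow> 1"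
    using eval_genfun_LIMSEQ by (rule LIMSEQ_Suc)
  then show False
    unfolding zero by (simp add: LIMSEQ_const_iff)
qed

end


section \<open>The operator \<open>I1\<close>\<close>

text \<open>The two solutions of r^2 - 2 z r + 1 = 0 have product 1, so one of them lies in the
  closed unit disc.\<close>

lemma joukowski_root:
  fixes z :: complex
  obtains w where "w \<noteq> 0" "cmod w \<le> 1" "2 * z = w + 1 / w"
proof -
  define r where "r = z + csqrt (z\<^sup>2 - 1)"
  have prod: "r * (2 * z - r) = 1"
    using power2_csqrt[of "z\<^sup>2 - 1"] by (simp add: r_def algebra_simps power2_eq_square)
  then have r0: "r \<noteq> 0"
    by auto
  have inv: "1 / r = 2 * z - r"
    using prod r0 by (simp add: field_simps)
  show thesis
  proof (cases "cmod r \<le> 1")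
    case True
    show ?thesis
      by (rule that[OF r0 True]) (simp add: inv)
  next
    case False
    have le: "cmod (1 / r) \<le> 1"
      using False by (simp add: norm_divide divide_simps)
    have "2 * z = 1 / r + r"
      by (simp add: inv)
    with r0 show ?thesis
      by (intro that[OF _ le]) simp_all
  qed
qed

lemma coords_add: "coords q l (F + G) n = coords q l F n + coords q l G n"
  and coords_diff: "coords q l (F - G) n = coords q l F n - coords q l G n"
  and coords_const_mult: "coords q l (fps_const k * F) n = k * coords q l F n"
  by (simp_all add: coords_def add_divide_distrib diff_divide_distrib)

lemma coords_sum: "coords q l (\<Sum>i<(N::nat). f i) n = (\<Sum>i<N. coords q l (f i) n)"
  by (simp add: coords_def fps_sum_nth sum_divide_distrib)

lemma Hl_iff: "F \<in> Hl q l \<longleftrightarrow> coords q l F \<in> l2"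
  by (simp add: Hl_def l2_def)

lemma Hl_norm_eq:
  assumes "F \<in> Hl q l"
  shows "Hl_norm q l F = l2norm (coords q l F)"
proof -
  have "Hl_inner q l F F = (\<Sum>n. complex_of_real ((cmod (coords q l F n))\<^sup>2))"
    unfolding Hl_inner_def by (intro suminf_cong) (simp add: complex_norm_square[symmetric] del: of_real_power)
  also have "\<dots> = complex_of_real (\<Sum>n. (cmod (coords q l F n))\<^sup>2)"
    using assms by (intro suminf_of_real[symmetric]) (simp add: Hl_def)
  finally show ?thesis
    by (simp add: Hl_norm_def l2norm_def)
qed

context q_laguerre
begin

definition kap :: real where
  "kap = q powr (-1/2) - q powr (1/2)"

lemma kap_pos: "0 < kap"
  using powr_less_mono'[of q "-1/2" "1/2"] q_pos q_less by (simp add: kap_def)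

lemmas coords_series' = coords_series[OF q_pos q_less l_pos]
lemmas series_coords' = series_coords[OF q_pos q_less l_pos]

lemma fps_eq_iff_coords: "F = G \<longleftrightarrow> (\<forall>n. coords q l F n = coords q l G n)"
  by (metis series_coords' ext)

lemma series_in_Hl: "series q l a \<in> Hl q l \<longleftrightarrow> a \<in> l2"
  by (simp add: Hl_iff coords_series'[abs_def])

lemma qnum_eq: "qnum q x = q powr (- x / 2) * (1 - q powr x) / kap"
proof -
  have "q powr (- x / 2) * (1 - q powr x) = q powr (- x / 2) - q powr (x / 2)"
    by (simp add: right_diff_distrib powr_add[symmetric])
  then show ?thesis
    unfolding qnum_def kap_def using kap_pos by (simp add: kap_def field_simps)
qed

text \<open>The two factors q^(J_0/4) contribute q^((2l+2n+1)/4), which exactly cancels the growth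
  of the matrix entry of J_+ or J_- and leaves a bounded weight.\<close>

lemma off_diagonal:
  "q powr (1/4 * (l + real n)) * sqrt (qnum q (2*l + real n) * qnum q (real (n + 1)))
     * q powr (1/4 * (l + real (n + 1))) = sq (Suc n) / kap"
proof -
  let ?e = "(2 * l + 2 * real n + 1) / 2"
  have ab: "1 - q powr (2 * l + real n) = 1 - A * B * q ^ n"
    using q_pos by (simp add: AB_eq powr_add powr_realpow)
  have qq: "1 - q powr (real (n + 1)) = 1 - q ^ Suc n"
    using q_pos powr_realpow[of q "Suc n"] by simp
  have "qnum q (2*l + real n) * qnum q (real (n + 1)) =
      (q powr (- (2*l + real n) / 2) * q powr (- real (n + 1) / 2)) * ((1 - A * B * q ^ n) * (1 - q ^ Suc n)) / kap\<^sup>2"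
    unfolding qnum_eq ab qq by (simp add: power2_eq_square)
  also have "q powr (- (2*l + real n) / 2) * q powr (- real (n + 1) / 2) = q powr (- ?e)"
    unfolding powr_add[symmetric] by (rule arg_cong[where f = "\<lambda>y. q powr y"]) (simp add: field_simps)
  finally have "sqrt (qnum q (2*l + real n) * qnum q (real (n + 1))) = sqrt (q powr (- ?e)) * sq (Suc n) / kap"
    using kap_pos by (simp add: sq_def real_sqrt_mult real_sqrt_divide)
  also have "sqrt (q powr (- ?e)) = q powr (- ?e / 2)"
    by (simp add: powr_half_sqrt[symmetric] powr_powr)
  finally have "q powr (1/4 * (l + real n)) * sqrt (qnum q (2*l + real n) * qnum q (real (n + 1)))
     * q powr (1/4 * (l + real (n + 1))) =
      (q powr (1/4 * (l + real n)) * q powr (- ?e / 2) * q powr (1/4 * (l + real (n + 1)))) * (sq (Suc n) / kap)"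
    by simp
  also have "q powr (1/4 * (l + real n)) * q powr (- ?e / 2) * q powr (1/4 * (l + real (n + 1))) = q powr 0"
    unfolding powr_add[symmetric] by (rule arg_cong[where f = "\<lambda>y. q powr y"]) (simp add: field_simps)
  finally show ?thesis
    using q_pos by simp
qed

text \<open>The constant a is - (q^(1/4) + q^(-1/4)) / kap, and q^l times this bracket is A +
  B.\<close>

lemma diagonal: "a_const q / 2 * q powr (1 * (l + real n)) = - bq n / kap"
proof -
  have AB: "A + B = q powr l * (q powr (1/4) + q powr (-1/4))"
    by (simp add: A_def B_def distrib_left powr_add[symmetric])
  have b: "b_const q = - 1 / kap"
    using kap_pos unfolding b_const_def kap_def by (simp add: field_simps)
  show ?thesis
    unfolding a_const_def b bq_def AB using q_pos kap_pos
    by (simp add: powr_add powr_realpow field_simps)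
qed

lemma coords_I1: "coords q l (I1 q l F) n = (coords q l F n - J (coords q l F) n) / kap"
proof -
  let ?u = "coords q l F" and ?c = complex_of_real
  have b: "b_const q = - 1 / kap"
    using kap_pos unfolding b_const_def kap_def by (simp add: field_simps)
  have "coords q l (qJ0 q l (1/4) (Jminus q l (qJ0 q l (1/4) F))) n =
      ?c (q powr (1/4 * (l + real n)) * sqrt (qnum q (2*l + real n) * qnum q (real (n + 1)))
        * q powr (1/4 * (l + real (n + 1)))) * ?u (Suc n)"
    unfolding qJ0_def Jminus_def coords_series' by simp
  then have minus: "coords q l (qJ0 q l (1/4) (Jminus q l (qJ0 q l (1/4) F))) n = ?c (sq (Suc n) / kap) * ?u (Suc n)"
    unfolding off_diagonal .
  have plus: "coords q l (qJ0 q l (1/4) (Jplus q l (qJ0 q l (1/4) F))) n = ?c (sq n / kap) * ?u (n - 1)"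
  proof (cases n)
    case (Suc m)
    have "coords q l (qJ0 q l (1/4) (Jplus q l (qJ0 q l (1/4) F))) n =
      ?c (q powr (1/4 * (l + real m)) * sqrt (qnum q (2*l + real m) * qnum q (real (m + 1)))
        * q powr (1/4 * (l + real (m + 1)))) * ?u m"
      unfolding qJ0_def Jplus_def coords_series' by (simp add: Suc)
    then show ?thesis
      unfolding off_diagonal by (simp add: Suc)
  qed (simp add: qJ0_def Jplus_def coords_series')
  have add: "coords q l (qJ0 q l (1/4) (G + H)) n = coords q l (qJ0 q l (1/4) G) n + coords q l (qJ0 q l (1/4) H) n" for G H
    by (simp add: qJ0_def coords_series' coords_add distrib_left)
  have "coords q l (qJ0 q l 1 F) n = ?c (q powr (1 * (l + real n))) * ?u n"
    by (simp add: qJ0_def coords_series')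
  then have "coords q l (fps_const (?c (a_const q / 2)) * qJ0 q l 1 F) n = ?c (a_const q / 2 * q powr (1 * (l + real n))) * ?u n"
    by (simp add: coords_const_mult)
  then have diag: "coords q l (fps_const (?c (a_const q / 2)) * qJ0 q l 1 F) n = ?c (- bq n / kap) * ?u n"
    unfolding diagonal .
  show ?thesis
    unfolding I1_def coords_diff diag
    unfolding coords_const_mult add plus minus b
    using kap_pos by (simp add: J_def field_simps)
qed

lemma coords_I1_minus:
  fixes \<zeta> :: complex
  shows "coords q l (I1 q l F - fps_const \<zeta> * F) n = - (J (coords q l F) n - (1 - kap * \<zeta>) * coords q l F n) / kap"
  unfolding coords_diff coords_const_mult coords_I1 using kap_pos by (simp add: field_simps)

lemma I1_eigen_iff:
  fixes \<zeta> :: complex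
  shows "I1 q l F = fps_const \<zeta> * F \<longleftrightarrow> (\<forall>n. J (coords q l F) n = (1 - kap * \<zeta>) * coords q l F n)"
proof -
  have "I1 q l F = fps_const \<zeta> * F \<longleftrightarrow> (\<forall>n. coords q l (I1 q l F - fps_const \<zeta> * F) n = 0)"
    unfolding fps_eq_iff_coords by (simp add: coords_diff)
  moreover have "coords q l (I1 q l F - fps_const \<zeta> * F) n = 0 \<longleftrightarrow>
      J (coords q l F) n = (1 - kap * \<zeta>) * coords q l F n" for n
    unfolding coords_I1_minus using kap_pos by auto
  ultimately show ?thesis
    by simp
qed

text \<open>Transfers boundedness from an operator on coordinate sequences; used for
  \<open>I1\<close> and for the resolvent.\<close>

lemma bounded_operatorI:
  assumes "\<And>F n. F \<in> Hl q l \<Longrightarrow> coords q l (T F) n = S (coords q l F) n"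
    and "\<And>u v n. u \<in> l2 \<Longrightarrow> v \<in> l2 \<Longrightarrow> S (\<lambda>n. u n + v n) n = S u n + S v n"
    and "\<And>u k n. u \<in> l2 \<Longrightarrow> S (\<lambda>n. k * u n) n = k * S u n"
    and "\<And>u. u \<in> l2 \<Longrightarrow> S u \<in> l2 \<and> l2norm (S u) \<le> K * l2norm u"
  shows "bounded_operator q l T"
proof -
  have c: "coords q l (T F) = S (coords q l F)" if "F \<in> Hl q l" for F
    using assms(1)[OF that] by (rule ext)
  have T: "T F \<in> Hl q l" if "F \<in> Hl q l" for F
    using that assms(4) by (simp add: Hl_iff c[OF that])
  have add: "T (F + G) = T F + T G" if "F \<in> Hl q l" "G \<in> Hl q l" for F G
  proof -
    have cFG: "coords q l (F + G) = (\<lambda>n. coords q l F n + coords q l G n)"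
      by (simp add: coords_add fun_eq_iff)
    have "F + G \<in> Hl q l"
      using that by (simp add: Hl_iff cFG l2_add)
    then show ?thesis
      using that assms(2) unfolding fps_eq_iff_coords by (simp add: c cFG coords_add Hl_iff)
  qed
  have scale: "T (fps_const z * F) = fps_const z * T F" if "F \<in> Hl q l" for F z
  proof -
    have cF: "coords q l (fps_const z * F) = (\<lambda>n. z * coords q l F n)"
      by (simp add: coords_const_mult fun_eq_iff)
    have "fps_const z * F \<in> Hl q l"
      using that by (simp add: Hl_iff cF l2_scale)
    then show ?thesis
      using that assms(3) unfolding fps_eq_iff_coords by (simp add: c cF coords_const_mult Hl_iff)
  qed
  have "Hl_norm q l (T F) \<le> K * Hl_norm q l F" if "F \<in> Hl q l" for F
    using that assms(4) T[OF that] by (simp add: Hl_norm_eq c Hl_iff)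
  with T add scale show ?thesis
    unfolding bounded_operator_def by blast
qed

lemma bounded_operator_I1: "bounded_operator q l (I1 q l)"
proof (rule bounded_operatorI)
  show "coords q l (I1 q l F) n = affine_J (1 / kap) (- 1 / kap) (coords q l F) n" for F n
    by (simp add: coords_I1 affine_J_def diff_divide_distrib)
  show "affine_J (1 / kap) (- 1 / kap) (\<lambda>n. u n + v n) n =
      affine_J (1 / kap) (- 1 / kap) u n + affine_J (1 / kap) (- 1 / kap) v n" for u v n
    by (simp add: affine_J_def J_add algebra_simps add_divide_distrib)
  show "affine_J (1 / kap) (- 1 / kap) (\<lambda>n. k * u n) n = k * affine_J (1 / kap) (- 1 / kap) u n" for u k n
    by (simp add: affine_J_def J_scale algebra_simps)
  fix u assume u: "u \<in> l2"
  have "l2norm (affine_J (1 / kap) (- 1 / kap) u) \<le>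
      l2norm (\<lambda>n. complex_of_real (1 / kap) * u n) + l2norm (\<lambda>n. complex_of_real (- 1 / kap) * J u n)"
    unfolding affine_J_def[abs_def] by (intro l2norm_add l2_scale J_l2 u)
  also have "\<dots> \<le> cmod (complex_of_real (1 / kap)) * l2norm u + cmod (complex_of_real (- 1 / kap)) * l2norm (J u)"
    by (intro add_mono l2norm_scale_le u J_l2)
  also have "\<dots> = 1 / kap * (l2norm u + l2norm (J u))"
    using kap_pos by (simp add: norm_divide add_divide_distrib)
  also have "\<dots> \<le> 1 / kap * (l2norm u + (2 + (A + B) / 2) * l2norm u)"
    using kap_pos by (intro mult_left_mono add_left_mono l2norm_J u) auto
  finally show "affine_J (1 / kap) (- 1 / kap) u \<in> l2 \<and>
      l2norm (affine_J (1 / kap) (- 1 / kap) u) \<le> (1 / kap * (3 + (A + B) / 2)) * l2norm u"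
    using affine_J_l2[OF u] by (simp add: algebra_simps)
qed

lemma bounded_selfadjoint_I1: "bounded_selfadjoint q l (I1 q l)"
  unfolding bounded_selfadjoint_def
proof (intro conjI ballI bounded_operator_I1)
  fix F G assume FG: "F \<in> Hl q l" "G \<in> Hl q l"
  let ?u = "coords q l F" and ?v = "coords q l G"
  have l2: "?u \<in> l2" "?v \<in> l2"
    using FG by (auto simp: Hl_iff)
  have s: "summable (\<lambda>n. ?u n * cnj (?v n))" "summable (\<lambda>n. J ?u n * cnj (?v n))" "summable (\<lambda>n. ?u n * cnj (J ?v n))"
    using l2 by (auto intro!: l2_summable_mult J_l2)
  have "Hl_inner q l (I1 q l F) G = (\<Sum>n. (?u n * cnj (?v n) - J ?u n * cnj (?v n)) / kap)"
    unfolding Hl_inner_def coords_I1 by (intro suminf_cong) (simp add: algebra_simps diff_divide_distrib)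
  also have "\<dots> = ((\<Sum>n. ?u n * cnj (?v n)) - (\<Sum>n. J ?u n * cnj (?v n))) / kap"
    using s by (simp add: suminf_divide suminf_diff summable_diff)
  also have "\<dots> = ((\<Sum>n. ?u n * cnj (?v n)) - (\<Sum>n. ?u n * cnj (J ?v n))) / kap"
    using J_symmetric[OF l2] by simp
  also have "\<dots> = (\<Sum>n. (?u n * cnj (?v n) - ?u n * cnj (J ?v n)) / kap)"
    using s by (simp add: suminf_divide suminf_diff summable_diff)
  also have "\<dots> = Hl_inner q l F (I1 q l G)"
    unfolding Hl_inner_def coords_I1 by (intro suminf_cong) (simp add: algebra_simps diff_divide_distrib)
  finally show "Hl_inner q l (I1 q l F) G = Hl_inner q l F (I1 q l G)" .
qed

lemma Hl_norm_diff_series: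
  assumes "H \<in> Hl q l" "G \<in> Hl q l"
  shows "Hl_norm q l (H - G) = l2norm (\<lambda>n. coords q l H n - coords q l G n)"
proof -
  have c: "coords q l (H - G) = (\<lambda>n. coords q l H n - coords q l G n)"
    by (simp add: coords_diff fun_eq_iff)
  then have "H - G \<in> Hl q l"
    using assms by (simp add: Hl_iff l2_diff)
  then show ?thesis
    by (simp add: Hl_norm_eq c)
qed

lemma simple_spectrum_I1: "simple_spectrum q l (I1 q l)"
  unfolding simple_spectrum_def
proof (intro bexI ballI allI impI)
  let ?v = "series q l (unit_seq 0)" and ?T = "affine_J (1 / kap) (- 1 / kap)"
  have iter: "coords q l ((I1 q l ^^ i) ?v) = (?T ^^ i) (unit_seq 0)" for i
  proof (induction i)
    case 0
    show ?case
      by (simp add: coords_series' fun_eq_iff)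
  next
    case (Suc i)
    have "coords q l (I1 q l F) = ?T (coords q l F)" for F
      by (simp add: coords_I1 affine_J_def diff_divide_distrib fun_eq_iff)
    with Suc show ?case
      by simp
  qed
  show "?v \<in> Hl q l"
    by (simp add: series_in_Hl unit_seq_l2)
  fix G and e :: real assume G: "G \<in> Hl q l" and e: "e > 0"
  have "l2_adherent (krylov (1 / kap) (- 1 / kap)) (coords q l G)"
    using G kap_pos by (intro krylov_dense) (auto simp: Hl_iff)
  then obtain u where u: "u \<in> krylov (1 / kap) (- 1 / kap)" "l2norm (\<lambda>n. u n - coords q l G n) < e"
    using e unfolding l2_adherent_def by blast
  then obtain k N where kN: "u = (\<lambda>n. \<Sum>i<N. k i * (?T ^^ i) (unit_seq 0) n)"
    unfolding krylov_def by blast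
  let ?H = "\<Sum>i<N. fps_const (k i) * (I1 q l ^^ i) ?v"
  have H: "coords q l ?H = u"
    by (simp add: fun_eq_iff coords_sum coords_const_mult iter kN)
  have "u \<in> l2"
    using u(1) l2_subspace.sub_l2[OF krylov_subspace] by blast
  then have "?H \<in> Hl q l"
    by (simp add: Hl_iff H)
  then have "Hl_norm q l (?H - G) < e"
    using u(2) G by (simp add: Hl_norm_diff_series H)
  then show "\<exists>N c. Hl_norm q l ((\<Sum>i<N. fps_const (c i) * (I1 q l ^^ i) ?v) - G) < e"
    by blast
qed

text \<open>The spectral parameter \<open>\<zeta>\<close> of \<open>I1\<close> corresponds to \<open>1 - kap \<zeta> = (w + 1/w) / 2\<close> for \<open>J\<close>; the
  interval \<open>[0, 2/kap]\<close> to \<open>|w| = 1\<close>.\<close>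

lemma not_in_point_spectrum_unit_circle:
  fixes w \<zeta> :: complex
  assumes "cmod w = 1" "2 * (1 - kap * \<zeta>) = w + 1 / w"
  shows "\<zeta> \<notin> point_spectrum q l (I1 q l)"
proof
  assume "\<zeta> \<in> point_spectrum q l (I1 q l)"
  then obtain F where F: "F \<in> Hl q l" "F \<noteq> 0" "I1 q l F = fps_const \<zeta> * F"
    unfolding point_spectrum_def by blast
  obtain L where "jost sq bq (sqrt ((1 - A * B) * (1 - q))) ((A + B) / 2) (1 - kap * \<zeta>) w L (jost_sol w)"
    by (rule jost_jost_sol[OF _ _ assms(2)]) (use assms(1) in auto)
  then interpret jost sq bq "sqrt ((1 - A * B) * (1 - q))" "(A + B) / 2" "1 - kap * \<zeta>" w L "jost_sol w" .
  have "coords q l F n = 0" for n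
    using F by (intro no_decaying_solution assms(1) l2_tendsto_0) (auto simp: I1_eigen_iff Hl_iff)
  then have "F = 0"
    unfolding fps_eq_iff_coords by (simp add: coords_def)
  with F(2) show False ..
qed

lemma continuous_spectrum_unit_circle:
  fixes w \<zeta> :: complex
  assumes "cmod w = 1" "2 * (1 - kap * \<zeta>) = w + 1 / w"
  shows "\<zeta> \<in> continuous_spectrum q l (I1 q l)"
proof -
  let ?z = "1 - kap * \<zeta>"
  obtain L where "jost sq bq (sqrt ((1 - A * B) * (1 - q))) ((A + B) / 2) (1 - kap * \<zeta>) w L (jost_sol w)"
    by (rule jost_jost_sol[OF _ _ assms(2)]) (use assms(1) in auto)
  then interpret jost sq bq "sqrt ((1 - A * B) * (1 - q))" "(A + B) / 2" "1 - kap * \<zeta>" w L "jost_sol w" .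
  have "\<zeta> \<in> spectrum q l (I1 q l)"
    unfolding spectrum_def
  proof (intro CollectI notI, elim exE conjE)
    fix R assume R: "bounded_operator q l R"
      "\<forall>F\<in>Hl q l. R (I1 q l F - fps_const \<zeta> * F) = F \<and> I1 q l (R F) - fps_const \<zeta> * R F = F"
    let ?F = "series q l (unit_seq 0)"
    have F: "?F \<in> Hl q l"
      by (simp add: series_in_Hl unit_seq_l2)
    \<comment> \<open>A resolvent applied to f_0 would give a square-summable h with (J - z) h = -
      kap e_0. It solves all rows but the first, hence is 0, and row 0 is contradicted.\<close>
    define h where "h = coords q l (R ?F)"
    have "R ?F \<in> Hl q l"
      using R(1) F by (auto simp: bounded_operator_def)
    then have h: "h \<in> l2"
      by (simp add: h_def Hl_iff)
    have "coords q l (I1 q l (R ?F) - fps_const \<zeta> * R ?F) n = unit_seq 0 n" for n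
      using R(2) F by (simp add: coords_series')
    then have eq: "- (J h n - ?z * h n) / kap = unit_seq 0 n" for n
      by (simp only: coords_I1_minus h_def)
    have "J h (Suc n) = ?z * h (Suc n)" for n
      using eq[of "Suc n"] kap_pos by (simp add: unit_seq_def)
    then have "h n = 0" for n
      by (intro no_decaying_solution assms(1) l2_tendsto_0 h)
    then show False
      using eq[of 0] by (simp add: J_def unit_seq_def)
  qed
  moreover have "p ?z \<notin> l2"
  proof
    assume "p ?z \<in> l2"
    then have "p ?z 0 = 0"
      by (intro no_decaying_solution assms(1) J_p l2_tendsto_0)
    then show False
      by simp
  qed
  have "\<exists>F\<in>Hl q l. Hl_norm q l (I1 q l F - fps_const \<zeta> * F - G) < e" if G: "G \<in> Hl q l" and e: "e > 0" for G e
  proof -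
    have "l2_adherent (range_sub ?z) (coords q l G)"
      using G by (intro dense_range \<open>p ?z \<notin> l2\<close>) (simp add: Hl_iff)
    then obtain v where v: "v \<in> range_sub ?z" "l2norm (\<lambda>n. v n - coords q l G n) < e"
      using e unfolding l2_adherent_def by blast
    then obtain u where u: "u \<in> l2" "v = (\<lambda>n. J u n - ?z * u n)"
      unfolding range_sub_def by blast
    \<comment> \<open>The factor - kap undoes \<open>I1\<close> - \<open>\<zeta>\<close> = - (J - z)
      / kap.\<close>
    let ?F = "series q l (\<lambda>n. - complex_of_real kap * u n)"
    have cF: "coords q l ?F = (\<lambda>n. - complex_of_real kap * u n)"
      by (simp add: coords_series' fun_eq_iff)
    have c: "coords q l (I1 q l ?F - fps_const \<zeta> * ?F) = v"
      unfolding coords_I1_minus cF J_scale u(2) using kap_pos by (simp add: fun_eq_iff field_simps)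
    have "v \<in> l2"
      using v(1) l2_subspace.sub_l2[OF range_subspace] by blast
    then have "I1 q l ?F - fps_const \<zeta> * ?F \<in> Hl q l"
      unfolding Hl_iff c .
    from Hl_norm_diff_series[OF this G]
    have "Hl_norm q l (I1 q l ?F - fps_const \<zeta> * ?F - G) < e"
      unfolding c using v(2) by simp
    moreover have "?F \<in> Hl q l"
      unfolding series_in_Hl by (rule l2_scale[OF u(1)])
    ultimately show ?thesis
      by blast
  qed
  ultimately show ?thesis
    unfolding continuous_spectrum_def using not_in_point_spectrum_unit_circle[OF assms] by blast
qed

text \<open>If \<open>\<kappa>\<close> were nonzero, the Green kernel times - kap would be a bounded
  inverse. So \<open>\<kappa>\<close> = 0, and \<open>\<psi>\<close> solves row 0 as well: it is an
  eigenvector and a nonzero multiple of p.\<close>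

lemma spectrum_unit_disc:
  fixes w \<zeta> :: complex
  assumes "w \<noteq> 0" "cmod w < 1" "2 * (1 - kap * \<zeta>) = w + 1 / w" "\<zeta> \<in> spectrum q l (I1 q l)"
  shows "\<zeta> \<in> point_spectrum q l (I1 q l) \<and> p (1 - kap * \<zeta>) \<in> l2"
proof -
  let ?z = "1 - kap * \<zeta>"
  obtain L where "jost sq bq (sqrt ((1 - A * B) * (1 - q))) ((A + B) / 2) (1 - kap * \<zeta>) w L (jost_sol w)"
    by (rule jost_jost_sol[OF _ assms(1,3)]) (use assms(2) in auto)
  then interpret jost sq bq "sqrt ((1 - A * B) * (1 - q))" "(A + B) / 2" "1 - kap * \<zeta>" w L "jost_sol w" .
  let ?\<psi> = "jost_sol w"
  have "\<kappa> = 0"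
  proof (rule ccontr)
    assume k: "\<kappa> \<noteq> 0"
    define R where "R F = series q l (\<lambda>n. - complex_of_real kap * green (coords q l F) n)" for F
    have cR: "coords q l (R F) = (\<lambda>n. - complex_of_real kap * green (coords q l F) n)" for F
      by (simp add: R_def coords_series' fun_eq_iff)
    obtain K where K: "\<And>g. g \<in> l2 \<Longrightarrow> green g \<in> l2 \<and> l2norm (green g) \<le> K * l2norm g"
      by (rule green_bounded[OF assms(2)]) blast
    have "bounded_operator q l R"
    proof (rule bounded_operatorI)
      show "coords q l (R F) n = - complex_of_real kap * green (coords q l F) n" for F n
        by (simp add: cR)
      show "- complex_of_real kap * green (\<lambda>n. u n + v n) n =
          - complex_of_real kap * green u n + - complex_of_real kap * green v n" if "u \<in> l2" "v \<in> l2" for u v n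
        using green_add[OF assms(2) that] by (simp add: algebra_simps)
      show "- complex_of_real kap * green (\<lambda>n. k * u n) n = k * (- complex_of_real kap * green u n)"
        if "u \<in> l2" for u k n
        using green_scale[OF assms(2) that] by simp
      fix u assume u: "u \<in> l2"
      have "l2norm (\<lambda>n. - complex_of_real kap * green u n) \<le> cmod (- complex_of_real kap) * l2norm (green u)"
        using K[OF u] by (intro l2norm_scale_le) simp
      also have "\<dots> \<le> kap * (K * l2norm u)"
        using K[OF u] kap_pos by (simp add: mult_left_mono)
      finally show "(\<lambda>n. - complex_of_real kap * green u n) \<in> l2 \<and>
          l2norm (\<lambda>n. - complex_of_real kap * green u n) \<le> (kap * K) * l2norm u"
        using l2_scale[OF conjunct1[OF K[OF u]]] by (simp only: mult.assoc simp_thms)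
    qed
    moreover have "R (I1 q l F - fps_const \<zeta> * F) = F \<and> I1 q l (R F) - fps_const \<zeta> * R F = F"
      if F: "F \<in> Hl q l" for F
    proof
      let ?u = "coords q l F"
      have u: "?u \<in> l2"
        using F by (simp add: Hl_iff)
      have d: "(\<lambda>n. J ?u n - ?z * ?u n) \<in> l2"
        by (intro l2_diff l2_scale J_l2 u)
      have c: "coords q l (I1 q l F - fps_const \<zeta> * F) = (\<lambda>n. (- 1 / complex_of_real kap) * (J ?u n - ?z * ?u n))"
        unfolding coords_I1_minus
        by (rule ext) (simp only: divide_inverse mult_minus_left mult_minus_right mult_1 mult.commute)
      show "R (I1 q l F - fps_const \<zeta> * F) = F"
        unfolding fps_eq_iff_coords cR c green_scale[OF assms(2) d] green_J[OF assms(2) k u]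
        using kap_pos by simp
      have "- (- complex_of_real kap * J (green ?u) n - ?z * (- complex_of_real kap * green ?u n)) / kap = ?u n" for n
      proof -
        have "- (- complex_of_real kap * J (green ?u) n - ?z * (- complex_of_real kap * green ?u n)) / kap
            = J (green ?u) n - ?z * green ?u n"
          using kap_pos by (simp add: field_simps)
        then show ?thesis
          using J_green[OF assms(2) k u, of n] by simp
      qed
      then show "I1 q l (R F) - fps_const \<zeta> * R F = F"
        unfolding fps_eq_iff_coords coords_I1_minus cR J_scale by blast
    qed
    ultimately have "\<zeta> \<notin> spectrum q l (I1 q l)"
      unfolding spectrum_def by blast
    with assms(4) show False
      by blast
  qed
  then have eig: "J ?\<psi> n = ?z * ?\<psi> n" for n
    by (cases n) (simp_all add: \<kappa>_def J_psi)
  let ?F = "series q l ?\<psi>"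
  have cF: "coords q l ?F = ?\<psi>"
    by (simp add: coords_series' fun_eq_iff)
  have "?F \<in> Hl q l"
    using psi_l2[OF assms(2)] by (simp add: series_in_Hl)
  moreover have "?F \<noteq> 0"
    using psi_ne_0 cF by (metis coords_def div_0 fps_zero_nth ext)
  moreover have "I1 q l ?F = fps_const \<zeta> * ?F"
    by (simp add: I1_eigen_iff cF eig)
  ultimately have "\<zeta> \<in> point_spectrum q l (I1 q l)"
    unfolding point_spectrum_def by blast
  have psi: "?\<psi> n = ?\<psi> 0 * p ?z n" for n
    by (rule J_eigen_unique[OF eig])
  have psi_0: "?\<psi> 0 \<noteq> 0"
  proof
    assume 0: "?\<psi> 0 = 0"
    have "?\<psi> n = 0" for n
      using psi[of n] unfolding 0 by simp
    then have "?\<psi> = (\<lambda>_. 0)"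
      by (rule ext)
    with psi_ne_0 show False
      by blast
  qed
  have "p ?z n = 1 / ?\<psi> 0 * ?\<psi> n" for n
    using psi[of n] psi_0 by simp
  then have "p ?z = (\<lambda>n. 1 / ?\<psi> 0 * ?\<psi> n)"
    by (rule ext)
  then have "p ?z \<in> l2"
    using l2_scale[OF psi_l2[OF assms(2)], of "1 / ?\<psi> 0"] by simp
  with \<open>\<zeta> \<in> point_spectrum q l (I1 q l)\<close> show ?thesis
    by blast
qed

text \<open>On the circle 1/w = cnj w, so 1 - kap \<open>\<zeta>\<close> = Re w runs through
  [-1, 1]; the right end point is 2 / kap.\<close>

lemma unit_circle_iff_interval:
  fixes \<zeta> :: complex
  shows "(\<exists>w. cmod w = 1 \<and> 2 * (1 - kap * \<zeta>) = w + 1 / w) \<longleftrightarrow> \<zeta> \<in> complex_of_real ` {0 .. 2 * q powr (1/2) / (1 - q)}"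
proof -
  have "q powr (1/2) * kap = 1 - q"
    using q_pos by (simp add: kap_def right_diff_distrib powr_add[symmetric])
  then have top: "2 * q powr (1/2) / (1 - q) = 2 / kap"
    using kap_pos q_less by (simp add: field_simps)
  show ?thesis
    unfolding top
  proof
    assume "\<exists>w. cmod w = 1 \<and> 2 * (1 - kap * \<zeta>) = w + 1 / w"
    then obtain w where w: "cmod w = 1" "2 * (1 - kap * \<zeta>) = w + 1 / w"
      by blast
    have "1 / w = cnj w"
      using w(1) by (simp add: divide_conv_cnj)
    then have "2 * (1 - kap * \<zeta>) = 2 * complex_of_real (Re w)"
      using w(2) by (simp add: complex_add_cnj)
    then have "1 - kap * \<zeta> = complex_of_real (Re w)"
      by (simp only: mult_cancel_left) simp
    then have "kap * \<zeta> = complex_of_real (1 - Re w)"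
      by (simp add: algebra_simps)
    then have "\<zeta> = complex_of_real ((1 - Re w) / kap)"
      using kap_pos by (simp add: field_simps)
    moreover have "(1 - Re w) / kap \<in> {0..2 / kap}"
      using w(1) abs_Re_le_cmod[of w] kap_pos by (auto intro!: divide_right_mono)
    ultimately show "\<zeta> \<in> complex_of_real ` {0..2 / kap}"
      by blast
  next
    assume "\<zeta> \<in> complex_of_real ` {0..2 / kap}"
    then obtain x where x: "\<zeta> = complex_of_real x" "0 \<le> x" "kap * x \<le> 2"
      using kap_pos by (auto simp: field_simps)
    let ?w = "cis (arccos (1 - kap * x))"
    have "0 \<le> kap * x"
      using x kap_pos by simp
    then have c: "cos (arccos (1 - kap * x)) = 1 - kap * x"
      using x(3) by (intro cos_arccos) auto
    have "?w + 1 / ?w = ?w + cnj ?w"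
      by (simp add: divide_conv_cnj)
    also have "\<dots> = complex_of_real (2 * (1 - kap * x))"
      unfolding complex_add_cnj using c by simp
    finally show "\<exists>w. cmod w = 1 \<and> 2 * (1 - kap * \<zeta>) = w + 1 / w"
      using x(1) by (intro exI[of _ ?w]) simp
  qed
qed

text \<open>A spectral point off the circle is an eigenvalue and therefore excluded by definition,
  so the extra eigenvalue for l < 1/4 does no harm.\<close>

lemma continuous_spectrum_I1:
  "continuous_spectrum q l (I1 q l) = complex_of_real ` {0 .. 2 * q powr (1/2) / (1 - q)}"
proof (intro set_eqI)
  fix \<zeta> :: complex
  obtain w where w: "w \<noteq> 0" "cmod w \<le> 1" "2 * (1 - kap * \<zeta>) = w + 1 / w"
    by (rule joukowski_root)
  show "\<zeta> \<in> continuous_spectrum q l (I1 q l) \<longleftrightarrow> \<zeta> \<in> complex_of_real ` {0 .. 2 * q powr (1/2) / (1 - q)}"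
    unfolding unit_circle_iff_interval[symmetric]
  proof
    assume c: "\<zeta> \<in> continuous_spectrum q l (I1 q l)"
    have "\<not> cmod w < 1"
      using spectrum_unit_disc[OF w(1) _ w(3)] c by (auto simp: continuous_spectrum_def)
    then show "\<exists>w. cmod w = 1 \<and> 2 * (1 - kap * \<zeta>) = w + 1 / w"
      using w by (intro exI[of _ w]) auto
  next
    assume "\<exists>w. cmod w = 1 \<and> 2 * (1 - kap * \<zeta>) = w + 1 / w"
    then show "\<zeta> \<in> continuous_spectrum q l (I1 q l)"
      using continuous_spectrum_unit_circle by blast
  qed
qed

text \<open>An eigenvector is a nonzero multiple of p in coordinates, so it would make p
  square-summable.\<close>

lemma point_spectrum_empty:
  assumes "1/4 \<le> l"
  shows "point_spectrum q l (I1 q l) = {}"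
proof (intro equals0I)
  fix \<zeta> assume pt: "\<zeta> \<in> point_spectrum q l (I1 q l)"
  obtain w where w: "w \<noteq> 0" "cmod w \<le> 1" "2 * (1 - kap * \<zeta>) = w + 1 / w"
    by (rule joukowski_root)
  show False
  proof (cases "cmod w = 1")
    case True
    then show False
      using not_in_point_spectrum_unit_circle[OF True w(3)] pt by blast
  next
    case False
    obtain F where F: "F \<in> Hl q l" "F \<noteq> 0" "I1 q l F = fps_const \<zeta> * F"
      using pt unfolding point_spectrum_def by blast
    let ?u = "coords q l F"
    have u: "?u n = ?u 0 * p (1 - kap * \<zeta>) n" for n
      using F(3) unfolding I1_eigen_iff by (intro J_eigen_unique) blast
    have "?u 0 \<noteq> 0"
    proof
      assume 0: "?u 0 = 0"
      have "?u n = 0" for n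
        using u[of n] unfolding 0 by simp
      then have "F = 0"
        unfolding fps_eq_iff_coords by (simp add: coords_def)
      with F(2) show False ..
    qed
    then have "p (1 - kap * \<zeta>) n = 1 / ?u 0 * ?u n" for n
      using u[of n] by simp
    then have "p (1 - kap * \<zeta>) = (\<lambda>n. 1 / ?u 0 * ?u n)"
      by (rule ext)
    then have "p (1 - kap * \<zeta>) \<in> l2"
      using l2_scale[of ?u "1 / ?u 0"] F(1) by (simp add: Hl_iff)
    then show False
      using p_not_l2[OF assms w(1) _ w(3)] False w(2) by simp
  qed
qed

lemma spectrum_I1:
  assumes "1/4 \<le> l"
  shows "spectrum q l (I1 q l) = complex_of_real ` {0 .. 2 * q powr (1/2) / (1 - q)}"
proof (intro equalityI subsetI)
  fix \<zeta> assume s: "\<zeta> \<in> spectrum q l (I1 q l)"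
  obtain w where w: "w \<noteq> 0" "cmod w \<le> 1" "2 * (1 - kap * \<zeta>) = w + 1 / w"
    by (rule joukowski_root)
  have "cmod w = 1"
    using spectrum_unit_disc[OF w(1) _ w(3) s] point_spectrum_empty[OF assms] w(2) by force
  with w(3) show "\<zeta> \<in> complex_of_real ` {0 .. 2 * q powr (1/2) / (1 - q)}"
    unfolding unit_circle_iff_interval[symmetric] by blast
next
  fix \<zeta> assume "\<zeta> \<in> complex_of_real ` {0 .. 2 * q powr (1/2) / (1 - q)}"
  then show "\<zeta> \<in> spectrum q l (I1 q l)"
    unfolding continuous_spectrum_I1[symmetric] continuous_spectrum_def by blast
qed

section \<open>The expansion and the uniqueness of the generalized eigenfunctions\<close>

lemma eval_fbasis: "eval_fps (fbasis q l n) x = complex_of_real (basis_coeff q l n) * x ^ n"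
  using basis_coeff_pos[OF q_pos q_less l_pos, of n]
  by (simp add: fbasis_def eval_fps_mult fps_conv_radius_cmult_left)

text \<open>The factor g_n of \<open>basis_coeff\<close> turns p into Q, and its power of q rescales
  x to the variable t of the generating function.\<close>

lemma fbasis_term:
  "p z n * eval_fps (fbasis q l n) x = Q z n * (of_real (q powr ((1 - 2*l)/4)) * x) ^ n"
proof -
  have "q powr ((1 - 2*l) * real n / 4) = (q powr ((1 - 2*l)/4)) ^ n"
    using q_pos by (simp add: powr_realpow[symmetric] powr_powr)
  then have "basis_coeff q l n = (q powr ((1 - 2*l)/4)) ^ n * g n"
    by (simp add: basis_coeff_def g_def AB_eq)
  then show ?thesis
    unfolding eval_fbasis by (simp add: Q_def power_mult_distrib mult_ac)
qed

lemma xi_sums: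
  assumes "cmod x < q powr ((2*l - 1)/4)"
  shows "(\<lambda>n. p (complex_of_real (cos \<theta>)) n * eval_fps (fbasis q l n) x) sums xi q l \<theta> x"
proof -
  define r t where "r = q powr ((1 - 2*l)/4)" and "t = complex_of_real r * x"
  let ?u = "exp (\<i> * complex_of_real \<theta>)" and ?v = "exp (- \<i> * complex_of_real \<theta>)"
  have uv: "cmod ?u = 1" "?u * ?v = 1" "?u + ?v = 2 * complex_of_real (cos \<theta>)" "cmod ?v = 1"
    by (simp_all add: exp_add[symmetric] cos_of_real[symmetric] cos_exp_eq)
  have r: "r > 0" "r * q powr ((2*l - 1)/4) = 1"
    using q_pos by (simp_all add: r_def powr_add[symmetric] add_divide_distrib[symmetric])
  have t: "cmod t < 1"
    using mult_strict_left_mono[OF assms r(1)] r by (simp add: t_def norm_mult)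
  have "ereal (cmod t) < fps_conv_radius (genfun (complex_of_real (cos \<theta>)))"
    using fps_conv_radius_genfun_ge_1[OF uv(1-3)] t by (metis ereal_less(3) less_le_trans)
  from sums_eval_fps[OF this]
  have "(\<lambda>n. p (complex_of_real (cos \<theta>)) n * eval_fps (fbasis q l n) x) sums
      eval_fps (genfun (complex_of_real (cos \<theta>))) t"
    unfolding fbasis_term by (simp add: genfun_def t_def r_def)
  moreover have "eval_fps (genfun (complex_of_real (cos \<theta>))) t = xi q l \<theta> x"
  proof -
    \<comment> \<open>The exponents are (l - 1/4) + (1 - 2l)/4 = l/2 and (l + 1/4) + (1 - 2l)/4 = (l
      + 1)/2.\<close>
    have "A * r = q powr (l/2)" "B * r = q powr ((l + 1)/2)"
      unfolding A_def B_def r_def powr_add[symmetric]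
      by (rule arg_cong[where f = "\<lambda>y. q powr y"]; simp add: field_simps)+
    then have AB: "of_real A * t = of_real (q powr (l/2)) * x" "of_real B * t = of_real (q powr ((l + 1)/2)) * x"
      by (simp_all add: t_def mult.assoc[symmetric] flip: of_real_mult)
    have ut: "of_real r * ?u * x = ?u * t" "of_real r * ?v * x = ?v * t"
      by (simp_all add: t_def)
    have "cmod (?u * t) < 1" "cmod (?v * t) < 1"
      unfolding norm_mult uv(1,4) using t by simp_all
    then have "qpoch_inf (?u * t) q \<noteq> 0" "qpoch_inf (?v * t) q \<noteq> 0"
      using q_pos q_less by (simp_all add: qpoch_inf_ne_0)
    then show ?thesis
      using genfun_product[OF uv(1-3) t]
      unfolding xi_def r_def[symmetric] ut AB[symmetric] by (simp add: field_simps)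
  qed
  ultimately show ?thesis
    by simp
qed

text \<open>Convergence to xi on a whole disc gives both the positive radius and the agreement near
  0; this is what lets the formal action of \<open>I1\<close> be applied to the function xi.\<close>

lemma xi_has_fps_expansion:
  "xi q l \<theta> has_fps_expansion series q l (p (complex_of_real (cos \<theta>)))"
proof -
  let ?S = "series q l (p (complex_of_real (cos \<theta>)))"
  define \<rho> where "\<rho> = q powr ((2*l - 1)/4)"
  have \<rho>: "\<rho> > 0"
    using q_pos by (simp add: \<rho>_def)
  have sums: "(\<lambda>n. fps_nth ?S n * x ^ n) sums xi q l \<theta> x" if "cmod x < \<rho>" for x
  proof -
    have "fps_nth ?S n * x ^ n = p (complex_of_real (cos \<theta>)) n * eval_fps (fbasis q l n) x" for n
      unfolding eval_fbasis by (simp only: series_def fps_nth_Abs_fps mult.assoc)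
    then show ?thesis
      using xi_sums[of x \<theta>] that by (simp add: \<rho>_def)
  qed
  have "cmod (complex_of_real (\<rho> / 2)) < \<rho>"
    using \<rho> by simp
  from sums_summable[OF sums[OF this]]
  have "norm (complex_of_real (\<rho> / 2)) \<le> fps_conv_radius ?S"
    unfolding fps_conv_radius_def by (rule conv_radius_geI)
  moreover have "0 < ereal (norm (complex_of_real (\<rho> / 2)))"
    using \<rho> by simp
  ultimately have "0 < fps_conv_radius ?S"
    by (rule less_le_trans[rotated])
  have "eval_fps ?S x = xi q l \<theta> x" if "cmod x < \<rho>" for x
    using sums[OF that] unfolding eval_fps_def by (rule sums_unique[symmetric])
  then have "\<forall>\<^sub>F x in nhds 0. eval_fps ?S x = xi q l \<theta> x"
    unfolding eventually_nhds_metric using \<rho> by (intro exI[of _ \<rho>]) simp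
  with \<open>0 < fps_conv_radius ?S\<close> show ?thesis
    by (simp add: has_fps_expansion_def)
qed

lemma I1_eigenfunction:
  fixes \<mu> :: real
  assumes "z = complex_of_real (1 - kap * \<mu>)"
  shows "I1 q l (series q l (p z)) = fps_const (complex_of_real \<mu>) * series q l (p z)"
    and "I1 q l F = fps_const (complex_of_real \<mu>) * F \<Longrightarrow> \<exists>c. F = fps_const c * series q l (p z)"
proof -
  have z: "1 - kap * complex_of_real \<mu> = z"
    using assms by simp
  have c: "coords q l (series q l (p z)) = p z"
    by (simp add: coords_series' fun_eq_iff)
  show "I1 q l (series q l (p z)) = fps_const (complex_of_real \<mu>) * series q l (p z)"
    unfolding I1_eigen_iff z c by (simp add: J_p)
  assume "I1 q l F = fps_const (complex_of_real \<mu>) * F"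
  then have "coords q l F n = coords q l F 0 * p z n" for n
    unfolding I1_eigen_iff z by (intro J_eigen_unique) blast
  then have "F = fps_const (coords q l F 0) * series q l (p z)"
    unfolding fps_eq_iff_coords coords_const_mult c by blast
  then show "\<exists>c. F = fps_const c * series q l (p z)" ..
qed

end

theorem theorem1:
  fixes q l :: real
  assumes "0 < q" and "q < 1" and "0 < l"
  shows
    "bounded_selfadjoint q l (I1 q l) \<and>
     simple_spectrum q l (I1 q l) \<and>
     continuous_spectrum q l (I1 q l) = complex_of_real ` {0 .. 2 * q powr (1/2) / (1 - q)} \<and>
     (1/4 \<le> l \<longrightarrow>
        spectrum q l (I1 q l) = complex_of_real ` {0 .. 2 * q powr (1/2) / (1 - q)} \<and>
        point_spectrum q l (I1 q l) = {}) \<and>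
     (\<forall>\<theta> \<mu> :: real. \<mu> = (1 - cos \<theta>) / (q powr (-1/2) - q powr (1/2)) \<longrightarrow>
        (\<forall>x. cmod x < q powr ((2*l - 1)/4) \<longrightarrow>
           (\<lambda>n. p_coeff q l n \<mu> * eval_fps (fbasis q l n) x) sums xi q l \<theta> x) \<and>
        (\<exists>\<Xi>. xi q l \<theta> has_fps_expansion \<Xi> \<and>
           \<Xi> = series q l (\<lambda>n. p_coeff q l n \<mu>) \<and>
           I1 q l \<Xi> = fps_const (complex_of_real \<mu>) * \<Xi> \<and>
           (\<forall>F. I1 q l F = fps_const (complex_of_real \<mu>) * F \<longrightarrow> (\<exists>c. F = fps_const c * \<Xi>))))"
proof -
  interpret q_laguerre q l
    by standard (rule assms)+
  have eigen: "(\<forall>x. cmod x < q powr ((2*l - 1)/4) \<longrightarrow>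
           (\<lambda>n. p_coeff q l n \<mu> * eval_fps (fbasis q l n) x) sums xi q l \<theta> x) \<and>
        (\<exists>\<Xi>. xi q l \<theta> has_fps_expansion \<Xi> \<and>
           \<Xi> = series q l (\<lambda>n. p_coeff q l n \<mu>) \<and>
           I1 q l \<Xi> = fps_const (complex_of_real \<mu>) * \<Xi> \<and>
           (\<forall>F. I1 q l F = fps_const (complex_of_real \<mu>) * F \<longrightarrow> (\<exists>c. F = fps_const c * \<Xi>)))"
    if \<mu>: "\<mu> = (1 - cos \<theta>) / (q powr (-1/2) - q powr (1/2))" for \<theta> \<mu> :: real
  proof -
    let ?z = "complex_of_real (cos \<theta>)"
    have cos: "cos \<theta> = 1 - kap * \<mu>"
      using \<mu> kap_pos by (simp add: kap_def)
    have pc: "(\<lambda>n. p_coeff q l n \<mu>) = p ?z"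
      by (rule ext) (simp only: p_coeff_eq cos kap_def)
    have z: "?z = complex_of_real (1 - kap * \<mu>)"
      by (simp only: cos)
    show ?thesis
      unfolding fun_cong[OF pc] pc
      using xi_sums[of _ \<theta>] xi_has_fps_expansion[of \<theta>] I1_eigenfunction[OF z] by blast
  qed
  then show ?thesis
    using bounded_selfadjoint_I1 simple_spectrum_I1 continuous_spectrum_I1 spectrum_I1 point_spectrum_empty
    by blast
qed

end
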